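(* Let $G$ be a locally compact, $\sigma$-compact abelian group whose topology has a countable basis, let $(X,G,m)$ be an ergodic dynamical system, and let $(B_n)$ be a van Hove sequence in $G$ along which the Birkhoff ergodic theorem holds. Then the following assertions are equivalent. (i) The dynamical system $(X,G,m)$ has discrete spectrum. (ii) For every $f\in C(X)$ the function $\Phi^f_x:G\to\mathbb{C}$, $\Phi^f_x(t)=f(\alpha_{-t}x)$, is mean almost periodic (with respect to $(B_n)$) for $m$-almost every $x\in X$.
   Context: $G$ is written additively, with Haar measure $m_G$ (also written $|\cdot|$) and dual group $\widehat{G}$. A dynamical system $(X,G,m)$ consists of a compact (Hausdorff) space $X$ with a continuous action $(t,x)\mapsto\alpha_t(x)$ of $G$ and a $G$-invariant (Radon) probability measure $m$ on $X$; it is ergodic if every invariant measurable set has measure $0$ or $1$. With $\langle f,g\rangle=\int_X f\overline g\,dm$ and $T_tf=f\circ\alpha_{-t}$, the spectral measure of $f\in L^2(X,m)$ is the unique finite measure $\varrho^f$ on $\widehat{G}$ with $\langle T_tf,f\rangle=\int_{\widehat{G}}\eta(t)\,d\varrho^f(\eta)$ for all $t\in G$. The system has discrete spectrum if $\varrho^f$ is a pure point measure for every $f\in L^2(X,m)$. A sequence $(B_n)$ of compact subsets of $G$ (of positive Haar measure) is a van Hove sequence if $\lim_{n\to\infty}|\partial^KB_n|/|B_n|=0$ for every compact $K\subset G$, where $\partial^KB:=\overline{((B+K)\setminus B)}\cup((\overline{G\setminus B}-K)\cap B)$. The Birkhoff ergodic theorem holds along $(B_n)$ if for every $F\in L^1(X,m)$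 one has $\frac{1}{m_G(B_n)}\int_{B_n}F(\alpha_{-t}x)\,dm_G(t)\to\int_XF\,dm$ for $m$-almost every $x\in X$. For a bounded measurable function $h$ on $G$ put $\overline{M}(h)=\limsup_{n\to\infty}\frac{1}{m_G(B_n)}\int_{B_n}|h(s)|\,dm_G(s)$. A set $A\subset G$ is relatively dense if $G=\bigcup_{a\in A}(a+K)$ for some compact $K\subset G$. A bounded uniformly continuous $h:G\to\mathbb{C}$ is mean almost periodic if for every $\varepsilon>0$ the set $\{t\in G:\overline{M}(h-h(t+\cdot))<\varepsilon\}$ is relatively dense in $G$. *)

theory Defs
  imports "HOL-Probability.Probability"
begin

section \<open>Groups, Haar measure and the dual group\<close>

definition sigma_compact_space :: "'a::topological_space itself \<Rightarrow> bool" where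
  "sigma_compact_space _ \<longleftrightarrow> (\<exists>K :: nat \<Rightarrow> 'a set. (\<forall>n. compact (K n)) \<and> (\<Union>n. K n) = UNIV)"

definition radon_measure :: "'a::t2_space measure \<Rightarrow> bool" where
  "radon_measure M \<longleftrightarrow>
     sets M = sets borel \<and>
     (\<forall>K. compact K \<longrightarrow> emeasure M K < \<infinity>) \<and>
     (\<forall>A\<in>sets M. emeasure M A = (INF U\<in>{U. open U \<and> A \<subseteq> U}. emeasure M U)) \<and>
     (\<forall>U. open U \<longrightarrow> emeasure M U = (SUP K\<in>{K. compact K \<and> K \<subseteq> U}. emeasure M K))"

definition haar_measure :: "'g::{topological_ab_group_add, t2_space} measure \<Rightarrow> bool" where
  "haar_measure mG \<longleftrightarrow>
     radon_measure mG \<and> emeasure mG UNIV \<noteq> 0 \<and>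
     (\<forall>t. \<forall>A\<in>sets mG. emeasure mG ((+) t ` A) = emeasure mG A)"

definition dual_group :: "('g::topological_ab_group_add \<Rightarrow> complex) set" where
  "dual_group = {\<eta>. continuous_on UNIV \<eta> \<and> (\<forall>t. norm (\<eta> t) = 1) \<and>
                    (\<forall>s t. \<eta> (s + t) = \<eta> s * \<eta> t)}"

text \<open>The compact-open topology. Taking the compact set to be empty shows that the whole dual
  group is open, so the generated topology has the dual group as its underlying set.\<close>

definition dual_topology :: "('g::topological_ab_group_add \<Rightarrow> complex) topology" where
  "dual_topology = topology_generated_by
     {{\<eta> \<in> dual_group. \<eta> ` K \<subseteq> U} | K U. compact K \<and> open U}"

lemma topspace_dual_topology: "topspace dual_topology = dual_group"
  unfolding dual_topology_def topology_generated_by_topspace by force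

definition dual_borel_sets :: "('g::topological_ab_group_add \<Rightarrow> complex) set set" where
  "dual_borel_sets = sigma_sets dual_group {U. openin dual_topology U}"

section \<open>Dynamical systems\<close>

definition dynamical_system ::
  "('g::{topological_ab_group_add, t2_space} \<Rightarrow> 'x::t2_space \<Rightarrow> 'x) \<Rightarrow> 'x measure \<Rightarrow> bool" where
  "dynamical_system \<alpha> m \<longleftrightarrow>
     compact (UNIV :: 'x set) \<and>
     (\<forall>x. \<alpha> 0 x = x) \<and> (\<forall>s t x. \<alpha> (s + t) x = \<alpha> s (\<alpha> t x)) \<and>
     continuous_on UNIV (\<lambda>(t, x). \<alpha> t x) \<and>
     radon_measure m \<and> prob_space m \<and>
     (\<forall>t. \<forall>A\<in>sets m. emeasure m (\<alpha> t -` A) = emeasure m A)"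

definition ergodic_system ::
  "('g::{topological_ab_group_add, t2_space} \<Rightarrow> 'x::t2_space \<Rightarrow> 'x) \<Rightarrow> 'x measure \<Rightarrow> bool" where
  "ergodic_system \<alpha> m \<longleftrightarrow>
     dynamical_system \<alpha> m \<and>
     (\<forall>A\<in>sets m. (\<forall>t. \<alpha> t ` A = A) \<longrightarrow> measure m A = 0 \<or> measure m A = 1)"

section \<open>Spectral measures and discrete spectrum\<close>

definition L2_functions :: "'x measure \<Rightarrow> ('x \<Rightarrow> complex) set" where
  "L2_functions m = {f \<in> borel_measurable m. integrable m (\<lambda>x. (norm (f x))\<^sup>2)}"

text \<open>For a locally compact second countable group exactly one measure has this property
  (Bochner's theorem and injectivity of the Fourier transform; all finite Borel measures on the
  dual group are then Radon). So \<open>discrete_spectrum\<close> below says that the spectral measure of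
  every \<open>f\<close> is pure point.\<close>

definition is_spectral_measure ::
  "('g::topological_ab_group_add \<Rightarrow> 'x \<Rightarrow> 'x) \<Rightarrow> 'x measure \<Rightarrow> ('x \<Rightarrow> complex) \<Rightarrow>
     ('g \<Rightarrow> complex) measure \<Rightarrow> bool" where
  "is_spectral_measure \<alpha> m f \<rho> \<longleftrightarrow>
     space \<rho> = dual_group \<and> sets \<rho> = dual_borel_sets \<and> finite_measure \<rho> \<and>
     (\<forall>t. (LINT x|m. f (\<alpha> (- t) x) * cnj (f x)) = (LINT \<eta>|\<rho>. \<eta> t))"

definition pure_point_measure :: "'a measure \<Rightarrow> bool" where
  "pure_point_measure \<rho> \<longleftrightarrow>
     (\<forall>A\<in>sets \<rho>. emeasure \<rho> A = (\<Sum>\<^sub>\<infinity>x\<in>A. emeasure \<rho> {x}))"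

definition discrete_spectrum ::
  "('g::topological_ab_group_add \<Rightarrow> 'x \<Rightarrow> 'x) \<Rightarrow> 'x measure \<Rightarrow> bool" where
  "discrete_spectrum \<alpha> m \<longleftrightarrow>
     (\<forall>f\<in>L2_functions m. \<exists>\<rho>. is_spectral_measure \<alpha> m f \<rho> \<and> pure_point_measure \<rho>)"

section \<open>Van Hove sequences and averages\<close>

definition van_hove_boundary ::
  "'g::topological_ab_group_add set \<Rightarrow> 'g set \<Rightarrow> 'g set" where
  "van_hove_boundary K B =
     closure ({b + k | b k. b \<in> B \<and> k \<in> K} - B) \<union>
     ({c - k | c k. c \<in> closure (- B) \<and> k \<in> K} \<inter> B)"

definition van_hove_sequence ::
  "'g::{topological_ab_group_add, t2_space} measure \<Rightarrow> (nat \<Rightarrow> 'g set) \<Rightarrow> bool" where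
  "van_hove_sequence mG B \<longleftrightarrow>
     (\<forall>n. compact (B n) \<and> measure mG (B n) > 0) \<and>
     (\<forall>K. compact K \<longrightarrow>
        (\<lambda>n. measure mG (van_hove_boundary K (B n)) / measure mG (B n)) \<longlonglongrightarrow> 0)"

definition birkhoff_along ::
  "'g::topological_ab_group_add measure \<Rightarrow> (nat \<Rightarrow> 'g set) \<Rightarrow>
     ('g \<Rightarrow> 'x \<Rightarrow> 'x) \<Rightarrow> 'x measure \<Rightarrow> bool" where
  "birkhoff_along mG B \<alpha> m \<longleftrightarrow>
     (\<forall>F :: 'x \<Rightarrow> complex. integrable m F \<longrightarrow>
        (AE x in m.
           (\<lambda>n. (LINT t:B n|mG. F (\<alpha> (- t) x)) /\<^sub>R measure mG (B n))
             \<longlonglongrightarrow> (LINT y|m. F y)))"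

section \<open>Mean almost periodicity\<close>

definition upper_mean ::
  "'g measure \<Rightarrow> (nat \<Rightarrow> 'g set) \<Rightarrow> ('g \<Rightarrow> complex) \<Rightarrow> ereal" where
  "upper_mean mG B h =
     limsup (\<lambda>n. ereal ((LINT s:B n|mG. norm (h s)) / measure mG (B n)))"

definition relatively_dense :: "'g::topological_ab_group_add set \<Rightarrow> bool" where
  "relatively_dense A \<longleftrightarrow> (\<exists>K. compact K \<and> (\<Union>a\<in>A. (+) a ` K) = UNIV)"

text \<open>Uniform continuity with respect to the group uniformity, expressed through neighbourhoods
  of \<open>0\<close> because a topological group type carries no \<open>uniformity\<close> of its own.\<close>

definition group_uniformly_continuous ::
  "('g::topological_ab_group_add \<Rightarrow> complex) \<Rightarrow> bool" where
  "group_uniformly_continuous h \<longleftrightarrow>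
     (\<forall>\<epsilon>>0. \<forall>\<^sub>F u in nhds 0. \<forall>t. norm (h (t + u) - h t) < \<epsilon>)"

definition mean_almost_periodic ::
  "'g::topological_ab_group_add measure \<Rightarrow> (nat \<Rightarrow> 'g set) \<Rightarrow> ('g \<Rightarrow> complex) \<Rightarrow> bool" where
  "mean_almost_periodic mG B h \<longleftrightarrow>
     bounded (range h) \<and> group_uniformly_continuous h \<and>
     (\<forall>\<epsilon>>0. relatively_dense {t. upper_mean mG B (\<lambda>s. h s - h (t + s)) < ereal \<epsilon>})"

end

theory Submission
  imports Defs
begin

text \<open>Put \<open>\<Phi> t = f (\<alpha> (- t) x)\<close>. The Birkhoff theorem for a countable dense set of \<open>t\<close> and the uniform
  continuity of \<open>f\<close> along orbits show that for almost every \<open>x\<close> the upper mean of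
  \<open>\<Phi> - \<Phi> (t + _)\<close> is the \<open>L\<^sup>1\<close>-distance between \<open>f\<close> and its translate by \<open>t\<close>, for all \<open>t\<close> at once.
  So mean almost periodicity of typical orbits is almost periodicity of \<open>t \<mapsto> T\<^sub>t f\<close> in \<open>L\<^sup>1\<close> or,
  \<open>f\<close> being bounded, in \<open>L\<^sup>2\<close>.

  If the spectral measure of \<open>f\<close> is pure point, finitely many characters carry it up to a small
  error, and finitely many characters are simultaneously close to 1 on a relatively dense set.

  Conversely, by density of the continuous functions in \<open>L\<^sup>2\<close>, every correlation function
  \<open>\<phi> t = \<langle>T\<^sub>t f, f\<rangle>\<close> is a positive definite function with totally bounded translates. It has to be
  a sum of characters with nonnegative coefficients, the masses of the spectral measure.
  Subtracting from \<open>\<phi>\<close> its Fourier part with respect to the invariant mean leaves a positive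
  definite remainder without Fourier coefficients, so it suffices to find one character with
  nonzero coefficient in any such \<open>\<phi> \<noteq> 0\<close>. It arises as an extreme point of a compact
  convex set of positive definite functions.\<close>

section \<open>Invariant means\<close>

text \<open>What has to be produced is a continuous character, starting from one positive definite
  \<phi>. All control comes from the gauge \<open>Re (\<phi> 0) - Re (\<phi> t)\<close>: Krein's
  inequality turns a bound on this defect into a modulus of continuity, almost periodicity makes the
  gauge totally bounded, and its smallness near 0 makes the characters found continuous on the
  group. Positive definite functions whose defect is at most \<open>C\<close> times the gauge form a
  family compact for pointwise convergence, and there pointwise convergence is uniform, so means
  depend continuously on the function. For functions continuous in the gauge, means by finite
  averages exist by total boundedness alone.

  An extreme point among all normalised positive definite functions may be a character that has
  nothing to do with \<phi>. The convex set is therefore cut down by asking that convolution with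
  \<phi> dominate \<kappa> times the function, with \<kappa> > 0 fixed. This forces membership in
  the compact family, is stable under the operations that split a function into positive definite
  parts, and leaves the extreme point with a coefficient of at least \<kappa> in \<phi>.\<close>

definition translate_average ::
  "'g::ab_group_add list \<Rightarrow> ('g \<Rightarrow> 'b::real_normed_vector) \<Rightarrow> 'g \<Rightarrow> 'b" where
  "translate_average xs h t = (\<Sum>s\<leftarrow>xs. h (t + s)) /\<^sub>R real (length xs)"

text \<open>Neither a measure nor a topology on the group is involved. Lists may repeat entries, so
  that a composite of two averages is again an average over a list.\<close>

definition has_mean :: "('g::ab_group_add \<Rightarrow> 'b::real_normed_vector) \<Rightarrow> 'b \<Rightarrow> bool" where
  "has_mean h c \<longleftrightarrow>
     (\<forall>\<epsilon>>0. \<exists>xs. xs \<noteq> [] \<and> (\<forall>t. norm (translate_average xs h t - c) \<le> \<epsilon>))"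

definition mean :: "('g::ab_group_add \<Rightarrow> 'b::real_normed_vector) \<Rightarrow> 'b" where
  "mean h = (THE c. has_mean h c)"

lemma sum_list_scaleR:
  "(\<Sum>x\<leftarrow>xs. c *\<^sub>R f x) = c *\<^sub>R (\<Sum>x\<leftarrow>xs. f x :: 'b::real_vector)"
  by (induction xs) (simp_all add: scaleR_add_right)

lemma translate_average_const:
  "xs \<noteq> [] \<Longrightarrow> translate_average xs (\<lambda>_. c) t = c"
proof -
  have "(\<Sum>s\<leftarrow>ys. c) = real (length ys) *\<^sub>R c" for ys :: "'a list"
    by (induction ys) (simp_all add: scaleR_add_left)
  then show "xs \<noteq> [] \<Longrightarrow> translate_average xs (\<lambda>_. c) t = c"
    by (simp add: translate_average_def)
qed

lemma translate_average_add:
  "translate_average xs (\<lambda>t. h t + k t) t = translate_average xs h t + translate_average xs k t"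
  by (simp add: translate_average_def sum_list_addf scaleR_add_right)

lemma translate_average_linear:
  assumes "bounded_linear L"
  shows "translate_average xs (\<lambda>t. L (h t)) t = L (translate_average xs h t)"
proof -
  interpret bounded_linear L by fact
  have "(\<Sum>s\<leftarrow>xs. L (h (t + s))) = L (\<Sum>s\<leftarrow>xs. h (t + s))"
    by (induction xs) (simp_all add: zero add)
  then show ?thesis by (simp add: translate_average_def scaleR)
qed

text \<open>Commutativity of the group enters here. Exchanging two averages is what allows one list
  to serve two functions, on which uniqueness and additivity of the mean rest.\<close>

lemma translate_average_commute:
  "translate_average xs (translate_average ys h) t = translate_average ys (translate_average xs h) t"
proof -
  have "(\<Sum>s\<leftarrow>xs. \<Sum>r\<leftarrow>ys. h (t + s + r)) = (\<Sum>r\<leftarrow>ys. \<Sum>s\<leftarrow>xs. h (t + r + s))"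
    by (induction xs) (simp_all add: sum_list_addf add.assoc add.commute add.left_commute)
  then show ?thesis
    by (simp add: translate_average_def sum_list_scaleR mult.commute)
qed

lemma translate_average_compose:
  "translate_average xs (translate_average ys h) t =
   translate_average (concat (map (\<lambda>x. map ((+) x) ys) xs)) h t"
proof -
  have "(\<Sum>s\<leftarrow>xs. \<Sum>r\<leftarrow>ys. h (t + s + r)) =
      (\<Sum>s\<leftarrow>concat (map (\<lambda>x. map ((+) x) ys) xs). h (t + s))"
    by (induction xs) (simp_all add: o_def add.assoc)
  moreover have "length (concat (map (\<lambda>x. map ((+) x) ys) xs)) = length xs * length ys"
    by (induction xs) simp_all
  ultimately show ?thesis
    by (simp add: translate_average_def sum_list_scaleR)
qed

lemma norm_sum_list_le:
  assumes "\<And>x. x \<in> set xs \<Longrightarrow> norm (f x) \<le> \<epsilon>"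
  shows "norm (\<Sum>x\<leftarrow>xs. f x :: 'b::real_normed_vector) \<le> real (length xs) * \<epsilon>"
  using assms
proof (induction xs)
  case (Cons a xs)
  then have "norm (f a) \<le> \<epsilon>" "norm (\<Sum>x\<leftarrow>xs. f x) \<le> real (length xs) * \<epsilon>" by auto
  then show ?case
    by (simp add: algebra_simps) (metis add_mono_thms_linordered_semiring(1) norm_triangle_le)
qed simp

lemma translate_average_diff_le:
  assumes "xs \<noteq> []" "\<And>s. s \<in> set xs \<Longrightarrow> norm (h (t + s) - k (u + s)) \<le> \<epsilon>"
  shows "norm (translate_average xs h t - translate_average xs k u) \<le> \<epsilon>"
proof -
  have "translate_average xs h t - translate_average xs k u =
      (\<Sum>s\<leftarrow>xs. h (t + s) - k (u + s)) /\<^sub>R real (length xs)"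
    by (simp add: translate_average_def sum_list_subtractf scaleR_diff_right)
  moreover have "norm (\<Sum>s\<leftarrow>xs. h (t + s) - k (u + s)) \<le> real (length xs) * \<epsilon>"
    using assms(2) by (intro norm_sum_list_le) auto
  ultimately show ?thesis using assms(1) by (simp add: field_simps)
qed

lemma translate_average_near_const:
  assumes "xs \<noteq> []" "\<And>t. norm (h t - c) \<le> \<epsilon>"
  shows "norm (translate_average xs h t - c) \<le> \<epsilon>"
  using translate_average_diff_le[of xs h t "\<lambda>_. c" t \<epsilon>] assms
  by (simp add: translate_average_const)

text \<open>Averaging a function already within \<epsilon> of a constant keeps it there. In the
  composite list \<open>ys\<close> acts first on \<open>k\<close>; for \<open>h\<close> the two
  averages are exchanged so that \<open>xs\<close> acts first.\<close>

lemma has_mean_common_average: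
  assumes "has_mean h c" "has_mean k d" "\<epsilon> > 0"
  obtains xs where "xs \<noteq> []" "\<And>t. norm (translate_average xs h t - c) \<le> \<epsilon>"
    "\<And>t. norm (translate_average xs k t - d) \<le> \<epsilon>"
proof -
  obtain xs where xs: "xs \<noteq> []" "\<And>t. norm (translate_average xs h t - c) \<le> \<epsilon>"
    using assms(1,3) unfolding has_mean_def by blast
  obtain ys where ys: "ys \<noteq> []" "\<And>t. norm (translate_average ys k t - d) \<le> \<epsilon>"
    using assms(2,3) unfolding has_mean_def by blast
  let ?zs = "concat (map (\<lambda>x. map ((+) x) ys) xs)"
  have ne: "?zs \<noteq> []" using xs(1) ys(1) by (cases xs) auto
  have "norm (translate_average ?zs h t - c) \<le> \<epsilon>" for t
    unfolding translate_average_compose[symmetric] translate_average_commute[of xs]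
    by (rule translate_average_near_const[OF ys(1) xs(2)])
  moreover have "norm (translate_average ?zs k t - d) \<le> \<epsilon>" for t
    unfolding translate_average_compose[symmetric]
    by (rule translate_average_near_const[OF xs(1) ys(2)])
  ultimately show ?thesis by (rule that[OF ne])
qed

lemma has_mean_unique:
  assumes "has_mean h c" "has_mean h d"
  shows "c = d"
proof (rule ccontr)
  assume "c \<noteq> d"
  then have "norm (c - d) / 3 > 0" by simp
  from has_mean_common_average[OF assms this] obtain xs where "xs \<noteq> []"
    "\<And>t. norm (translate_average xs h t - c) \<le> norm (c - d) / 3"
    "\<And>t. norm (translate_average xs h t - d) \<le> norm (c - d) / 3" by blast
  then have "norm (c - d) \<le> norm (c - d) / 3 + norm (c - d) / 3"
    by (metis norm_diff_triangle_le norm_minus_commute)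
  with \<open>c \<noteq> d\<close> show False by simp
qed

lemma mean_eqI: "has_mean h c \<Longrightarrow> mean h = c"
  unfolding mean_def using has_mean_unique by blast

lemma has_mean_const: "has_mean (\<lambda>_. c) c"
  unfolding has_mean_def using translate_average_const[of "[0]" c]
  by (metis diff_self list.distinct(1) norm_zero order_less_imp_le)

lemma has_mean_add:
  assumes "has_mean h c" "has_mean k d"
  shows "has_mean (\<lambda>t. h t + k t) (c + d)"
  unfolding has_mean_def
proof (intro allI impI)
  fix \<epsilon> :: real assume "\<epsilon> > 0"
  then have "\<epsilon> / 2 > 0" by simp
  from has_mean_common_average[OF assms this] obtain xs where xs: "xs \<noteq> []"
    "\<And>t. norm (translate_average xs h t - c) \<le> \<epsilon> / 2"
    "\<And>t. norm (translate_average xs k t - d) \<le> \<epsilon> / 2" by blast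
  have "norm (translate_average xs (\<lambda>t. h t + k t) t - (c + d)) \<le> \<epsilon>" for t
    using norm_triangle_mono[OF xs(2)[of t] xs(3)[of t]]
    by (simp add: translate_average_add algebra_simps)
  with xs(1) show "\<exists>xs. xs \<noteq> [] \<and>
      (\<forall>t. norm (translate_average xs (\<lambda>t. h t + k t) t - (c + d)) \<le> \<epsilon>)" by blast
qed

lemma has_mean_linear:
  assumes "bounded_linear L" "has_mean h c"
  shows "has_mean (\<lambda>t. L (h t)) (L c)"
  unfolding has_mean_def
proof (intro allI impI)
  fix \<epsilon> :: real assume \<epsilon>: "\<epsilon> > 0"
  interpret bounded_linear L by fact
  obtain K where K: "K > 0" "\<And>x. norm (L x) \<le> norm x * K" using pos_bounded by blast
  from K(1) \<epsilon> have "\<epsilon> / K > 0" by simp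
  then obtain xs where xs: "xs \<noteq> []" "\<And>t. norm (translate_average xs h t - c) \<le> \<epsilon> / K"
    using assms(2) unfolding has_mean_def by blast
  have "norm (translate_average xs (\<lambda>t. L (h t)) t - L c) \<le> \<epsilon>" for t
  proof -
    have "norm (translate_average xs (\<lambda>t. L (h t)) t - L c) \<le> norm (translate_average xs h t - c) * K"
      using K(2) by (simp add: translate_average_linear[OF assms(1)] flip: diff)
    also have "\<dots> \<le> \<epsilon> / K * K" using xs(2) K(1) by (intro mult_right_mono) auto
    finally show ?thesis using K(1) by simp
  qed
  with xs(1) show "\<exists>xs. xs \<noteq> [] \<and>
      (\<forall>t. norm (translate_average xs (\<lambda>t. L (h t)) t - L c) \<le> \<epsilon>)" by blast
qed

lemma has_mean_translate:
  assumes "has_mean h c"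
  shows "has_mean (\<lambda>t. h (a + t)) c"
proof -
  have "translate_average xs (\<lambda>t. h (a + t)) t = translate_average xs h (a + t)" for xs t
    by (simp add: translate_average_def add.assoc)
  then show ?thesis using assms unfolding has_mean_def by metis
qed

lemma has_mean_reflect:
  assumes "has_mean h c"
  shows "has_mean (\<lambda>t. h (- t)) c"
proof -
  have "translate_average (map uminus xs) (\<lambda>t. h (- t)) t = translate_average xs h (- t)" for xs t
    by (simp add: translate_average_def o_def)
  then show ?thesis using assms unfolding has_mean_def by (metis Nil_is_map_conv)
qed

lemma has_mean_close:
  assumes "has_mean h c" "has_mean k d" "\<And>t. norm (h t - k t) \<le> \<epsilon>"
  shows "norm (c - d) \<le> \<epsilon>"
proof (rule field_le_epsilon)
  fix e :: real assume "e > 0"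
  then have "e / 2 > 0" by simp
  from has_mean_common_average[OF assms(1,2) this] obtain xs where xs: "xs \<noteq> []"
    "\<And>t. norm (translate_average xs h t - c) \<le> e / 2"
    "\<And>t. norm (translate_average xs k t - d) \<le> e / 2" by blast
  have "norm (translate_average xs h 0 - translate_average xs k 0) \<le> \<epsilon>"
    using assms(3) xs(1) by (intro translate_average_diff_le) auto
  then show "norm (c - d) \<le> \<epsilon> + e"
    using xs(2)[of 0] xs(3)[of 0] by norm
qed

text \<open>Only functions that are uniformly continuous for one fixed totally bounded
  translation invariant gauge occur, so that sums and products stay in the same class.\<close>

locale totally_bounded_gauge =
  fixes \<theta> :: "'g::ab_group_add \<Rightarrow> real"
  assumes gauge_nonneg: "0 \<le> \<theta> t"
    and finite_net: "\<epsilon> > 0 \<Longrightarrow> \<exists>F. finite F \<and> (\<forall>t. \<exists>s\<in>F. \<theta> (t - s) \<le> \<epsilon>)"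
begin

definition gauge_continuous :: "('g \<Rightarrow> 'b::real_normed_vector) \<Rightarrow> bool" where
  "gauge_continuous h \<longleftrightarrow>
     (\<forall>\<epsilon>>0. \<exists>\<delta>>0. \<forall>s t. \<theta> (s - t) \<le> \<delta> \<longrightarrow> norm (h s - h t) \<le> \<epsilon>)"

lemma gauge_continuousD:
  assumes "gauge_continuous h" "\<epsilon> > 0"
  obtains \<delta> where "\<delta> > 0" "\<And>s t. \<theta> (s - t) \<le> \<delta> \<Longrightarrow> norm (h s - h t) \<le> \<epsilon>"
  using assms unfolding gauge_continuous_def by blast

text \<open>The gauge sees only differences, so a net point \<open>s\<close> close to
  \<open>t\<close> gives closeness of \<open>h (u + t)\<close> and \<open>h (u + s)\<close> for all
  \<open>u\<close> at once: the translates of \<open>h\<close> are totally bounded in the supremum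
  norm.\<close>

lemma gauge_continuous_net:
  assumes "gauge_continuous h" "\<epsilon> > 0"
  obtains ys where "ys \<noteq> []" "\<And>t. \<exists>s\<in>set ys. \<forall>u. norm (h (u + t) - h (u + s)) \<le> \<epsilon>"
proof -
  obtain \<delta> where \<delta>: "\<delta> > 0" "\<And>s t. \<theta> (s - t) \<le> \<delta> \<Longrightarrow> norm (h s - h t) \<le> \<epsilon>"
    using assms unfolding gauge_continuous_def by blast
  obtain F where F: "finite F" "\<And>t. \<exists>s\<in>F. \<theta> (t - s) \<le> \<delta>" using finite_net[OF \<delta>(1)] by blast
  obtain ys where ys: "set ys = F" using finite_list[OF F(1)] by blast
  have "\<exists>s\<in>set ys. \<forall>u. norm (h (u + t) - h (u + s)) \<le> \<epsilon>" for t
    using F(2)[of t] \<delta>(2) ys by (metis add_diff_cancel_left)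
  then show ?thesis using that[of ys] by fastforce
qed

lemma gauge_continuous_bounded:
  assumes "gauge_continuous h"
  obtains C where "C > 0" "\<And>t. norm (h t) \<le> C"
proof -
  obtain ys where ys: "\<And>t. \<exists>s\<in>set ys. \<forall>u. norm (h (u + t) - h (u + s)) \<le> 1"
    using gauge_continuous_net[OF assms, of 1] by (metis zero_less_one)
  define C where "C = (\<Sum>s\<in>set ys. norm (h s)) + 1"
  have "norm (h t) \<le> C" for t
  proof -
    obtain s where s: "s \<in> set ys" "norm (h (0 + t) - h (0 + s)) \<le> 1" using ys by blast
    have "norm (h s) \<le> (\<Sum>s\<in>set ys. norm (h s))"
      using s(1) by (intro member_le_sum) auto
    then show ?thesis using s(2) unfolding C_def by simp norm
  qed
  moreover have "C > 0" unfolding C_def by (simp add: add_nonneg_pos sum_nonneg)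
  ultimately show ?thesis using that by blast
qed

lemma gauge_continuous_const [simp]: "gauge_continuous (\<lambda>_. c)"
  unfolding gauge_continuous_def by (auto intro: exI[of _ 1])

lemma gauge_continuous_linear:
  assumes "bounded_linear L" "gauge_continuous h"
  shows "gauge_continuous (\<lambda>t. L (h t))"
  unfolding gauge_continuous_def
proof (intro allI impI)
  fix \<epsilon> :: real assume \<epsilon>: "\<epsilon> > 0"
  interpret bounded_linear L by fact
  obtain K where K: "K > 0" "\<And>x. norm (L x) \<le> norm x * K" using pos_bounded by blast
  obtain \<delta> where \<delta>: "\<delta> > 0" "\<And>s t. \<theta> (s - t) \<le> \<delta> \<Longrightarrow> norm (h s - h t) \<le> \<epsilon> / K"
    using gauge_continuousD[OF assms(2), of "\<epsilon> / K"] \<epsilon> K(1) by (metis divide_pos_pos)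
  have "norm (L (h s) - L (h t)) \<le> \<epsilon>" if "\<theta> (s - t) \<le> \<delta>" for s t
  proof -
    have "norm (L (h s) - L (h t)) \<le> norm (h s - h t) * K" using K(2) by (simp flip: diff)
    also have "\<dots> \<le> \<epsilon> / K * K" using \<delta>(2)[OF that] K(1) by (intro mult_right_mono) auto
    finally show ?thesis using K(1) by simp
  qed
  then show "\<exists>\<delta>>0. \<forall>s t. \<theta> (s - t) \<le> \<delta> \<longrightarrow> norm (L (h s) - L (h t)) \<le> \<epsilon>"
    using \<delta>(1) by blast
qed

lemma gauge_continuous_add:
  assumes "gauge_continuous h" "gauge_continuous k"
  shows "gauge_continuous (\<lambda>t. h t + k t)"
  unfolding gauge_continuous_def
proof (intro allI impI)
  fix \<epsilon> :: real assume \<epsilon>: "\<epsilon> > 0"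
  obtain \<delta>1 where \<delta>1: "\<delta>1 > 0" "\<And>s t. \<theta> (s - t) \<le> \<delta>1 \<Longrightarrow> norm (h s - h t) \<le> \<epsilon> / 2"
    using gauge_continuousD[OF assms(1) half_gt_zero[OF \<epsilon>]] by metis
  obtain \<delta>2 where \<delta>2: "\<delta>2 > 0" "\<And>s t. \<theta> (s - t) \<le> \<delta>2 \<Longrightarrow> norm (k s - k t) \<le> \<epsilon> / 2"
    using gauge_continuousD[OF assms(2) half_gt_zero[OF \<epsilon>]] by metis
  have "norm (h s + k s - (h t + k t)) \<le> \<epsilon>" if "\<theta> (s - t) \<le> min \<delta>1 \<delta>2" for s t
    using \<delta>1(2)[of s t] \<delta>2(2)[of s t] that
      norm_triangle_ineq[of "h s - h t" "k s - k t"] by (simp add: algebra_simps)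
  then show "\<exists>\<delta>>0. \<forall>s t. \<theta> (s - t) \<le> \<delta> \<longrightarrow> norm (h s + k s - (h t + k t)) \<le> \<epsilon>"
    using \<delta>1(1) \<delta>2(1) by (metis min_less_iff_conj)
qed

lemma gauge_continuous_mult:
  fixes h k :: "'g \<Rightarrow> 'b::real_normed_algebra"
  assumes "gauge_continuous h" "gauge_continuous k"
  shows "gauge_continuous (\<lambda>t. h t * k t)"
  unfolding gauge_continuous_def
proof (intro allI impI)
  fix \<epsilon> :: real assume \<epsilon>: "\<epsilon> > 0"
  obtain A where A: "A > 0" "\<And>t. norm (h t) \<le> A" using gauge_continuous_bounded[OF assms(1)] by blast
  obtain B where B: "B > 0" "\<And>t. norm (k t) \<le> B" using gauge_continuous_bounded[OF assms(2)] by blast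
  have "\<epsilon> / (2 * B) > 0" "\<epsilon> / (2 * A) > 0" using \<epsilon> A B by auto
  then obtain \<delta>1 \<delta>2 where
    \<delta>1: "\<delta>1 > 0" "\<And>s t. \<theta> (s - t) \<le> \<delta>1 \<Longrightarrow> norm (h s - h t) \<le> \<epsilon> / (2 * B)" and
    \<delta>2: "\<delta>2 > 0" "\<And>s t. \<theta> (s - t) \<le> \<delta>2 \<Longrightarrow> norm (k s - k t) \<le> \<epsilon> / (2 * A)"
    using gauge_continuousD[OF assms(1)] gauge_continuousD[OF assms(2)] by metis
  have "norm (h s * k s - h t * k t) \<le> \<epsilon>" if "\<theta> (s - t) \<le> min \<delta>1 \<delta>2" for s t
  proof -
    have "h s * k s - h t * k t = h s * (k s - k t) + (h s - h t) * k t" by (simp add: algebra_simps)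
    also have "norm \<dots> \<le> norm (h s) * norm (k s - k t) + norm (h s - h t) * norm (k t)"
      by (meson add_mono norm_mult_ineq norm_triangle_le)
    also have "\<dots> \<le> A * (\<epsilon> / (2 * A)) + \<epsilon> / (2 * B) * B"
      using \<delta>1(2)[of s t] \<delta>2(2)[of s t] that A B \<epsilon>
      by (intro add_mono mult_mono) (auto simp: less_imp_le)
    also have "\<dots> = \<epsilon>" using A B by (simp add: field_simps)
    finally show ?thesis .
  qed
  then show "\<exists>\<delta>>0. \<forall>s t. \<theta> (s - t) \<le> \<delta> \<longrightarrow> norm (h s * k s - h t * k t) \<le> \<epsilon>"
    using \<delta>1(1) \<delta>2(1) by (metis min_less_iff_conj)
qed

lemma gauge_continuous_translate:
  assumes "gauge_continuous h"
  shows "gauge_continuous (\<lambda>t. h (a + t))"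
proof -
  have "a + s - (a + t) = s - t" for s t by simp
  then show ?thesis using assms unfolding gauge_continuous_def by metis
qed

text \<open>Von Neumann's argument: take an average whose supremum is almost minimal. If it were
  small somewhere, averaging it once more over a net would lower the supremum.\<close>

lemma has_mean_real:
  fixes h :: "'g \<Rightarrow> real"
  assumes h: "gauge_continuous h"
  shows "\<exists>c. has_mean h c"
proof -
  define S where "S = {c. \<exists>xs. xs \<noteq> [] \<and> (\<forall>t. translate_average xs h t \<le> c)}"
  obtain C where C: "\<And>t. norm (h t) \<le> C" using gauge_continuous_bounded[OF h] by blast
  have Cav: "\<bar>translate_average xs h t\<bar> \<le> C" if "xs \<noteq> []" for xs t
    using translate_average_near_const[OF that, of h 0] C by simp
  have "C \<in> S" unfolding S_def using Cav[of "[0]"] by (auto intro!: exI[of _ "[0]"] simp: abs_le_iff)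
  have bdd: "bdd_below S"
  proof (rule bdd_belowI[of _ "- C"])
    fix c assume "c \<in> S"
    then obtain xs where xs: "xs \<noteq> []" "\<And>t. translate_average xs h t \<le> c"
      unfolding S_def by blast
    from Cav[OF xs(1), of 0] xs(2)[of 0] show "- C \<le> c" by linarith
  qed
  define U where "U = Inf S"
  have "has_mean h U"
    unfolding has_mean_def
  proof (intro allI impI)
    fix \<delta> :: real assume \<delta>: "\<delta> > 0"
    obtain ys where ys: "ys \<noteq> []" "\<And>t. \<exists>s\<in>set ys. \<forall>u. norm (h (u + t) - h (u + s)) \<le> \<delta> / 2"
      using gauge_continuous_net[OF h, of "\<delta> / 2"] \<delta> by auto
    define n where "n = real (length ys)"
    have n: "n \<ge> 1" using ys(1) unfolding n_def by (cases ys) auto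
    \<comment> \<open>One term of the average lies below \<open>U - \<delta> / 2\<close>, the other
      \<open>n - 1\<close> are at most \<open>U + \<gamma>\<close>. The average drops to
      \<open>U - \<gamma>\<close> as soon as
      \<open>(2 * n - 1) * \<gamma> \<le> \<delta> / 2\<close>, which this choice ensures.\<close>
    define \<gamma> where "\<gamma> = \<delta> / (4 * n)"
    have "\<delta> * 1 \<le> \<delta> * (4 * n)" using \<delta> n by (intro mult_left_mono) auto
    then have \<gamma>: "\<gamma> > 0" "\<gamma> \<le> \<delta>" using \<delta> n by (auto simp: \<gamma>_def field_simps)
    obtain c where "c \<in> S" "c < U + \<gamma>"
      using cInf_lessD[of S "U + \<gamma>"] \<open>C \<in> S\<close> \<gamma> unfolding U_def by auto
    then obtain xs where xs: "xs \<noteq> []" "\<And>t. translate_average xs h t \<le> U + \<gamma>"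
      unfolding S_def using less_imp_le order_trans by (smt (verit) mem_Collect_eq)
    define k where "k = translate_average xs h"
    have "k t0 \<ge> U - \<delta>" for t0
    proof (rule ccontr)
      assume less: "\<not> k t0 \<ge> U - \<delta>"
      have small: "\<exists>s\<in>set ys. k (t + s) \<le> U - \<delta> / 2" for t
      proof -
        \<comment> \<open>The net point stands in for \<open>t0 - t\<close>, so that
          \<open>t + s\<close> behaves like the point \<open>t0\<close> where \<open>k\<close> is
          small.\<close>
        obtain s where s: "s \<in> set ys" "\<And>u. norm (h (u + (t0 - t)) - h (u + s)) \<le> \<delta> / 2"
          using ys(2) by blast
        have "norm (k (t + (t0 - t)) - k (t + s)) \<le> \<delta> / 2"
          unfolding k_def
        proof (rule translate_average_diff_le[OF xs(1)])
          fix r assume "r \<in> set xs"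
          show "norm (h (t + (t0 - t) + r) - h (t + s + r)) \<le> \<delta> / 2"
            using s(2)[of "t + r"] by (simp add: algebra_simps)
        qed
        then show ?thesis using less s(1)
          by (intro bexI[of _ s]) (auto simp: abs_if split: if_splits)
      qed
      have av: "translate_average ys k t \<le> U - \<gamma>" for t
      proof -
        obtain s where s: "s \<in> set ys" "k (t + s) \<le> U - \<delta> / 2" using small by blast
        obtain as bs where split: "ys = as @ s # bs" using split_list[OF s(1)] by blast
        have le: "(\<Sum>s\<leftarrow>zs. k (t + s)) \<le> real (length zs) * (U + \<gamma>)" for zs
        proof (induction zs)
          case (Cons z zs)
          then show ?case using xs(2)[of "t + z"] by (simp add: algebra_simps k_def)
        qed simp
        have "(\<Sum>s\<leftarrow>ys. k (t + s)) \<le> (n - 1) * (U + \<gamma>) + (U - \<delta> / 2)"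
          using le[of as] le[of bs] s(2) unfolding split n_def by (simp add: algebra_simps)
        also have "\<dots> \<le> n * (U - \<gamma>)"
          using n \<gamma> by (simp add: \<gamma>_def field_simps)
        finally have "(\<Sum>s\<leftarrow>ys. k (t + s)) / n \<le> U - \<gamma>"
          using n by (simp add: pos_divide_le_eq mult.commute)
        then show ?thesis by (simp add: translate_average_def n_def divide_inverse mult.commute)
      qed
      let ?zs = "concat (map (\<lambda>x. map ((+) x) xs) ys)"
      have "?zs \<noteq> []" using xs(1) ys(1) by (cases ys) auto
      then have "U - \<gamma> \<in> S"
        unfolding S_def using av unfolding k_def translate_average_compose by blast
      then have "U \<le> U - \<gamma>" unfolding U_def using bdd by (rule cInf_lower)
      with \<gamma> show False by simp
    qed
    then have "norm (translate_average xs h t - U) \<le> \<delta>" for t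
      using xs(2)[of t] \<gamma>(2) unfolding k_def by (simp add: abs_le_iff) (smt (verit))
    with xs(1) show "\<exists>xs. xs \<noteq> [] \<and> (\<forall>t. norm (translate_average xs h t - U) \<le> \<delta>)" by blast
  qed
  then show ?thesis by blast
qed

lemma has_mean_mean:
  fixes h :: "'g \<Rightarrow> complex"
  assumes h: "gauge_continuous h"
  shows "has_mean h (mean h)"
proof -
  obtain a b where a: "has_mean (\<lambda>t. Re (h t)) a" and b: "has_mean (\<lambda>t. Im (h t)) b"
    using has_mean_real gauge_continuous_linear[OF bounded_linear_Re h]
      gauge_continuous_linear[OF bounded_linear_Im h] by metis
  have "bounded_linear (\<lambda>x. \<i> * complex_of_real x)"
    by (intro bounded_linear_const_mult bounded_linear_of_real)
  from has_mean_add[OF has_mean_linear[OF bounded_linear_of_real a] has_mean_linear[OF this b]]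
  have "has_mean h (of_real a + \<i> * of_real b)" by (simp add: complex_eq[symmetric])
  then show ?thesis using mean_eqI by metis
qed

text \<open>Faithfulness of the mean. From every \<open>t\<close> some net point leads to a place
  where \<open>h\<close> is at least \<open>h a / 2\<close>, so the average over the net is bounded
  below by \<open>h a / (2 * n)\<close>. Composing it with an average within
  \<open>h a / (4 * n)\<close> of \<open>c\<close> leaves \<open>c\<close> positive.\<close>

lemma mean_pos:
  fixes h :: "'g \<Rightarrow> real"
  assumes h: "gauge_continuous h" "has_mean h c" "\<And>t. 0 \<le> h t" "0 < h a"
  shows "0 < c"
proof -
  obtain ys where ys: "ys \<noteq> []" "\<And>t. \<exists>s\<in>set ys. \<forall>u. norm (h (u + t) - h (u + s)) \<le> h a / 2"
    using gauge_continuous_net[OF h(1), of "h a / 2"] h(4) by auto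
  define n where "n = real (length ys)"
  have n: "n > 0" using ys(1) unfolding n_def by (cases ys) auto
  have av: "translate_average ys h t \<ge> h a / (2 * n)" for t
  proof -
    obtain s where s: "s \<in> set ys" "\<And>u. norm (h (u + (a - t)) - h (u + s)) \<le> h a / 2"
      using ys(2) by blast
    from s(2)[of t] have "h (t + s) \<ge> h a / 2" by (simp add: abs_if split: if_splits)
    moreover have "h (t + s) \<le> (\<Sum>s\<leftarrow>ys. h (t + s))"
      using s(1) h(3) by (intro member_le_sum_list) auto
    ultimately show ?thesis using n by (simp add: translate_average_def n_def field_simps)
  qed
  have "h a / (4 * n) > 0" using h(4) n by simp
  then obtain xs where xs: "xs \<noteq> []" "\<And>t. norm (translate_average xs h t - c) \<le> h a / (4 * n)"
    using h(2) unfolding has_mean_def by blast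
  have "norm (translate_average ys (translate_average xs h) 0 - c) \<le> h a / (4 * n)"
    by (rule translate_average_near_const[OF ys(1) xs(2)])
  moreover have "translate_average xs (translate_average ys h) 0 \<ge> h a / (2 * n)"
  proof -
    have "(\<Sum>s\<leftarrow>zs. translate_average ys h s) \<ge> real (length zs) * (h a / (2 * n))" for zs
    proof (induction zs)
      case (Cons z zs)
      then show ?case using av[of z] by (simp only: list.map sum_list.Cons length_Cons of_nat_Suc distrib_right)
    qed simp
    from this[of xs] show ?thesis
      using xs(1) by (simp add: translate_average_def[of xs] field_simps)
  qed
  moreover have "h a / (4 * n) < h a / (2 * n)" using n h(4) by (simp add: field_simps)
  ultimately show ?thesis by (simp add: translate_average_commute[of xs] abs_le_iff)
qed

end

section \<open>Positive definite functions\<close>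

text \<open>Only the real part of the form is tested, so Hermitian symmetry is demanded separately;
  with it the form is real. Both conditions survive pointwise limits.\<close>

definition pos_def :: "('g::ab_group_add \<Rightarrow> complex) \<Rightarrow> bool" where
  "pos_def p \<longleftrightarrow> (\<forall>t. p (- t) = cnj (p t)) \<and>
     (\<forall>n (s :: nat \<Rightarrow> 'g) (w :: nat \<Rightarrow> complex).
        0 \<le> Re (\<Sum>i<n. \<Sum>j<n. w i * cnj (w j) * p (s i - s j)))"

text \<open>The quadratic form of \<open>p\<close> based at a moving point \<open>u\<close>:
  positive definiteness is its nonnegativity at 0. As an operator on \<open>p\<close> it multiplies
  a character \<eta> by the square modulus of the sum of \<open>w i * \<eta> (s i)\<close>.\<close>

definition smear ::
  "'i set \<Rightarrow> ('i \<Rightarrow> 'g::ab_group_add) \<Rightarrow> ('i \<Rightarrow> complex) \<Rightarrow> ('g \<Rightarrow> complex) \<Rightarrow> 'g \<Rightarrow> complex" where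
  "smear I s w p u = (\<Sum>i\<in>I. \<Sum>j\<in>I. w i * cnj (w j) * p (u + (s i - s j)))"

lemma pos_def_uminus: "pos_def p \<Longrightarrow> p (- t) = cnj (p t)"
  by (simp add: pos_def_def)

lemma pos_def_minus_commute: "pos_def p \<Longrightarrow> p (t - s) = cnj (p (s - t))"
  using pos_def_uminus[of p "s - t"] by simp

lemma pos_defD:
  assumes "pos_def p" "finite I"
  shows "0 \<le> Re (\<Sum>i\<in>I. \<Sum>j\<in>I. w i * cnj (w j) * p (s i - s j))"
proof -
  obtain h where h: "bij_betw h {..<card I} I"
    using ex_bij_betw_nat_finite[OF assms(2)] by (auto simp: atLeast0LessThan)
  have "(\<Sum>i\<in>I. \<Sum>j\<in>I. w i * cnj (w j) * p (s i - s j)) =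
      (\<Sum>i<card I. \<Sum>j<card I. w (h i) * cnj (w (h j)) * p (s (h i) - s (h j)))"
    by (simp add: sum.reindex_bij_betw[OF h, symmetric])
  also have "0 \<le> Re \<dots>"
  proof -
    from assms(1) have "0 \<le> Re (\<Sum>i<n. \<Sum>j<n. v i * cnj (v j) * p (r i - r j))"
      for n and r :: "nat \<Rightarrow> 'a" and v unfolding pos_def_def by blast
    then show ?thesis .
  qed
  finally show ?thesis .
qed

lemma smear_nonneg: "pos_def p \<Longrightarrow> finite I \<Longrightarrow> 0 \<le> Re (smear I s w p 0)"
  using pos_defD[of p I w s] by (simp add: smear_def)

lemma pos_defI:
  assumes "\<And>t. p (- t) = cnj (p t)"
    and "\<And>n (s :: nat \<Rightarrow> 'g::ab_group_add) w. 0 \<le> Re (smear {..<n} s w p 0)"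
  shows "pos_def p"
  using assms unfolding pos_def_def smear_def by simp

lemma smear_add: "smear I s w (\<lambda>t. p t + q t) u = smear I s w p u + smear I s w q u"
  by (simp add: smear_def distrib_left sum.distrib)

lemma smear_cmult: "smear I s w (\<lambda>t. c * p t) u = c * smear I s w p u"
  by (simp add: smear_def sum_distrib_left ac_simps)

lemma smear_diff: "smear I s w (\<lambda>t. p t - q t) u = smear I s w p u - smear I s w q u"
  by (simp add: smear_def right_diff_distrib sum_subtractf)

lemma smear_commute:
  "smear I s w (smear J t v p) u = smear J t v (smear I s w p) u"
proof -
  have "smear I s w (smear J t v p) u =
      (\<Sum>i\<in>I. \<Sum>j\<in>I. \<Sum>k\<in>J. \<Sum>l\<in>J. w i * cnj (w j) * v k * cnj (v l) * p (u + (s i - s j) + (t k - t l)))"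
    by (simp add: smear_def sum_distrib_left mult.assoc)
  also have "\<dots> = (\<Sum>i\<in>I. \<Sum>k\<in>J. \<Sum>j\<in>I. \<Sum>l\<in>J. w i * cnj (w j) * v k * cnj (v l) * p (u + (s i - s j) + (t k - t l)))"
    by (intro sum.cong refl sum.swap)
  also have "\<dots> = (\<Sum>k\<in>J. \<Sum>i\<in>I. \<Sum>j\<in>I. \<Sum>l\<in>J. w i * cnj (w j) * v k * cnj (v l) * p (u + (s i - s j) + (t k - t l)))"
    by (rule sum.swap)
  also have "\<dots> = (\<Sum>k\<in>J. \<Sum>i\<in>I. \<Sum>l\<in>J. \<Sum>j\<in>I. w i * cnj (w j) * v k * cnj (v l) * p (u + (s i - s j) + (t k - t l)))"
    by (intro sum.cong refl sum.swap)
  also have "\<dots> = (\<Sum>k\<in>J. \<Sum>l\<in>J. \<Sum>i\<in>I. \<Sum>j\<in>I. w i * cnj (w j) * v k * cnj (v l) * p (u + (s i - s j) + (t k - t l)))"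
    by (intro sum.cong refl sum.swap)
  also have "\<dots> = smear J t v (smear I s w p) u"
    unfolding smear_def sum_distrib_left by (intro sum.cong refl) (simp add: algebra_simps)
  finally show ?thesis .
qed

text \<open>The form of a smeared function is the form of \<open>p\<close> on the sums of points
  with the products of weights; hence smearing preserves positive definiteness.\<close>

lemma smear_smear:
  "smear I s w (smear J t v p) u =
   smear (I \<times> J) (\<lambda>(i, k). s i + t k) (\<lambda>(i, k). w i * v k) p u"
proof -
  have "smear I s w (smear J t v p) u =
      (\<Sum>i\<in>I. \<Sum>j\<in>I. \<Sum>k\<in>J. \<Sum>l\<in>J. w i * cnj (w j) * v k * cnj (v l) * p (u + (s i - s j) + (t k - t l)))"
    by (simp add: smear_def sum_distrib_left mult.assoc)
  also have "\<dots> = (\<Sum>i\<in>I. \<Sum>k\<in>J. \<Sum>j\<in>I. \<Sum>l\<in>J. w i * cnj (w j) * v k * cnj (v l) * p (u + (s i - s j) + (t k - t l)))"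
    by (intro sum.cong refl sum.swap)
  also have "\<dots> = smear (I \<times> J) (\<lambda>(i, k). s i + t k) (\<lambda>(i, k). w i * v k) p u"
    unfolding smear_def sum.cartesian_product' prod.case
    by (intro sum.cong refl) (simp add: algebra_simps)
  finally show ?thesis .
qed

lemma smear_uminus:
  assumes "\<And>t. p (- t) = cnj (p t)"
  shows "smear I s w p (- u) = cnj (smear I s w p u)"
proof -
  have *: "p (- u + (s i - s j)) = cnj (p (u + (s j - s i)))" for i j
    using assms[of "u + (s j - s i)"] by (simp add: algebra_simps)
  show ?thesis
    unfolding smear_def * by (subst sum.swap) (simp add: mult.commute)
qed

lemma pos_def_smear:
  assumes "pos_def p" "finite I"
  shows "pos_def (smear I s w p)"
  using smear_uminus[of p I s w, OF pos_def_uminus[OF assms(1)]] assms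
  by (intro pos_defI) (simp_all add: smear_smear smear_nonneg)

lemma pos_def_add: "pos_def p \<Longrightarrow> pos_def q \<Longrightarrow> pos_def (\<lambda>t. p t + q t)"
  by (intro pos_defI) (simp_all add: pos_def_uminus smear_add smear_nonneg)

lemma pos_def_cmult: "pos_def p \<Longrightarrow> 0 \<le> c \<Longrightarrow> pos_def (\<lambda>t. complex_of_real c * p t)"
  by (intro pos_defI) (simp_all add: pos_def_uminus smear_cmult smear_nonneg)

lemma pos_def_zero: "pos_def (\<lambda>_. 0)"
  by (simp add: pos_def_def)

lemma pos_def_Im_0: "pos_def p \<Longrightarrow> Im (p 0) = 0"
  using pos_def_uminus[of p 0] by (simp add: complex_eq_iff)

lemma pos_def_of_real_0: "pos_def p \<Longrightarrow> complex_of_real (Re (p 0)) = p 0"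
  by (simp add: complex_eq_iff pos_def_Im_0)

text \<open>The form on three points, written out. Suitable weights give nonnegativity at 0, the
  bound by the value at 0, and Krein's inequality.\<close>

lemma pos_def_three:
  assumes "pos_def p"
  shows "0 \<le> ((cmod x)\<^sup>2 + (cmod y)\<^sup>2 + (cmod z)\<^sup>2) * Re (p 0) + 2 * Re (x * cnj y * p (a - b)) +
    2 * Re (x * cnj z * p (a - c)) + 2 * Re (y * cnj z * p (b - c))"
proof -
  have "0 \<le> Re (\<Sum>i\<in>{0,1,2::nat}. \<Sum>j\<in>{0,1,2::nat}. (if i = 0 then x else if i = 1 then y else z) *
      cnj (if j = 0 then x else if j = 1 then y else z) *
      p ((if i = 0 then a else if i = 1 then b else c) - (if j = 0 then a else if j = 1 then b else c)))"
    by (rule pos_defD[OF assms]) simp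
  also have "\<dots> = ((cmod x)\<^sup>2 + (cmod y)\<^sup>2 + (cmod z)\<^sup>2) * Re (p 0) + 2 * Re (x * cnj y * p (a - b)) +
    2 * Re (x * cnj z * p (a - c)) + 2 * Re (y * cnj z * p (b - c))"
    using pos_def_minus_commute[OF assms, of b a] pos_def_minus_commute[OF assms, of c a]
      pos_def_minus_commute[OF assms, of c b] pos_def_Im_0[OF assms]
    by (simp add: cmod_power2) (simp add: algebra_simps power2_eq_square)
  finally show ?thesis .
qed

lemma pos_def_Re_0_nonneg: "pos_def p \<Longrightarrow> 0 \<le> Re (p 0)"
  using pos_def_three[of p 1 0 0] by simp

lemma cnj_sgn_mult: "cnj (sgn z) * z = of_real (cmod z)"
proof (cases "z = 0")
  case False
  have "cnj z * z = of_real (cmod z) * of_real (cmod z)"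
    using complex_norm_square[of z] by (simp add: power2_eq_square mult.commute)
  then show ?thesis using False by (simp add: sgn_eq)
qed simp

lemma pos_def_norm_le:
  assumes "pos_def p"
  shows "norm (p u) \<le> Re (p 0)"
proof (cases "p u = 0")
  case False
  \<comment> \<open>The phase of the second weight is chosen to make the cross term of the points
    \<open>u\<close> and 0 as negative as possible.\<close>
  have "cnj (- sgn (p u)) * p u = - norm (p u)" by (simp add: cnj_sgn_mult)
  then have "Re (1 * cnj (- sgn (p u)) * p (u - 0)) = - norm (p u)" by simp
  then show ?thesis
    using pos_def_three[OF assms, of 1 "- sgn (p u)" 0 u 0 0] False by (simp add: norm_sgn)
qed (simp add: pos_def_Re_0_nonneg assms)

text \<open>Test with the points \<open>u\<close>, \<open>v\<close>, 0 and the weights 1, -1,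
  \<open>w\<close>. The outcome is that the defect \<open>Re (p 0) - Re (p t)\<close> alone governs
  the modulus of continuity, which is why later bounds are imposed on the defect only.\<close>

lemma pos_def_krein:
  assumes "pos_def p"
  shows "(norm (p u - p v))\<^sup>2 \<le> 2 * Re (p 0) * (Re (p 0) - Re (p (u - v)))"
proof (cases "p u = p v")
  case True
  have "Re (p (u - v)) \<le> Re (p 0)"
    using pos_def_norm_le[OF assms, of "u - v"] complex_Re_le_cmod order_trans by blast
  then show ?thesis using True pos_def_Re_0_nonneg[OF assms] by simp
next
  case False
  define d where "d = p u - p v"
  \<comment> \<open>The test value is \<open>(2 + r\<^sup>2) * Re (p 0) - 2 * Re (p (u - v)) - 2 *
    (r * norm d)\<close> when \<open>w\<close> has modulus \<open>r\<close> and phase opposite to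
    \<open>d\<close>; this \<open>r\<close> minimises it.\<close>
  define r where "r = norm d / Re (p 0)"
  have "d \<noteq> 0" using False by (simp add: d_def)
  have p0: "Re (p 0) > 0"
  proof (rule ccontr)
    assume "\<not> Re (p 0) > 0"
    then have "p u = 0" "p v = 0"
      using pos_def_norm_le[OF assms, of u] pos_def_norm_le[OF assms, of v]
      by (metis norm_le_zero_iff not_le order_trans less_le_trans)+
    with False show False by simp
  qed
  define w where "w = - of_real r * sgn d"
  have "cnj w * d = - of_real (r * norm d)"
    by (simp add: w_def cnj_sgn_mult mult.assoc)
  then have "Re (cnj w * p u) - Re (cnj w * p v) = - (r * norm d)"
    by (metis Re_complex_of_real d_def minus_complex.sel(1) of_real_minus right_diff_distrib')
  moreover have "cmod w = r" using \<open>d \<noteq> 0\<close> p0 by (simp add: w_def r_def norm_mult norm_divide norm_sgn)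
  ultimately have "0 \<le> (2 + r\<^sup>2) * Re (p 0) - 2 * Re (p (u - v)) - 2 * (r * norm d)"
    using pos_def_three[OF assms, of 1 "- 1" w u v 0] by simp
  also have "\<dots> = 2 * (Re (p 0) - Re (p (u - v))) - (norm d)\<^sup>2 / Re (p 0)"
    using p0 by (simp add: r_def power2_eq_square field_simps)
  finally show ?thesis using p0 by (simp add: d_def field_simps)
qed

lemma norm_smear_le:
  assumes "\<And>u. norm (p u) \<le> C"
  shows "norm (smear I s w p u) \<le> (\<Sum>i\<in>I. norm (w i))\<^sup>2 * C"
proof -
  have "norm (smear I s w p u) \<le> (\<Sum>i\<in>I. \<Sum>j\<in>I. norm (w i) * norm (w j) * C)"
    unfolding smear_def
    by (intro sum_norm_le) (simp add: norm_mult mult_left_mono assms)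
  also have "\<dots> = (\<Sum>i\<in>I. norm (w i))\<^sup>2 * C"
    unfolding power2_eq_square sum_product by (simp only: sum_distrib_right)
  finally show ?thesis .
qed

text \<open>Smearings commute, so testing \<open>smear I s w p\<close> amounts to smearing the
  positive definite test function \<open>?q\<close>. Its values are bounded by \<open>?q 0\<close>,
  and the weights contribute at most the square of the sum of their moduli.\<close>

lemma pos_def_diff_smear:
  assumes "pos_def p" "finite I" "(\<Sum>i\<in>I. norm (w i))\<^sup>2 \<le> K"
  shows "pos_def (\<lambda>t. complex_of_real K * p t - smear I s w p t)"
proof (rule pos_defI)
  show "complex_of_real K * p (- t) - smear I s w p (- t) =
      cnj (complex_of_real K * p t - smear I s w p t)" for t
    using smear_uminus[of p I s w, OF pos_def_uminus[OF assms(1)]] by (simp add: pos_def_uminus[OF assms(1)])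
next
  fix n :: nat and t v
  let ?q = "smear {..<n} t v p"
  have q: "pos_def ?q" by (simp add: pos_def_smear assms(1))
  have "Re (smear I s w ?q 0) \<le> (\<Sum>i\<in>I. norm (w i))\<^sup>2 * Re (?q 0)"
    using norm_smear_le[of ?q "Re (?q 0)"] pos_def_norm_le[OF q] complex_Re_le_cmod order_trans by blast
  also have "\<dots> \<le> K * Re (?q 0)"
    using assms(3) pos_def_Re_0_nonneg[OF q] by (rule mult_right_mono)
  finally show "0 \<le> Re (smear {..<n} t v (\<lambda>t. complex_of_real K * p t - smear I s w p t) 0)"
    by (simp add: smear_diff smear_cmult smear_commute[of "{..<n}"])
qed

text \<open>Purely algebraic, in contrast to \<open>dual_group\<close>. Continuity is recovered from
  continuity with respect to the gauge.\<close>

definition character :: "('g::ab_group_add \<Rightarrow> complex) \<Rightarrow> bool" where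
  "character \<eta> \<longleftrightarrow> (\<forall>s t. \<eta> (s + t) = \<eta> s * \<eta> t) \<and> (\<forall>t. norm (\<eta> t) = 1)"

lemma character_add: "character \<eta> \<Longrightarrow> \<eta> (s + t) = \<eta> s * \<eta> t"
  and norm_character: "character \<eta> \<Longrightarrow> norm (\<eta> t) = 1"
  by (simp_all add: character_def)

lemma character_mult_cnj: "character \<eta> \<Longrightarrow> \<eta> t * cnj (\<eta> t) = 1"
  using complex_norm_square[of "\<eta> t"] by (simp add: norm_character)

lemma character_0: "character \<eta> \<Longrightarrow> \<eta> 0 = 1"
  using character_add[of \<eta> 0 0] norm_character[of \<eta> 0] by auto

lemma character_uminus:
  assumes "character \<eta>" shows "\<eta> (- t) = cnj (\<eta> t)"
proof -
  have "\<eta> (- t) * \<eta> t = 1" using character_add[OF assms, of "- t" t] character_0[OF assms] by simp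
  then have "\<eta> (- t) * (\<eta> t * cnj (\<eta> t)) = cnj (\<eta> t)" by (simp flip: mult.assoc)
  then show ?thesis by (simp add: character_mult_cnj[OF assms])
qed

lemma character_diff: "character \<eta> \<Longrightarrow> \<eta> (s - t) = \<eta> s * cnj (\<eta> t)"
  using character_add[of \<eta> s "- t"] by (simp add: character_uminus)

lemma character_cnj: "character \<eta> \<Longrightarrow> character (\<lambda>t. cnj (\<eta> t))"
  by (simp add: character_def)

lemma pos_def_mult_character:
  assumes "pos_def p" "character \<eta>"
  shows "pos_def (\<lambda>t. p t * \<eta> t)"
proof (rule pos_defI)
  show "p (- t) * \<eta> (- t) = cnj (p t * \<eta> t)" for t
    by (simp add: pos_def_uminus assms(1) character_uminus assms(2))
next
  fix n :: nat and s w
  have "smear {..<n} s w (\<lambda>t. p t * \<eta> t) 0 = smear {..<n} s (\<lambda>i. w i * \<eta> (s i)) p 0"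
    by (simp add: smear_def character_diff assms(2) ac_simps)
  then show "0 \<le> Re (smear {..<n} s w (\<lambda>t. p t * \<eta> t) 0)"
    by (simp add: smear_nonneg assms(1))
qed

lemma smear_const: "smear I s w (\<lambda>_. c) u = of_real ((cmod (\<Sum>i\<in>I. w i))\<^sup>2) * c"
proof -
  have "smear I s w (\<lambda>_. c) u = (\<Sum>i\<in>I. w i) * (\<Sum>i\<in>I. cnj (w i)) * c"
    unfolding smear_def sum_product by (simp only: sum_distrib_right)
  also have "(\<Sum>i\<in>I. cnj (w i)) = cnj (\<Sum>i\<in>I. w i)" by simp
  finally show ?thesis by (simp only: complex_norm_square)
qed

lemma pos_def_one: "pos_def (\<lambda>_. 1)"
  by (intro pos_defI) (simp_all add: smear_const)

lemma pos_def_character: "character \<eta> \<Longrightarrow> pos_def \<eta>"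
  using pos_def_mult_character[OF pos_def_one] by simp

lemma pos_def_mean_Im:
  assumes "pos_def p" "has_mean p c"
  shows "Im c = 0"
proof -
  have "has_mean p (cnj c)"
    using has_mean_linear[OF bounded_linear_cnj has_mean_reflect[OF assms(2)]]
    by (simp add: pos_def_uminus[OF assms(1)])
  with assms(2) have "c = cnj c" by (rule has_mean_unique)
  then show ?thesis by (simp add: complex_eq_iff)
qed

text \<open>Test positive definiteness on the given points together with the points of an averaging
  list, the latter carrying the total weight \<open>- Z\<close>.\<close>

lemma pos_def_mean_aux:
  assumes p: "pos_def p" and c: "has_mean p c" and I: "finite I" and \<epsilon>: "\<epsilon> > 0"
  shows "- \<epsilon> * (2 * cmod Z * (\<Sum>i\<in>I. cmod (w i)) + (cmod Z)\<^sup>2) \<le>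
    Re (smear I s w p 0) - 2 * Re (cnj Z * (\<Sum>i\<in>I. w i) * c) + (cmod Z)\<^sup>2 * Re c"
proof -
  obtain xs where xs: "xs \<noteq> []" "\<And>t. norm (translate_average xs p t - c) \<le> \<epsilon>"
    using c \<epsilon> unfolding has_mean_def by blast
  define n where "n = length xs"
  have n: "n > 0" using xs(1) by (simp add: n_def)
  define v where "v = - Z / of_nat n"
  define e where "e t = translate_average xs p t - c" for t
  have e: "norm (e t) \<le> \<epsilon>" for t using xs(2) by (simp add: e_def)
  have av: "(\<Sum>k<n. p (t + xs ! k)) = of_nat n * (c + e t)" for t
  proof -
    have "(\<Sum>s\<leftarrow>xs. p (t + s)) = (\<Sum>k<n. p (t + xs ! k))"
      by (simp add: sum_list_sum_nth n_def atLeast0LessThan)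
    then show ?thesis
      using n by (simp add: e_def translate_average_def n_def scaleR_conv_of_real field_simps)
  qed
  \<comment> \<open>The left summand indexes the given points, the right one the averaging list.
    List entries are inserted negated, so that differences with them become the sums
    \<open>t + xs ! k\<close> occurring in a translate average.\<close>
  let ?f = "\<lambda>x y. (case_sum w (\<lambda>_. v) x * cnj (case_sum w (\<lambda>_. v) y) *
      p (case_sum s (\<lambda>k. - (xs ! k)) x - case_sum s (\<lambda>k. - (xs ! k)) y))"
  have "0 \<le> Re (\<Sum>x\<in>I <+> {..<n}. \<Sum>y\<in>I <+> {..<n}. ?f x y)"
    by (rule pos_defD[OF p]) (simp add: I)
  also have "(\<Sum>x\<in>I <+> {..<n}. \<Sum>y\<in>I <+> {..<n}. ?f x y) =
      smear I s w p 0 + (\<Sum>i\<in>I. \<Sum>k<n. w i * cnj v * p (s i + xs ! k)) +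
      ((\<Sum>k<n. \<Sum>i\<in>I. v * cnj (w i) * p (- (xs ! k) - s i)) +
       (\<Sum>k<n. \<Sum>l<n. v * cnj v * p (- (xs ! k) + xs ! l)))"
    by (simp add: sum.Plus I sum.distrib smear_def)
  also have "(\<Sum>k<n. \<Sum>i\<in>I. v * cnj (w i) * p (- (xs ! k) - s i)) =
      cnj (\<Sum>i\<in>I. \<Sum>k<n. w i * cnj v * p (s i + xs ! k))"
  proof -
    have "p (- (xs ! k) - s i) = cnj (p (s i + xs ! k))" for k i
      using pos_def_uminus[OF p, of "s i + xs ! k"] by (simp only: minus_add diff_conv_add_uminus)
    then show ?thesis by (subst sum.swap) (simp add: ac_simps)
  qed
  also have "(\<Sum>i\<in>I. \<Sum>k<n. w i * cnj v * p (s i + xs ! k)) =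
      - (cnj Z * (\<Sum>i\<in>I. w i) * c) - cnj Z * (\<Sum>i\<in>I. w i * e (s i))"
  proof -
    have "(\<Sum>i\<in>I. \<Sum>k<n. w i * cnj v * p (s i + xs ! k)) = (\<Sum>i\<in>I. - cnj Z * (w i * (c + e (s i))))"
      by (intro sum.cong refl, unfold sum_distrib_left[symmetric] av)
        (use n in \<open>simp add: v_def ac_simps\<close>)
    then show ?thesis
      by (simp add: distrib_left sum.distrib sum_distrib_left sum_distrib_right sum_negf sum_subtractf ac_simps)
  qed
  also have "(\<Sum>k<n. \<Sum>l<n. v * cnj v * p (- (xs ! k) + xs ! l)) =
      of_real ((cmod Z)\<^sup>2) * c + Z * cnj Z * (\<Sum>k<n. e (- (xs ! k))) / of_nat n"
  proof -
    have "(\<Sum>k<n. \<Sum>l<n. v * cnj v * p (- (xs ! k) + xs ! l)) =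
        (\<Sum>k<n. Z * cnj Z / of_nat n * (c + e (- (xs ! k))))"
      by (intro sum.cong refl, unfold sum_distrib_left[symmetric] av)
        (use n in \<open>simp add: v_def ac_simps\<close>)
    then show ?thesis
      using n by (simp add: distrib_left sum.distrib sum_distrib_left complex_norm_square
          sum_divide_distrib del: of_real_power)
  qed
  also have "Re (A + (- X - Y) + (cnj (- X - Y) + (of_real z * c + D))) =
      Re A - 2 * Re X + z * Re c - 2 * Re Y + Re D" for A X Y D z by simp
  finally have main: "0 \<le> Re (smear I s w p 0) - 2 * Re (cnj Z * (\<Sum>i\<in>I. w i) * c) + (cmod Z)\<^sup>2 * Re c
      - 2 * Re (cnj Z * (\<Sum>i\<in>I. w i * e (s i))) + Re (Z * cnj Z * (\<Sum>k<n. e (- (xs ! k))) / of_nat n)" .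
  have "- Re (cnj Z * (\<Sum>i\<in>I. w i * e (s i))) \<le> cmod (cnj Z * (\<Sum>i\<in>I. w i * e (s i)))"
    using abs_Re_le_cmod by (metis abs_le_D2)
  also have "\<dots> \<le> cmod Z * ((\<Sum>i\<in>I. cmod (w i)) * \<epsilon>)"
  proof -
    have "cmod (\<Sum>i\<in>I. w i * e (s i)) \<le> (\<Sum>i\<in>I. cmod (w i) * \<epsilon>)"
      by (intro sum_norm_le) (simp add: norm_mult mult_left_mono e)
    then show ?thesis by (simp add: norm_mult mult_left_mono sum_distrib_right)
  qed
  finally have b1: "- Re (cnj Z * (\<Sum>i\<in>I. w i * e (s i))) \<le> cmod Z * ((\<Sum>i\<in>I. cmod (w i)) * \<epsilon>)" .
  have "Re (Z * cnj Z * (\<Sum>k<n. e (- (xs ! k))) / of_nat n) \<le>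
      cmod (Z * cnj Z * (\<Sum>k<n. e (- (xs ! k))) / of_nat n)" by (rule complex_Re_le_cmod)
  also have "\<dots> = (cmod Z)\<^sup>2 * (cmod (\<Sum>k<n. e (- (xs ! k))) / real n)"
    by (simp add: norm_mult norm_divide power2_eq_square)
  also have "\<dots> \<le> (cmod Z)\<^sup>2 * \<epsilon>"
  proof (intro mult_left_mono)
    have "cmod (\<Sum>k<n. e (- (xs ! k))) \<le> (\<Sum>k<n. \<epsilon>)" by (intro sum_norm_le e)
    then show "cmod (\<Sum>k<n. e (- (xs ! k))) / real n \<le> \<epsilon>" using n by (simp add: field_simps)
  qed simp
  finally show ?thesis using main b1 by (simp add: algebra_simps)
qed

lemma scaled_lower_bound_imp_nonneg:
  assumes "\<And>\<epsilon>::real. \<epsilon> > 0 \<Longrightarrow> - \<epsilon> * C \<le> x" "0 \<le> C"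
  shows "0 \<le> x"
proof (rule field_le_epsilon)
  fix e :: real assume e: "e > 0"
  have "- (e / (C + 1)) * C \<le> x" using assms e by (intro assms(1)) auto
  moreover have "e / (C + 1) * C \<le> e" using assms(2) e by (simp add: field_simps)
  ultimately show "0 \<le> x + e" by simp
qed

lemma pos_def_mean_Re:
  assumes "pos_def p" "has_mean p c"
  shows "0 \<le> Re c"
  by (rule scaled_lower_bound_imp_nonneg[of 1])
    (use pos_def_mean_aux[OF assms, of "{}" _ 1] in \<open>auto simp: smear_def\<close>)

text \<open>The mean is the weight at the trivial character. In the preceding inequality take
  \<open>Z\<close> to be the sum of the \<open>w i\<close>: the terms with \<open>c\<close> then
  combine to minus \<open>(cmod Z)\<^sup>2 * Re c\<close>, precisely the change in the form caused
  by subtracting the constant \<open>c\<close>.\<close>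

lemma pos_def_diff_mean:
  assumes "pos_def p" "has_mean p c"
  shows "pos_def (\<lambda>t. p t - c)"
proof (rule pos_defI)
  show "p (- t) - c = cnj (p t - c)" for t
    using pos_def_mean_Im[OF assms] by (simp add: pos_def_uminus[OF assms(1)] complex_eq_iff)
next
  fix n :: nat and s and w :: "nat \<Rightarrow> complex"
  let ?Z = "\<Sum>i<n. w i"
  have *: "cnj ?Z * ?Z * c = of_real ((cmod ?Z)\<^sup>2) * c" by (simp only: complex_norm_square mult.commute)
  have Z: "Re (cnj ?Z * ?Z * c) = (cmod ?Z)\<^sup>2 * Re c"
    unfolding * by (simp del: of_real_power)
  have "Re (smear {..<n} s w (\<lambda>t. p t - c) 0) = Re (smear {..<n} s w p 0) - (cmod ?Z)\<^sup>2 * Re c"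
    by (simp add: smear_diff smear_const del: of_real_power)
  moreover have "0 \<le> Re (smear {..<n} s w p 0) - (cmod ?Z)\<^sup>2 * Re c"
  proof (rule scaled_lower_bound_imp_nonneg)
    fix \<epsilon> :: real assume \<epsilon>: "\<epsilon> > 0"
    show "- \<epsilon> * (2 * cmod ?Z * (\<Sum>i<n. cmod (w i)) + (cmod ?Z)\<^sup>2) \<le>
        Re (smear {..<n} s w p 0) - (cmod ?Z)\<^sup>2 * Re c"
      using pos_def_mean_aux[OF assms finite_lessThan \<epsilon>, of ?Z w n s] Z by simp
  qed (simp add: sum_nonneg)
  ultimately show "0 \<le> Re (smear {..<n} s w (\<lambda>t. p t - c) 0)" by simp
qed

text \<open>Twisting by the conjugate of \<eta> moves the weight at \<eta> to the trivial character;
  subtract the mean there and twist back.\<close>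

lemma pos_def_diff_character:
  assumes "pos_def p" "character \<eta>" "has_mean (\<lambda>t. p t * cnj (\<eta> t)) c"
  shows "pos_def (\<lambda>t. p t - c * \<eta> t)"
proof -
  have "pos_def (\<lambda>t. (p t * cnj (\<eta> t) - c) * \<eta> t)"
    by (intro pos_def_mult_character pos_def_diff_mean assms character_cnj)
  moreover have "(p t * cnj (\<eta> t) - c) * \<eta> t = p t * (\<eta> t * cnj (\<eta> t)) - c * \<eta> t" for t
    by (simp add: algebra_simps)
  ultimately show ?thesis by (simp add: character_mult_cnj[OF assms(2)])
qed

section \<open>Almost periodic positive definite functions\<close>

lemma closed_pos_def: "closed {p :: 'g::ab_group_add \<Rightarrow> complex. pos_def p}"
  unfolding pos_def_def
  by (intro closed_Collect_conj closed_Collect_all closed_Collect_eq closed_Collect_le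
      continuous_intros continuous_on_product_coordinates)

context totally_bounded_gauge
begin

lemma gauge_continuous_sum:
  assumes "\<And>i. i \<in> I \<Longrightarrow> gauge_continuous (f i)"
  shows "gauge_continuous (\<lambda>t. \<Sum>i\<in>I. f i t)"
  using assms by (induction I rule: infinite_finite_induct) (simp_all add: gauge_continuous_add)

lemma gauge_continuous_cmult:
  "gauge_continuous h \<Longrightarrow> gauge_continuous (\<lambda>t. (c :: 'b::real_normed_algebra) * h t)"
  by (rule gauge_continuous_linear[OF bounded_linear_mult_right])

lemma gauge_continuous_cnj: "gauge_continuous h \<Longrightarrow> gauge_continuous (\<lambda>t. cnj (h t))"
  by (rule gauge_continuous_linear[OF bounded_linear_cnj])

lemma gauge_continuous_diff:
  "gauge_continuous h \<Longrightarrow> gauge_continuous k \<Longrightarrow> gauge_continuous (\<lambda>t. h t - k t)"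
  using gauge_continuous_add[of h "\<lambda>t. - k t"]
    gauge_continuous_linear[OF bounded_linear_minus[OF bounded_linear_ident], of k] by simp

lemma gauge_continuous_smear:
  assumes "gauge_continuous p" shows "gauge_continuous (smear I s w p)"
proof -
  have "gauge_continuous (\<lambda>u. \<Sum>i\<in>I. \<Sum>j\<in>I. w i * cnj (w j) * p ((s i - s j) + u))"
    by (intro gauge_continuous_sum gauge_continuous_cmult gauge_continuous_translate assms)
  then show ?thesis by (simp add: smear_def[abs_def] add.commute)
qed

section \<open>The inner product and the square norm defined by the mean\<close>

definition mean_inner :: "('g \<Rightarrow> complex) \<Rightarrow> ('g \<Rightarrow> complex) \<Rightarrow> complex" where
  "mean_inner p q = mean (\<lambda>s. p s * cnj (q s))"

lemma has_mean_inner: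
  "gauge_continuous p \<Longrightarrow> gauge_continuous q \<Longrightarrow> has_mean (\<lambda>s. p s * cnj (q s)) (mean_inner p q)"
  unfolding mean_inner_def by (intro has_mean_mean gauge_continuous_mult gauge_continuous_cnj)

lemma mean_inner_add_left:
  assumes "gauge_continuous p" "gauge_continuous p'" "gauge_continuous q"
  shows "mean_inner (\<lambda>s. p s + p' s) q = mean_inner p q + mean_inner p' q"
  unfolding mean_inner_def[of "\<lambda>s. p s + p' s"] distrib_right
  by (intro mean_eqI has_mean_add has_mean_inner assms)

lemma mean_inner_cmult_left:
  assumes "gauge_continuous p" "gauge_continuous q"
  shows "mean_inner (\<lambda>s. c * p s) q = c * mean_inner p q"
  unfolding mean_inner_def[of "\<lambda>s. c * p s"] mult.assoc
  by (intro mean_eqI has_mean_linear[OF bounded_linear_mult_right] has_mean_inner assms)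

lemma mean_inner_cnj:
  assumes "gauge_continuous p" "gauge_continuous q"
  shows "mean_inner q p = cnj (mean_inner p q)"
  using has_mean_linear[OF bounded_linear_cnj has_mean_inner[OF assms]]
  by (auto simp: mean_inner_def[of q] mult.commute intro: mean_eqI)

lemma mean_inner_diff_left:
  assumes "gauge_continuous p" "gauge_continuous p'" "gauge_continuous q"
  shows "mean_inner (\<lambda>s. p s - p' s) q = mean_inner p q - mean_inner p' q"
  using mean_inner_add_left[of p "\<lambda>s. - 1 * p' s" q] mean_inner_cmult_left[of p' q "- 1"]
    gauge_continuous_cmult[of p' "- 1"] assms by simp

lemma mean_inner_sum_left:
  assumes "\<And>i. i \<in> I \<Longrightarrow> gauge_continuous (f i)" "gauge_continuous q"
  shows "mean_inner (\<lambda>s. \<Sum>i\<in>I. c i * f i s) q = (\<Sum>i\<in>I. c i * mean_inner (f i) q)"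
proof -
  have zero: "mean_inner (\<lambda>s. 0) q = 0"
    unfolding mean_inner_def using mean_eqI[OF has_mean_const[of 0]] by simp
  show ?thesis
    using assms(1)
  proof (induction I rule: infinite_finite_induct)
    case (insert i I)
    then show ?case
      by (simp add: mean_inner_add_left mean_inner_cmult_left gauge_continuous_cmult
          gauge_continuous_sum assms(2))
  qed (simp_all add: zero)
qed

lemma mean_inner_close:
  assumes "gauge_continuous p" "gauge_continuous p'" "gauge_continuous q"
    and "\<And>t. norm (p t - p' t) \<le> e" "\<And>t. norm (q t) \<le> C"
  shows "norm (mean_inner p q - mean_inner p' q) \<le> e * C"
proof (rule has_mean_close[OF has_mean_inner has_mean_inner])
  fix t
  have "norm (p t * cnj (q t) - p' t * cnj (q t)) = norm (p t - p' t) * norm (q t)"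
    by (simp add: norm_mult flip: left_diff_distrib)
  also have "\<dots> \<le> e * C"
    using assms(4,5) norm_ge_zero order_trans by (intro mult_mono) blast+
  finally show "norm (p t * cnj (q t) - p' t * cnj (q t)) \<le> e * C" .
qed (use assms in auto)

lemma mean_inner_translate:
  assumes "gauge_continuous p" "gauge_continuous q"
  shows "mean_inner (\<lambda>s. p (a + s)) (\<lambda>s. q (a + s)) = mean_inner p q"
  unfolding mean_inner_def[of "\<lambda>s. p (a + s)"]
  by (rule mean_eqI) (rule has_mean_translate[OF has_mean_inner[OF assms]])

lemma pos_def_mean_inner_Im:
  assumes "pos_def p" "pos_def q" "gauge_continuous p" "gauge_continuous q"
  shows "Im (mean_inner p q) = 0"
proof -
  have "mean_inner q p = mean_inner p q"
    using has_mean_reflect[OF has_mean_inner[OF assms(3,4)]]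
    unfolding mean_inner_def[of q]
    by (intro mean_eqI) (simp add: pos_def_uminus assms mult.commute)
  with mean_inner_cnj[OF assms(3,4)] show ?thesis by (simp add: complex_eq_iff)
qed

definition mean_square :: "('g \<Rightarrow> complex) \<Rightarrow> real" where
  "mean_square p = mean (\<lambda>s. (cmod (p s))\<^sup>2)"

lemma cmod_square_eq_Re: "(cmod z)\<^sup>2 = Re (z * cnj z)"
  unfolding cmod_power2 by (simp add: power2_eq_square)

lemma gauge_continuous_square: "gauge_continuous p \<Longrightarrow> gauge_continuous (\<lambda>s. (cmod (p s))\<^sup>2)"
  unfolding cmod_square_eq_Re
  by (intro gauge_continuous_linear[OF bounded_linear_Re] gauge_continuous_mult gauge_continuous_cnj)

lemma Re_mean_inner_self:
  assumes "gauge_continuous p" shows "Re (mean_inner p p) = mean_square p"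
    and has_mean_square: "has_mean (\<lambda>s. (cmod (p s))\<^sup>2) (mean_square p)"
proof -
  have *: "has_mean (\<lambda>s. (cmod (p s))\<^sup>2) (Re (mean_inner p p))"
    unfolding cmod_square_eq_Re
    by (rule has_mean_linear[OF bounded_linear_Re has_mean_inner[OF assms assms]])
  then show "Re (mean_inner p p) = mean_square p" unfolding mean_square_def by (metis mean_eqI)
  with * show "has_mean (\<lambda>s. (cmod (p s))\<^sup>2) (mean_square p)" by simp
qed

lemma mean_square_pos:
  assumes "gauge_continuous p" "p a \<noteq> 0" shows "0 < mean_square p"
  using assms by (intro mean_pos[OF gauge_continuous_square has_mean_square, of p a]) auto

text \<open>The last term is the exact defect of convexity. As the mean is faithful, it vanishes for
  \<open>x\<close>, \<open>y\<close> > 0 only if \<open>u = v\<close>; this strict convexity makes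
  maximisers extreme.\<close>

lemma mean_square_convex:
  assumes "gauge_continuous u" "gauge_continuous v" "x + y = 1"
  shows "mean_square (\<lambda>s. of_real x * u s + of_real y * v s) =
    x * mean_square u + y * mean_square v - x * y * mean_square (\<lambda>s. u s - v s)"
proof -
  have x: "x = 1 - y" using assms(3) by simp
  have pointwise: "(cmod (of_real x * a + of_real y * b))\<^sup>2 =
      (x * (cmod a)\<^sup>2 + y * (cmod b)\<^sup>2) + (- (x * y)) * (cmod (a - b))\<^sup>2" for a b
    unfolding cmod_power2 x by (simp add: power2_eq_square algebra_simps)
  have "has_mean (\<lambda>s. (x * (cmod (u s))\<^sup>2 + y * (cmod (v s))\<^sup>2) + (- (x * y)) * (cmod (u s - v s))\<^sup>2)
      ((x * mean_square u + y * mean_square v) + (- (x * y)) * mean_square (\<lambda>s. u s - v s))"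
    by (intro has_mean_add has_mean_linear[OF bounded_linear_mult_right] has_mean_square
        gauge_continuous_diff assms)
  then show ?thesis
    unfolding mean_square_def[of "\<lambda>s. of_real x * u s + of_real y * v s"] pointwise
    by (simp add: mean_eqI)
qed

section \<open>Compact families of positive definite functions controlled by the gauge\<close>

definition dominated :: "real \<Rightarrow> ('g \<Rightarrow> complex) set" where
  "dominated C = {p. pos_def p \<and> Re (p 0) \<le> C \<and> (\<forall>t. Re (p 0) - Re (p t) \<le> C * \<theta> t)}"

lemma dominated_pos_def: "p \<in> dominated C \<Longrightarrow> pos_def p"
  by (simp add: dominated_def)

lemma dominated_norm_le: "p \<in> dominated C \<Longrightarrow> norm (p t) \<le> C"
  unfolding dominated_def using pos_def_norm_le order_trans by blast

lemma dominated_nonneg: "p \<in> dominated C \<Longrightarrow> 0 \<le> C"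
  using dominated_norm_le norm_ge_zero order_trans by blast

text \<open>Krein's inequality bounds \<open>(norm (p s - p t))\<^sup>2\<close> by
  \<open>2 * C\<close> times the defect at \<open>s - t\<close>, hence by
  \<open>2 * C\<^sup>2 * \<theta> (s - t)\<close>, uniformly over the family.\<close>

lemma dominated_equicontinuous:
  assumes "\<epsilon> > 0"
  shows "\<exists>\<delta>>0. \<forall>p\<in>dominated C. \<forall>s t. \<theta> (s - t) \<le> \<delta> \<longrightarrow> norm (p s - p t) \<le> \<epsilon>"
proof (intro exI conjI ballI allI impI)
  \<comment> \<open>Makes \<open>2 * C\<^sup>2 * ?\<delta>\<close> at most
    \<open>\<epsilon>\<^sup>2\<close>; the added 1 covers \<open>C = 0\<close>.\<close>
  let ?\<delta> = "\<epsilon>\<^sup>2 / (2 * (C\<^sup>2 + 1))"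
  have C1: "0 < 2 * (C\<^sup>2 + 1)" by (simp add: add_nonneg_pos)
  then show "0 < ?\<delta>" using assms by simp
  fix p s t assume p: "p \<in> dominated C" and st: "\<theta> (s - t) \<le> ?\<delta>"
  have C: "0 \<le> C" using dominated_nonneg[OF p] .
  have "Re (p 0) - Re (p (s - t)) \<le> C * \<theta> (s - t)" using p by (simp add: dominated_def)
  also have "\<dots> \<le> C * ?\<delta>" using st C by (rule mult_left_mono)
  finally have le: "Re (p 0) - Re (p (s - t)) \<le> C * ?\<delta>" .
  have "0 \<le> Re (p 0) - Re (p (s - t))"
    using pos_def_norm_le[OF dominated_pos_def[OF p]] complex_Re_le_cmod order_trans
    by (metis diff_ge_0_iff_ge)
  then have "2 * Re (p 0) * (Re (p 0) - Re (p (s - t))) \<le> 2 * C * (C * ?\<delta>)"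
    using le p C by (intro mult_mono) (auto simp: dominated_def pos_def_Re_0_nonneg)
  also have "\<dots> = C\<^sup>2 / (C\<^sup>2 + 1) * \<epsilon>\<^sup>2" using C1 by (simp add: power2_eq_square field_simps)
  also have "\<dots> \<le> 1 * \<epsilon>\<^sup>2" by (intro mult_right_mono) (simp_all add: add_nonneg_pos)
  finally have "(norm (p s - p t))\<^sup>2 \<le> \<epsilon>\<^sup>2"
    using pos_def_krein[OF dominated_pos_def[OF p], of s t] by simp
  then show "norm (p s - p t) \<le> \<epsilon>" using assms by (simp add: power2_le_iff_abs_le)
qed

lemma dominated_gauge_continuous: "p \<in> dominated C \<Longrightarrow> gauge_continuous p"
  unfolding gauge_continuous_def using dominated_equicontinuous by meson

text \<open>Pass from \<open>t\<close> to a net point for \<open>p\<close> and for \<open>q\<close>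
  by equicontinuity and compare there: three errors of \<epsilon>. The finite set serves all pairs
  of the family.\<close>

lemma dominated_finite_determined:
  assumes "\<epsilon> > 0"
  obtains F where "finite F" "\<And>p q t. p \<in> dominated C \<Longrightarrow> q \<in> dominated C \<Longrightarrow>
    (\<And>s. s \<in> F \<Longrightarrow> norm (p s - q s) \<le> \<epsilon>) \<Longrightarrow> norm (p t - q t) \<le> 3 * \<epsilon>"
proof -
  obtain \<delta> where \<delta>: "\<delta> > 0"
    "\<And>p s t. p \<in> dominated C \<Longrightarrow> \<theta> (s - t) \<le> \<delta> \<Longrightarrow> norm (p s - p t) \<le> \<epsilon>"
    using dominated_equicontinuous[OF assms] by metis
  obtain F where F: "finite F" "\<And>t. \<exists>s\<in>F. \<theta> (t - s) \<le> \<delta>" using finite_net[OF \<delta>(1)] by blast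
  have "norm (p t - q t) \<le> 3 * \<epsilon>"
    if pq: "p \<in> dominated C" "q \<in> dominated C" and *: "\<And>s. s \<in> F \<Longrightarrow> norm (p s - q s) \<le> \<epsilon>" for p q t
  proof -
    obtain s where s: "s \<in> F" "\<theta> (t - s) \<le> \<delta>" using F(2) by blast
    show ?thesis using \<delta>(2)[OF pq(1) s(2)] \<delta>(2)[OF pq(2) s(2)] *[OF s(1)] by norm
  qed
  then show ?thesis using that[OF F(1)] by blast
qed

text \<open>On a dominated family, pointwise convergence is already uniform.\<close>

lemma continuous_on_dominated:
  fixes f :: "('g \<Rightarrow> complex) \<Rightarrow> 'b::metric_space"
  assumes lip: "\<And>p q e. p \<in> dominated C \<Longrightarrow> q \<in> dominated C \<Longrightarrow> (\<And>t. norm (p t - q t) \<le> e) \<Longrightarrow>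
    dist (f p) (f q) \<le> e * K"
  shows "continuous_on (dominated C) f"
  unfolding continuous_on_topological
proof (intro ballI allI impI)
  fix p B assume p: "p \<in> dominated C" and B: "open B" "f p \<in> B"
  obtain e where e: "e > 0" "ball (f p) e \<subseteq> B" using B open_contains_ball by blast
  define \<epsilon> where "\<epsilon> = e / (4 * (\<bar>K\<bar> + 1))"
  have \<epsilon>: "\<epsilon> > 0" using e(1) by (simp add: \<epsilon>_def)
  obtain F where F: "finite F" "\<And>p q t. p \<in> dominated C \<Longrightarrow> q \<in> dominated C \<Longrightarrow>
    (\<And>s. s \<in> F \<Longrightarrow> norm (p s - q s) \<le> \<epsilon>) \<Longrightarrow> norm (p t - q t) \<le> 3 * \<epsilon>"
    using dominated_finite_determined[OF \<epsilon>] by blast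
  let ?A = "\<Inter>s\<in>F. (\<lambda>q. q s) -` ball (p s) \<epsilon>"
  have "open ?A"
    using F(1) by (intro open_INT ballI open_vimage open_ball continuous_on_product_coordinates)
  moreover have "p \<in> ?A" using \<epsilon> by simp
  moreover have "f q \<in> B" if q: "q \<in> dominated C" "q \<in> ?A" for q
  proof -
    have "norm (p t - q t) \<le> 3 * \<epsilon>" for t
      using q(2) by (intro F(2) p q(1)) (auto simp: dist_norm less_imp_le)
    then have "dist (f p) (f q) \<le> 3 * \<epsilon> * K" by (rule lip[OF p q(1)])
    also have "\<dots> \<le> 3 * \<epsilon> * (\<bar>K\<bar> + 1)" using \<epsilon> by (intro mult_left_mono) auto
    also have "\<dots> = 3 / 4 * e" unfolding \<epsilon>_def by (simp add: field_simps)
    also have "\<dots> < e" using e(1) by simp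
    finally show ?thesis using e(2) by auto
  qed
  ultimately show "\<exists>A. open A \<and> p \<in> A \<and> (\<forall>q\<in>dominated C. q \<in> A \<longrightarrow> f q \<in> B)" by blast
qed

lemma closed_dominated: "closed (dominated C)"
  unfolding dominated_def
  by (intro closed_Collect_conj closed_pos_def closed_Collect_all closed_Collect_le
      continuous_intros continuous_on_product_coordinates)

text \<open>Tychonoff's theorem: a pointwise closed subset of a product of discs of radius
  \<open>C\<close>.\<close>

lemma compact_dominated: "compact (dominated C)"
proof -
  have "compactin (product_topology (\<lambda>_. euclidean) UNIV) (PiE (UNIV :: 'g set) (\<lambda>_. cball (0::complex) C))"
    unfolding compactin_PiE by simp
  then have "compact (PiE (UNIV :: 'g set) (\<lambda>_. cball (0::complex) C))"
    by (simp add: euclidean_product_topology)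
  then have "compact (PiE (UNIV :: 'g set) (\<lambda>_. cball (0::complex) C) \<inter> dominated C)"
    using closed_dominated by (rule compact_Int_closed)
  moreover have "PiE (UNIV :: 'g set) (\<lambda>_. cball (0::complex) C) \<inter> dominated C = dominated C"
    using dominated_norm_le by auto
  ultimately show ?thesis by simp
qed

lemma continuous_on_mean_inner:
  assumes "gauge_continuous \<phi>"
  shows "continuous_on (dominated C) (\<lambda>p. mean_inner (\<lambda>s. p (t + s)) \<phi>)"
proof -
  obtain K where K: "\<And>t. norm (\<phi> t) \<le> K" using gauge_continuous_bounded[OF assms] by blast
  show ?thesis
    unfolding dist_norm
    by (rule continuous_on_dominated[of _ _ K], unfold dist_norm)
      (intro mean_inner_close gauge_continuous_translate dominated_gauge_continuous[of _ C] assms K)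
qed

lemma continuous_on_mean_square: "continuous_on (dominated C) mean_square"
proof (rule continuous_on_dominated[of _ _ "2 * C"])
  fix p q e assume pq: "p \<in> dominated C" "q \<in> dominated C" and e: "\<And>t. norm (p t - q t) \<le> e"
  have g: "gauge_continuous p" "gauge_continuous q" using pq dominated_gauge_continuous by blast+
  show "dist (mean_square p) (mean_square q) \<le> e * (2 * C)"
    unfolding dist_norm
  proof (rule has_mean_close[OF has_mean_square[OF g(1)] has_mean_square[OF g(2)]])
    fix t
    have "\<bar>(cmod (p t))\<^sup>2 - (cmod (q t))\<^sup>2\<bar> = \<bar>cmod (p t) - cmod (q t)\<bar> * (cmod (p t) + cmod (q t))"
      by (simp add: power2_eq_square square_diff_square_factored abs_mult mult.commute)
    also have "\<dots> \<le> e * (C + C)"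
      using e[of t] norm_triangle_ineq3[of "p t" "q t"] dominated_norm_le[OF pq(1), of t]
        dominated_norm_le[OF pq(2), of t] by (intro mult_mono add_mono) auto
    finally show "norm ((cmod (p t))\<^sup>2 - (cmod (q t))\<^sup>2) \<le> e * (2 * C)" by simp
  qed
qed

text \<open>For Hermitian \<phi> the factor \<open>cnj (\<phi> s)\<close> is
  \<open>\<phi> (- s)\<close>, so this is convolution with respect to the mean. A character \<eta>
  is an eigenfunction, with eigenvalue \<open>mean_inner \<eta> \<phi>\<close>.\<close>

definition mean_convolution :: "('g \<Rightarrow> complex) \<Rightarrow> ('g \<Rightarrow> complex) \<Rightarrow> 'g \<Rightarrow> complex" where
  "mean_convolution \<phi> q t = mean_inner (\<lambda>s. q (t + s)) \<phi>"

lemma mean_convolution_0: "mean_convolution \<phi> q 0 = mean_inner q \<phi>"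
  by (simp add: mean_convolution_def)

lemma mean_convolution_uminus:
  assumes "pos_def \<phi>" "pos_def q" "gauge_continuous \<phi>" "gauge_continuous q"
  shows "mean_convolution \<phi> q (- t) = cnj (mean_convolution \<phi> q t)"
proof -
  have "q (- t + - s) * cnj (\<phi> (- s)) = cnj (q (t + s) * cnj (\<phi> s))" for s
    using pos_def_uminus[OF assms(2), of "t + s"] pos_def_uminus[OF assms(1), of s]
    by (simp add: algebra_simps)
  moreover have "has_mean (\<lambda>s. q (- t + - s) * cnj (\<phi> (- s))) (mean_convolution \<phi> q (- t))"
    unfolding mean_convolution_def
    by (intro has_mean_reflect has_mean_inner gauge_continuous_translate assms)
  moreover have "has_mean (\<lambda>s. cnj (q (t + s) * cnj (\<phi> s))) (cnj (mean_convolution \<phi> q t))"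
    unfolding mean_convolution_def
    by (intro has_mean_linear[OF bounded_linear_cnj] has_mean_inner gauge_continuous_translate assms)
  ultimately show ?thesis using has_mean_unique by force
qed

lemma mean_convolution_cmult:
  assumes "gauge_continuous \<phi>" "gauge_continuous q"
  shows "mean_convolution \<phi> (\<lambda>s. c * q s) t = c * mean_convolution \<phi> q t"
  unfolding mean_convolution_def
  by (intro mean_inner_cmult_left gauge_continuous_translate assms)

lemma mean_convolution_smear:
  assumes "gauge_continuous \<phi>" "gauge_continuous q"
  shows "mean_convolution \<phi> (smear I s w q) t = smear I s w (mean_convolution \<phi> q) t"
proof -
  have "mean_inner (\<lambda>r. \<Sum>i\<in>I. 1 * (\<Sum>j\<in>I. w i * cnj (w j) * q (t + r + (s i - s j)))) \<phi> =
      (\<Sum>i\<in>I. 1 * (\<Sum>j\<in>I. w i * cnj (w j) * mean_inner (\<lambda>r. q (t + r + (s i - s j))) \<phi>))"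
  proof -
    have g: "gauge_continuous (\<lambda>r. q (t + r + a))" for a
      using gauge_continuous_translate[OF assms(2), of "t + a"] by (simp add: ac_simps)
    show ?thesis
      by (subst mean_inner_sum_left)
        (simp_all add: mean_inner_sum_left g assms gauge_continuous_sum gauge_continuous_cmult)
  qed
  then show ?thesis by (simp add: mean_convolution_def smear_def ac_simps)
qed

text \<open>In terms of Fourier coefficients, membership in \<open>spectral_cone \<phi> \<kappa>\<close> says that \<open>q\<close> is
  carried by characters whose coefficient in \<open>\<phi>\<close> is at least \<open>\<kappa>\<close>.\<close>

definition spectral_cone :: "('g \<Rightarrow> complex) \<Rightarrow> real \<Rightarrow> ('g \<Rightarrow> complex) set" where
  "spectral_cone \<phi> \<kappa> = {q. pos_def q \<and> gauge_continuous q \<and>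
     pos_def (\<lambda>t. mean_convolution \<phi> q t - of_real \<kappa> * q t)}"

lemma spectral_cone_smear:
  assumes "gauge_continuous \<phi>" "q \<in> spectral_cone \<phi> \<kappa>" "finite I"
  shows "smear I s w q \<in> spectral_cone \<phi> \<kappa>"
proof -
  have "pos_def (smear I s w (\<lambda>t. mean_convolution \<phi> q t - of_real \<kappa> * q t))"
    using assms by (intro pos_def_smear) (auto simp: spectral_cone_def)
  moreover have "smear I s w (\<lambda>t. mean_convolution \<phi> q t - of_real \<kappa> * q t) =
      (\<lambda>t. mean_convolution \<phi> (smear I s w q) t - of_real \<kappa> * smear I s w q t)"
    using assms by (auto simp: smear_diff smear_cmult mean_convolution_smear spectral_cone_def)
  ultimately show ?thesis
    using assms by (simp add: spectral_cone_def pos_def_smear gauge_continuous_smear)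
qed

lemma spectral_cone_cmult:
  assumes "gauge_continuous \<phi>" "q \<in> spectral_cone \<phi> \<kappa>" "0 \<le> c"
  shows "(\<lambda>t. complex_of_real c * q t) \<in> spectral_cone \<phi> \<kappa>"
proof -
  have "pos_def (\<lambda>t. of_real c * (mean_convolution \<phi> q t - of_real \<kappa> * q t))"
    using assms by (intro pos_def_cmult) (auto simp: spectral_cone_def)
  moreover have "(\<lambda>t. of_real c * (mean_convolution \<phi> q t - of_real \<kappa> * q t)) =
      (\<lambda>t. mean_convolution \<phi> (\<lambda>t. of_real c * q t) t - of_real \<kappa> * (of_real c * q t))"
    using assms by (auto simp: mean_convolution_cmult spectral_cone_def algebra_simps)
  ultimately show ?thesis
    using assms by (simp add: spectral_cone_def pos_def_cmult gauge_continuous_cmult)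
qed

text \<open>Since the convolution minus \<kappa> times \<open>q\<close> is positive definite, its
  defect is nonnegative, so \<kappa> times the defect of \<open>q\<close> is at most the defect of
  the convolution. The latter is half a mean of a second difference of \<phi> against
  \<open>q\<close>, and \<open>q\<close> has modulus at most 1, so the defect of \<phi> bounds
  it.\<close>

lemma spectral_cone_dominated:
  assumes \<phi>: "\<phi> \<in> dominated C" and q: "q \<in> spectral_cone \<phi> \<kappa>" "q 0 = 1" and \<kappa>: "\<kappa> > 0"
  shows "q \<in> dominated (max 1 (C / \<kappa>))"
proof -
  note g\<phi> = dominated_gauge_continuous[OF \<phi>] and p\<phi> = dominated_pos_def[OF \<phi>]
  have gq: "gauge_continuous q" and pq: "pos_def q"
    and pd: "pos_def (\<lambda>t. mean_convolution \<phi> q t - of_real \<kappa> * q t)"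
    using q(1) by (auto simp: spectral_cone_def)
  have q1: "norm (q u) \<le> 1" for u using pos_def_norm_le[OF pq, of u] q(2) by simp
  have key: "\<kappa> * (1 - Re (q t)) \<le> Re (\<phi> 0) - Re (\<phi> t)" for t
  proof -
    let ?P = "mean_convolution \<phi> q"
    let ?\<psi> = "\<lambda>s. 2 * \<phi> s - \<phi> (- t + s) - \<phi> (t + s)"
    \<comment> \<open>The second difference of \<phi> is a smear with weights 1 and -1 at 0 and
      \<open>t\<close>. Being positive definite, it is bounded by its value at 0, twice the defect
      of \<phi>.\<close>
    let ?\<psi>' = "smear {0,1::nat} (\<lambda>i. if i = 0 then 0 else t) (\<lambda>i. if i = 0 then 1 else - 1) \<phi>"
    have "Re (?P t - of_real \<kappa> * q t) \<le> Re (?P 0 - of_real \<kappa> * q 0)"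
      using pos_def_norm_le[OF pd, of t] complex_Re_le_cmod order_trans by blast
    then have 1: "\<kappa> * (1 - Re (q t)) \<le> Re (?P 0) - Re (?P t)" using q(2) by (simp add: algebra_simps)
    have g: "gauge_continuous (\<lambda>s. 2 * \<phi> s)" "gauge_continuous (\<lambda>s. \<phi> (- t + s))"
      "gauge_continuous (\<lambda>s. \<phi> (t + s))"
      by (intro g\<phi> gauge_continuous_cmult gauge_continuous_translate)+
    have shift: "mean_inner (\<lambda>s. \<phi> (a + s)) q = cnj (?P (- a))" for a
      using mean_inner_translate[of "\<lambda>s. q (- a + s)" \<phi> a] g\<phi> gq
        mean_inner_cnj[of q "\<lambda>s. \<phi> (a + s)"] gauge_continuous_translate[of \<phi> a]
        gauge_continuous_translate[of q "- a"]
      by (simp add: mean_convolution_def)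
    have "mean_inner ?\<psi> q = 2 * cnj (?P 0) - cnj (?P t) - cnj (?P (- t))"
      using g gq g\<phi> shift[of 0] shift[of t] shift[of "- t"]
      by (simp add: mean_inner_diff_left mean_inner_cmult_left gauge_continuous_diff)
    then have "Re (mean_inner ?\<psi> q) = 2 * (Re (?P 0) - Re (?P t))"
      using mean_convolution_uminus[OF p\<phi> pq g\<phi> gq, of t] by simp
    moreover have \<psi>: "?\<psi> = ?\<psi>'"
      by (rule ext) (simp add: smear_def algebra_simps)
    have "pos_def ?\<psi>'" by (intro pos_def_smear p\<phi>) simp
    then have "norm (?\<psi> u) \<le> Re (?\<psi>' 0)" for u
      unfolding fun_cong[OF \<psi>, of u] by (rule pos_def_norm_le)
    moreover have "Re (?\<psi>' 0) = 2 * (Re (\<phi> 0) - Re (\<phi> t))"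
      using pos_def_uminus[OF p\<phi>, of t] arg_cong[OF fun_cong[OF \<psi>, of 0], of Re] by simp
    ultimately have "norm (?\<psi> u - 0) \<le> 2 * (Re (\<phi> 0) - Re (\<phi> t))" for u by simp
    from mean_inner_close[OF _ _ gq this q1]
    have "norm (mean_inner ?\<psi> q - mean_inner (\<lambda>_. 0) q) \<le> 2 * (Re (\<phi> 0) - Re (\<phi> t))"
      using g by (simp add: gauge_continuous_diff)
    moreover have "mean_inner (\<lambda>_. 0) q = 0"
      using mean_inner_sum_left[of "{}" "\<lambda>_. q" q "\<lambda>_. 0"] gq by simp
    ultimately have "Re (mean_inner ?\<psi> q) \<le> 2 * (Re (\<phi> 0) - Re (\<phi> t))"
      using complex_Re_le_cmod[of "mean_inner ?\<psi> q"] by simp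
    with 1 \<open>Re (mean_inner ?\<psi> q) = _\<close> show ?thesis by simp
  qed
  \<comment> \<open>The key estimate gives the slope \<open>C / \<kappa>\<close>; the maximum with 1
    accounts for the value \<open>q 0 = 1\<close>, as \<open>dominated\<close> uses one constant for
    both bounds.\<close>
  have "1 - Re (q t) \<le> max 1 (C / \<kappa>) * \<theta> t" for t
  proof -
    have "\<kappa> * (1 - Re (q t)) \<le> C * \<theta> t"
      using key[of t] \<phi> order_trans unfolding dominated_def by blast
    then have le: "1 - Re (q t) \<le> C / \<kappa> * \<theta> t" using \<kappa> by (simp add: field_simps)
    have "C / \<kappa> * \<theta> t \<le> max 1 (C / \<kappa>) * \<theta> t"
      by (intro mult_right_mono gauge_nonneg) auto
    with le show ?thesis by simp
  qed
  then show ?thesis using pq q(2) by (simp add: dominated_def)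
qed

text \<open>The cone is nonempty: a maximiser of \<open>Re (mean_inner p \<phi>) - \<kappa> * Re (p 0)\<close> over all \<open>p\<close> with
  both \<open>p\<close> and \<open>\<phi> - p\<close> positive definite loses value when any part is removed from it.\<close>

lemma spectral_cone_nontrivial:
  assumes \<phi>: "\<phi> \<in> dominated C" and \<kappa>: "\<kappa> * Re (\<phi> 0) < mean_square \<phi>"
  shows "\<exists>p\<in>spectral_cone \<phi> \<kappa>. 0 < Re (p 0)"
proof -
  note g\<phi> = dominated_gauge_continuous[OF \<phi>] and p\<phi> = dominated_pos_def[OF \<phi>]
  \<comment> \<open>The order interval between 0 and \<phi>. Its elements inherit the bounds on
    \<phi>, because \<open>\<phi> - p\<close> has nonnegative value at 0 and nonnegative
    defect.\<close>
  define D where "D = {p. pos_def p \<and> pos_def (\<lambda>t. \<phi> t - p t)}"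
  \<comment> \<open>Heuristically \<open>L\<close> weights each Fourier coefficient of
    \<open>p\<close> by the corresponding coefficient of \<phi> minus \<kappa>, so a maximiser keeps
    just the characters where this is not negative. The assumption on \<kappa> makes
    \<open>L \<phi>\<close> positive.\<close>
  define L where "L p = Re (mean_inner p \<phi>) - \<kappa> * Re (p 0)" for p
  have D: "D \<subseteq> dominated C"
  proof
    fix p assume "p \<in> D"
    then have p: "pos_def p" "pos_def (\<lambda>t. \<phi> t - p t)" by (auto simp: D_def)
    have "0 \<le> Re (\<phi> 0 - p 0)" using pos_def_Re_0_nonneg[OF p(2)] .
    moreover have "Re (\<phi> t - p t) \<le> Re (\<phi> 0 - p 0)" for t
      using pos_def_norm_le[OF p(2), of t] complex_Re_le_cmod order_trans by blast
    ultimately show "p \<in> dominated C"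
      using \<phi> p(1) unfolding dominated_def by simp (smt (verit))
  qed
  have "closed D"
  proof -
    have "continuous_on UNIV (\<lambda>p t. \<phi> t - p t :: complex)"
      by (intro continuous_on_coordinatewise_then_product continuous_intros
          continuous_on_product_coordinates)
    from closed_vimage[OF closed_pos_def this] show ?thesis
      using closed_Int[OF closed_pos_def] by (fastforce simp: D_def vimage_def Collect_conj_eq)
  qed
  then have compD: "compact D"
    using compact_Int_closed[OF compact_dominated, of D C] D by (simp add: Int_absorb1)
  have contL: "continuous_on D L"
  proof -
    have "continuous_on D (\<lambda>p. mean_inner p \<phi>)"
      using continuous_on_subset[OF continuous_on_mean_inner[OF g\<phi>, of C 0] D] by simp
    moreover have "continuous_on D (\<lambda>p. p 0)"
      by (rule continuous_on_subset[OF continuous_on_product_coordinates]) simp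
    ultimately show ?thesis unfolding L_def[abs_def] by (intro continuous_intros)
  qed
  have "\<phi> \<in> D" by (simp add: D_def p\<phi> pos_def_zero)
  then obtain p where p: "p \<in> D" "\<And>q. q \<in> D \<Longrightarrow> L q \<le> L p"
    using continuous_attains_sup[OF compD _ contL] by (metis empty_iff)
  then have pp: "pos_def p" and pp': "pos_def (\<lambda>t. \<phi> t - p t)" and gp: "gauge_continuous p"
    using D dominated_gauge_continuous by (auto simp: D_def)
  have "0 < L \<phi>" using \<kappa> by (simp add: L_def Re_mean_inner_self g\<phi>)
  also have "L \<phi> \<le> L p" by (rule p(2)) fact
  finally have "0 < L p" .
  have "0 < Re (p 0)"
  proof (rule ccontr)
    assume "\<not> 0 < Re (p 0)"
    then have "norm (p t) \<le> 0" for t using pos_def_norm_le[OF pp, of t] by linarith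
    then have "p = (\<lambda>_. 0)" by auto
    then have "L p = 0" using mean_inner_sum_left[of "{}" "\<lambda>_. \<phi>" \<phi> "\<lambda>_. 0"] g\<phi> by (simp add: L_def)
    with \<open>0 < L p\<close> show False by simp
  qed
  moreover have "pos_def (\<lambda>t. mean_convolution \<phi> p t - of_real \<kappa> * p t)"
  proof (rule pos_defI)
    show "mean_convolution \<phi> p (- t) - of_real \<kappa> * p (- t) =
        cnj (mean_convolution \<phi> p t - of_real \<kappa> * p t)" for t
      by (simp add: mean_convolution_uminus[OF p\<phi> pp g\<phi> gp] pos_def_uminus[OF pp])
  next
    fix n :: nat and s and w :: "nat \<Rightarrow> complex"
    let ?q = "smear {..<n} s w p"
    \<comment> \<open>Large enough that \<open>?q / K\<close> can be removed from \<open>p\<close>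
      without leaving \<open>D\<close>; the added 1 makes division by \<open>K\<close>
      legitimate.\<close>
    define K where "K = (\<Sum>i<n. norm (w i))\<^sup>2 + 1"
    have K: "K > 0" by (simp add: K_def add_nonneg_pos)
    let ?r = "\<lambda>t. of_real (1 / K) * ?q t"
    have gq: "gauge_continuous ?q" by (rule gauge_continuous_smear[OF gp])
    have gr: "gauge_continuous ?r" by (intro gauge_continuous_cmult gq)
    have "pos_def ?r" using K by (intro pos_def_cmult pos_def_smear pp) auto
    moreover have "pos_def (\<lambda>t. of_real (1 / K) * (of_real K * p t - ?q t))"
      using K by (intro pos_def_cmult pos_def_diff_smear pp) (auto simp: K_def)
    moreover have "(\<lambda>t. of_real (1 / K) * (of_real K * p t - ?q t)) = (\<lambda>t. p t - ?r t)"
      using K by (auto simp: field_simps)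
    ultimately have "(\<lambda>t. p t - ?r t) \<in> D"
      using pos_def_add[OF pp', of ?r] by (simp add: D_def algebra_simps)
    from p(2)[OF this] have "L (\<lambda>t. p t - ?r t) \<le> L p" .
    moreover have "L (\<lambda>t. p t - ?r t) = L p - L ?r"
      unfolding L_def mean_inner_diff_left[OF gp gr g\<phi>] by (simp add: algebra_simps)
    ultimately have "0 \<le> L ?r" by simp
    moreover have "L ?r = L ?q / K"
      unfolding L_def mean_inner_cmult_left[OF gq g\<phi>] using K by (simp add: field_simps)
    ultimately have "0 \<le> L ?q" using K by (simp add: zero_le_divide_iff)
    then show "0 \<le> Re (smear {..<n} s w (\<lambda>t. mean_convolution \<phi> p t - of_real \<kappa> * p t) 0)"
      by (simp add: smear_diff smear_cmult L_def mean_convolution_0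
          mean_convolution_smear[OF g\<phi> gp, symmetric])
  qed
  ultimately show ?thesis using pp gp by (auto simp: spectral_cone_def)
qed

text \<open>A maximiser of the strictly convex functional \<open>mean_square\<close> over the normalised cone is
  proportional to each of the two parts of the decomposition of \<open>q\<close> with spectral weights
  \<open>(1 \<plusminus> Re (e * \<eta> a)) / 2\<close>; this forces multiplicativity.\<close>

lemma ex_character:
  assumes \<phi>: "\<phi> \<in> dominated C" and "\<phi> \<noteq> (\<lambda>_. 0)"
  shows "\<exists>\<eta> C'. character \<eta> \<and> \<eta> \<in> dominated C' \<and> 0 < Re (mean_inner \<phi> \<eta>)"
proof -
  note g\<phi> = dominated_gauge_continuous[OF \<phi>] and p\<phi> = dominated_pos_def[OF \<phi>]
  obtain a where "\<phi> a \<noteq> 0" using assms(2) by auto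
  then have "0 < norm (\<phi> a)" and ms: "0 < mean_square \<phi>" using mean_square_pos[OF g\<phi>] by auto
  then have \<phi>0: "0 < Re (\<phi> 0)" using pos_def_norm_le[OF p\<phi>, of a] by linarith
  \<comment> \<open>Half the threshold below which the cone is known to be nontrivial.\<close>
  define \<kappa> where "\<kappa> = mean_square \<phi> / (2 * Re (\<phi> 0))"
  have \<kappa>: "0 < \<kappa>" "\<kappa> * Re (\<phi> 0) < mean_square \<phi>" using \<phi>0 ms by (auto simp: \<kappa>_def)
  define C' where "C' = max 1 (C / \<kappa>)"
  define Q where "Q = {q \<in> spectral_cone \<phi> \<kappa>. q 0 = 1}"
  have Qdom: "Q \<subseteq> dominated C'"
    using spectral_cone_dominated[OF \<phi> _ _ \<kappa>(1)] by (auto simp: Q_def C'_def)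
  have normalise: "(\<lambda>t. of_real (1 / Re (q 0)) * q t) \<in> Q"
    if "q \<in> spectral_cone \<phi> \<kappa>" "0 < Re (q 0)" for q
  proof -
    have "q 0 = of_real (Re (q 0))"
      using that(1) pos_def_of_real_0[of q] by (simp add: spectral_cone_def)
    then have "of_real (1 / Re (q 0)) * q 0 = 1" using that(2)
      by (metis less_irrefl nonzero_eq_divide_eq of_real_1 of_real_mult)
    then show ?thesis
      using spectral_cone_cmult[OF g\<phi> that(1), of "1 / Re (q 0)"] that(2)
      by (cases "q 0 = 0") (simp_all add: Q_def)
  qed
  have "Q \<noteq> {}" using spectral_cone_nontrivial[OF \<phi> \<kappa>(2)] normalise by blast
  moreover have "compact Q"
  proof -
    let ?G = "\<lambda>q t. mean_convolution \<phi> q t - of_real \<kappa> * q t"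
    have coord: "continuous_on (dominated C') (\<lambda>q. q t)" for t
      by (rule continuous_on_subset[OF continuous_on_product_coordinates]) simp
    have "continuous_on (dominated C') ?G"
      unfolding mean_convolution_def
      by (intro continuous_on_coordinatewise_then_product continuous_intros
          continuous_on_mean_inner[OF g\<phi>] coord)
    then have 1: "closed (dominated C' \<inter> ?G -` {p. pos_def p})"
      using closed_dominated closed_pos_def by (rule continuous_closed_preimage)
    have 2: "closed (dominated C' \<inter> (\<lambda>q. q 0) -` {1})"
      by (rule continuous_closed_preimage[OF coord closed_dominated]) simp
    have "compact (dominated C' \<inter> ((dominated C' \<inter> ?G -` {p. pos_def p}) \<inter>
        (dominated C' \<inter> (\<lambda>q. q 0) -` {1})))"
      by (rule compact_Int_closed[OF compact_dominated closed_Int[OF 1 2]])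
    moreover have "dominated C' \<inter> ((dominated C' \<inter> ?G -` {p. pos_def p}) \<inter>
        (dominated C' \<inter> (\<lambda>q. q 0) -` {1})) = Q"
      using Qdom dominated_pos_def dominated_gauge_continuous
      by (auto simp: Q_def spectral_cone_def)
    ultimately show ?thesis by simp
  qed
  moreover have "continuous_on Q mean_square"
    using continuous_on_subset[OF continuous_on_mean_square Qdom] .
  ultimately obtain q where q: "q \<in> Q" "\<And>r. r \<in> Q \<Longrightarrow> mean_square r \<le> mean_square q"
    using continuous_attains_sup[of Q mean_square] by blast
  then have qc: "q \<in> spectral_cone \<phi> \<kappa>" and q0: "q 0 = 1" and pq: "pos_def q"
    and gq: "gauge_continuous q"
    by (auto simp: Q_def spectral_cone_def)
  \<comment> \<open>As a smear of \<open>q\<close> it stays in the cone. For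
    \<open>cmod e = 1\<close> a character \<eta> receives the factor
    \<open>(cmod (1 + e * \<eta> a))\<^sup>2 / 4\<close>, and the factors for \<open>e\<close> and
    \<open>- e\<close> add up to 1.\<close>
  define part where
    "part e a = smear {0,1::nat} (\<lambda>i. if i = 0 then 0 else a) (\<lambda>i. if i = 0 then 1/2 else e/2) q" for e a
  have part_eq: "part e a t = (of_real (1 + (cmod e)\<^sup>2) * q t + e * q (t + a) + cnj e * q (t - a)) / 4"
    for e a t
    unfolding part_def smear_def by (simp add: complex_norm_square field_simps del: of_real_power)
  have part: "part e a t = of_real (Re (part e a 0)) * q t" if e: "cmod e = 1" for e a t
  proof -
    let ?x = "Re (part e a 0)" and ?y = "Re (part (- e) a 0)"
    have cone: "part e a \<in> spectral_cone \<phi> \<kappa>" for e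
      unfolding part_def by (rule spectral_cone_smear[OF g\<phi> qc]) simp
    have sum: "part e a t + part (- e) a t = q t" for t
      using e by (simp add: part_eq field_simps)
    have xy: "?x + ?y = 1" using arg_cong[OF sum[of 0], of Re] q0 by simp
    have zero: "part e a t = 0" if "Re (part e a 0) \<le> 0" for e t
    proof -
      have "pos_def (part e a)" using cone[of e] by (simp add: spectral_cone_def)
      from pos_def_norm_le[OF this, of t] that have "norm (part e a t) \<le> 0" by linarith
      then show ?thesis by simp
    qed
    \<comment> \<open>In the first two cases one part has no positive value at 0 and therefore
      vanishes identically, so the other one is \<open>q\<close>.\<close>
    consider "?x \<le> 0" | "?y \<le> 0" | "0 < ?x" "0 < ?y" by linarith
    then show ?thesis
    proof cases
      case 1
      then show ?thesis using zero by simp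
    next
      case 2
      then have "part e a t = q t" for t using zero[of "- e"] sum[of t] by simp
      then show ?thesis using q0 by simp
    next
      case 3
      define u where "u t = of_real (1 / ?x) * part e a t" for t
      define v where "v t = of_real (1 / ?y) * part (- e) a t" for t
      have uv: "u \<in> Q" "v \<in> Q"
        using normalise[OF cone 3(1)] normalise[OF cone 3(2)] by (simp_all add: u_def[abs_def] v_def[abs_def])
      then have g: "gauge_continuous u" "gauge_continuous v" by (auto simp: Q_def spectral_cone_def)
      have comb: "of_real ?x * u t = part e a t" "of_real ?y * v t = part (- e) a t" for t
        unfolding u_def v_def using 3 by simp_all
      have q_eq: "q = (\<lambda>t. of_real ?x * u t + of_real ?y * v t)"
        unfolding comb sum by simp
      \<comment> \<open>Neither normalised part exceeds \<open>q\<close> in mean square, so the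
        convexity defect cannot be positive; faithfulness then gives \<open>u = v\<close>.\<close>
      have "mean_square q = ?x * mean_square u + ?y * mean_square v
          - ?x * ?y * mean_square (\<lambda>s. u s - v s)"
        using mean_square_convex[OF g xy] q_eq by simp
      also have "\<dots> \<le> ?x * mean_square q + ?y * mean_square q - ?x * ?y * mean_square (\<lambda>s. u s - v s)"
        using q(2)[OF uv(1)] q(2)[OF uv(2)] 3 by (intro diff_right_mono add_mono mult_left_mono) auto
      also have "\<dots> = (?x + ?y) * mean_square q - ?x * ?y * mean_square (\<lambda>s. u s - v s)"
        by (simp only: distrib_right)
      finally have "?x * ?y * mean_square (\<lambda>s. u s - v s) \<le> 0" using xy by simp
      then have "\<not> 0 < mean_square (\<lambda>s. u s - v s)" using 3 by (simp add: mult_le_0_iff not_less)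
      then have "u t = v t" for t
        using mean_square_pos[OF gauge_continuous_diff[OF g], of t] by auto
      then have "q t = of_real (?x + ?y) * u t" for t
        using fun_cong[OF q_eq, of t] by (simp add: distrib_right)
      then have "q = u" using xy by auto
      then show ?thesis using comb(1)[of t] by simp
    qed
  qed
  have "q (t + a) = q a * q t" for a t
  proof -
    have *: "e * q (t + a) + cnj e * q (t - a) = of_real (2 * Re (e * q a)) * q t" if e: "cmod e = 1" for e
    proof -
      have "Re (part e a 0) = (2 + 2 * Re (e * q a)) / 4"
        using pos_def_uminus[OF pq, of a] by (simp add: part_eq q0 e)
      then have "part e a t = of_real ((2 + 2 * Re (e * q a)) / 4) * q t"
        unfolding part[OF e, of a t] by (simp only:)
      then have "4 * part e a t = 2 * q t + of_real (2 * Re (e * q a)) * q t"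
        by (simp add: algebra_simps add_divide_distrib)
      moreover have "4 * part e a t = 2 * q t + (e * q (t + a) + cnj e * q (t - a))"
        unfolding part_eq by (simp add: e)
      ultimately show ?thesis by (metis add_left_cancel)
    qed
    \<comment> \<open>The values \<open>e = 1\<close> and \<open>e = \<i>\<close> yield the cosine
      and the sine form of the addition law; their combination is multiplicativity.\<close>
    have "q (t + a) + q (t - a) = 2 * of_real (Re (q a)) * q t" using *[of 1] by simp
    moreover have "\<i> * (q (t + a) - q (t - a)) = - 2 * of_real (Im (q a)) * q t"
      using *[of \<i>] by (simp add: right_diff_distrib)
    then have "- \<i> * (\<i> * (q (t + a) - q (t - a))) = - \<i> * (- 2 * of_real (Im (q a)) * q t)" by simp
    then have "q (t + a) - q (t - a) = 2 * \<i> * of_real (Im (q a)) * q t"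
      by (simp flip: mult.assoc)
    ultimately have "2 * q (t + a) = 2 * (of_real (Re (q a)) + \<i> * of_real (Im (q a))) * q t"
      by (simp add: algebra_simps)
    then show ?thesis by (simp flip: complex_eq)
  qed
  then have "q (s + t) = q s * q t" for s t by (simp add: add.commute)
  moreover have "norm (q t) = 1" for t
  proof -
    have "q t * cnj (q t) = 1"
      using calculation[of t "- t"] pos_def_uminus[OF pq, of t] q0 by simp
    then have "(norm (q t))\<^sup>2 = 1\<^sup>2"
      by (simp add: complex_norm_square[symmetric] flip: of_real_power)
    then show ?thesis by (rule power2_eq_imp_eq) simp_all
  qed
  ultimately have "character q" by (simp add: character_def)
  moreover have "q \<in> dominated C'" using q(1) Qdom by blast
  moreover have "0 < Re (mean_inner \<phi> q)"
  proof -
    have "0 \<le> Re (mean_convolution \<phi> q 0 - of_real \<kappa> * q 0)"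
      using qc by (intro pos_def_Re_0_nonneg) (simp add: spectral_cone_def)
    then show ?thesis
      using \<kappa>(1) q0 mean_inner_cnj[OF gq g\<phi>] by (simp add: mean_convolution_0)
  qed
  ultimately show ?thesis by blast
qed

section \<open>Orthogonality of characters and the Fourier expansion\<close>

lemma mean_inner_character_self:
  assumes "character \<eta>"
  shows "mean_inner \<eta> \<eta> = 1"
  unfolding mean_inner_def by (simp add: character_mult_cnj[OF assms] mean_eqI has_mean_const)

text \<open>Translating by a point \<open>a\<close> where the characters differ leaves the mean
  unchanged but multiplies it by \<open>\<eta> a * cnj (\<xi> a)\<close>, which is not 1.\<close>

lemma mean_inner_characters:
  assumes "character \<eta>" "character \<xi>" "gauge_continuous \<eta>" "gauge_continuous \<xi>" "\<eta> \<noteq> \<xi>"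
  shows "mean_inner \<eta> \<xi> = 0"
proof -
  obtain a where a: "\<eta> a \<noteq> \<xi> a" using assms(5) by auto
  have "\<eta> a * cnj (\<xi> a) \<noteq> 1"
  proof
    assume "\<eta> a * cnj (\<xi> a) = 1"
    then have "\<eta> a * (\<xi> a * cnj (\<xi> a)) = \<xi> a" by (simp add: algebra_simps)
    then show False using a by (simp add: character_mult_cnj assms(2))
  qed
  moreover have "mean_inner (\<lambda>s. \<eta> (a + s)) (\<lambda>s. \<xi> (a + s)) = \<eta> a * cnj (\<xi> a) * mean_inner \<eta> \<xi>"
    using mean_inner_cmult_left[OF assms(3,4), of "\<eta> a * cnj (\<xi> a)"]
    by (simp add: mean_inner_def character_add assms(1,2) ac_simps)
  ultimately show ?thesis
    using mean_inner_translate[OF assms(3,4), of a] by simp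
qed

lemma mean_inner_character_nonneg:
  assumes "pos_def p" "gauge_continuous p" "character \<eta>" "gauge_continuous \<eta>"
  shows "0 \<le> Re (mean_inner p \<eta>)"
    and "pos_def (\<lambda>t. p t - of_real (Re (mean_inner p \<eta>)) * \<eta> t)"
proof -
  have "pos_def (\<lambda>t. p t * cnj (\<eta> t))" by (intro pos_def_mult_character assms character_cnj)
  from pos_def_mean_Re[OF this has_mean_inner] assms show "0 \<le> Re (mean_inner p \<eta>)" by blast
  have "complex_of_real (Re (mean_inner p \<eta>)) = mean_inner p \<eta>"
    using pos_def_mean_inner_Im[OF assms(1) pos_def_character assms(2,4)] assms(3)
    by (simp add: complex_eq_iff)
  then show "pos_def (\<lambda>t. p t - of_real (Re (mean_inner p \<eta>)) * \<eta> t)"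
    using pos_def_diff_character[OF assms(1,3) has_mean_inner[OF assms(2,4)]] by simp
qed

lemma tendsto_coordinatewise:
  fixes f :: "'i \<Rightarrow> 'a \<Rightarrow> 'b::topological_space"
  assumes "\<And>x. ((\<lambda>i. f i x) \<longlongrightarrow> l x) F"
  shows "(f \<longlongrightarrow> l) F"
proof -
  have "limitin (product_topology (\<lambda>_. euclidean) UNIV) f l F"
    unfolding limitin_componentwise using assms by (simp add: limitin_canonical_iff)
  then show ?thesis by (simp add: euclidean_product_topology limitin_canonical_iff)
qed

text \<open>All gauge continuous characters are taken at once. Removing finitely many keeps the
  remainder positive definite, so \<open>Re (\<phi> 0)\<close> bounds every finite sum of
  coefficients. The limit remainder is still dominated, has all coefficients zero, and so must
  vanish by \<open>ex_character\<close>.\<close>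

theorem pos_def_character_expansion:
  assumes \<phi>: "\<phi> \<in> dominated C"
  obtains X c where "\<And>\<eta>. \<eta> \<in> X \<Longrightarrow> character \<eta> \<and> gauge_continuous \<eta> \<and> 0 \<le> c \<eta>"
    "\<And>t. ((\<lambda>\<eta>. complex_of_real (c \<eta>) * \<eta> t) has_sum \<phi> t) X"
proof -
  note g\<phi> = dominated_gauge_continuous[OF \<phi>] and p\<phi> = dominated_pos_def[OF \<phi>]
  define X where "X = {\<eta>. character \<eta> \<and> gauge_continuous \<eta>}"
  define c where "c \<eta> = Re (mean_inner \<phi> \<eta>)" for \<eta>
  define S where "S F t = (\<Sum>\<eta>\<in>F. complex_of_real (c \<eta>) * \<eta> t)" for F t
  define rest where "rest F t = \<phi> t - S F t" for F t
  have gS: "gauge_continuous (S F)" if "F \<subseteq> X" for F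
    unfolding S_def[abs_def] using that
    by (intro gauge_continuous_sum gauge_continuous_cmult) (auto simp: X_def)
  have grest: "gauge_continuous (rest F)" if "F \<subseteq> X" for F
    unfolding rest_def[abs_def] by (intro gauge_continuous_diff g\<phi> gS that)
  have c: "0 \<le> c \<eta>" if "\<eta> \<in> X" for \<eta>
    using that unfolding c_def X_def by (intro mean_inner_character_nonneg p\<phi> g\<phi>) auto
  have inner_rest: "Re (mean_inner (rest F) \<eta>) = (if \<eta> \<in> F then 0 else c \<eta>)"
    if "finite F" "F \<subseteq> X" "\<eta> \<in> X" for F \<eta>
  proof -
    have \<eta>: "character \<eta>" "gauge_continuous \<eta>" using that(3) by (auto simp: X_def)
    have "mean_inner (S F) \<eta> = (\<Sum>\<xi>\<in>F. complex_of_real (c \<xi>) * mean_inner \<xi> \<eta>)"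
      unfolding S_def[abs_def] using that \<eta>(2) by (intro mean_inner_sum_left) (auto simp: X_def)
    also have "\<dots> = (\<Sum>\<xi>\<in>F. if \<xi> = \<eta> then of_real (c \<eta>) else 0)"
      using that \<eta> mean_inner_characters[of _ \<eta>]
      by (intro sum.cong refl) (auto simp: X_def mean_inner_character_self)
    also have "\<dots> = (if \<eta> \<in> F then of_real (c \<eta>) else 0)" using that(1) by simp
    finally show ?thesis
      using mean_inner_diff_left[OF g\<phi> gS[OF that(2)] \<eta>(2)]
      by (simp add: rest_def[abs_def] c_def)
  qed
  have pd_rest: "pos_def (rest F)" if "finite F" "F \<subseteq> X" for F
    using that
  proof (induction F rule: finite_induct)
    case empty
    then show ?case by (simp add: rest_def[abs_def] S_def p\<phi>)
  next
    case (insert \<eta> F)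
    then have \<eta>: "\<eta> \<in> X" "F \<subseteq> X" by auto
    have "pos_def (\<lambda>t. rest F t - of_real (Re (mean_inner (rest F) \<eta>)) * \<eta> t)"
      using insert \<eta> by (intro mean_inner_character_nonneg grest) (auto simp: X_def)
    then show ?case
      using insert inner_rest[OF insert(1) \<eta>(2,1)] by (simp add: rest_def[abs_def] S_def algebra_simps)
  qed
  have dom_rest: "rest F \<in> dominated C" if F: "finite F" "F \<subseteq> X" for F
  proof -
    have re: "Re (S F t) = (\<Sum>\<eta>\<in>F. c \<eta> * Re (\<eta> t))" for t by (simp add: S_def)
    \<comment> \<open>Thus \<open>S F\<close> has nonnegative defect, and subtracting it from \<phi>
      can only lower the defect that has to be bounded.\<close>
    have "Re (S F t) \<le> Re (S F 0)" for t
      unfolding re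
    proof (intro sum_mono mult_left_mono)
      fix \<eta> assume "\<eta> \<in> F"
      then have \<eta>: "character \<eta>" "\<eta> \<in> X" using F by (auto simp: X_def)
      then show "Re (\<eta> t) \<le> Re (\<eta> 0)" "0 \<le> c \<eta>"
        using complex_Re_le_cmod[of "\<eta> t"] c by (simp_all add: norm_character character_0)
    qed
    moreover have "0 \<le> Re (S F 0)"
      unfolding re using F c by (intro sum_nonneg) (auto simp: X_def character_0)
    ultimately show ?thesis
      using \<phi> pd_rest[OF F] unfolding dominated_def rest_def by simp (smt (verit))
  qed
  have sum_c: "sum c F \<le> Re (\<phi> 0)" if "finite F" "F \<subseteq> X" for F
  proof -
    have "S F 0 = (\<Sum>\<eta>\<in>F. complex_of_real (c \<eta>))"
      unfolding S_def using that by (intro sum.cong refl) (auto simp: X_def character_0)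
    then have "Re (S F 0) = sum c F" by simp
    then show ?thesis using pos_def_Re_0_nonneg[OF pd_rest[OF that]] by (simp add: rest_def)
  qed
  have summable: "c summable_on X"
  proof (rule nonneg_bdd_above_summable_on)
    show "bdd_above (sum c ` {F. F \<subseteq> X \<and> finite F})"
      by (rule bdd_aboveI[of _ "Re (\<phi> 0)"]) (use sum_c in blast)
  qed (rule c)
  have abs_summable: "(\<lambda>\<eta>. norm (complex_of_real (c \<eta>) * \<eta> t)) summable_on X" for t
  proof -
    have "norm (complex_of_real (c \<eta>) * \<eta> t) = c \<eta>" if "\<eta> \<in> X" for \<eta>
      using that c[OF that] by (simp add: norm_mult X_def norm_character)
    then show ?thesis using summable by (simp cong: summable_on_cong)
  qed
  define T where "T t = (\<Sum>\<^sub>\<infinity>\<eta>\<in>X. complex_of_real (c \<eta>) * \<eta> t)" for t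
  have T: "((\<lambda>\<eta>. complex_of_real (c \<eta>) * \<eta> t) has_sum T t) X" for t
    unfolding T_def by (rule has_sum_infsum[OF abs_summable_summable[OF abs_summable]])
  define r where "r t = \<phi> t - T t" for t
  have "(rest \<longlongrightarrow> r) (finite_subsets_at_top X)"
  proof (rule tendsto_coordinatewise)
    show "((\<lambda>F. rest F t) \<longlongrightarrow> r t) (finite_subsets_at_top X)" for t
      unfolding rest_def r_def
      by (rule tendsto_diff[OF tendsto_const]) (use T[of t] in \<open>simp add: S_def has_sum_def\<close>)
  qed
  moreover have "\<forall>\<^sub>F F in finite_subsets_at_top X. rest F \<in> dominated C"
    by (intro eventually_finite_subsets_at_top_weakI dom_rest)
  ultimately have r: "r \<in> dominated C"
    using Lim_in_closed_set[OF closed_dominated _ finite_subsets_at_top_neq_bot] by blast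
  have "r = (\<lambda>_. 0)"
  proof (rule ccontr)
    assume "r \<noteq> (\<lambda>_. 0)"
    from ex_character[OF r this] obtain \<eta> where \<eta>: "character \<eta>" "gauge_continuous \<eta>"
      and pos: "0 < Re (mean_inner r \<eta>)"
      using dominated_gauge_continuous by blast
    then have \<eta>X: "\<eta> \<in> X" by (simp add: X_def)
    \<comment> \<open>Half the supposed coefficient. For a finite \<open>F\<close> containing \<eta>
      with tail mass below it, \<open>r\<close> and \<open>rest F\<close> are uniformly that close,
      while \<open>rest F\<close> has coefficient 0 at \<eta>.\<close>
    let ?e = "Re (mean_inner r \<eta>) / 2"
    have "(c has_sum infsum c X) X" using summable by simp
    moreover have "0 < ?e" using pos by simp
    ultimately have "\<forall>\<^sub>F F in finite_subsets_at_top X. dist (sum c F) (infsum c X) < ?e"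
      unfolding has_sum_def by (rule tendstoD)
    then obtain F0 where F0: "finite F0" "F0 \<subseteq> X"
      "\<And>F. finite F \<Longrightarrow> F0 \<subseteq> F \<Longrightarrow> F \<subseteq> X \<Longrightarrow> dist (sum c F) (infsum c X) < ?e"
      unfolding eventually_finite_subsets_at_top by meson
    define F where "F = insert \<eta> F0"
    have F: "finite F" "F \<subseteq> X" "\<eta> \<in> F" using F0 \<eta>X by (auto simp: F_def)
    have "norm (r t - rest F t) \<le> ?e" for t
    proof -
      have sum: "((\<lambda>\<eta>. complex_of_real (c \<eta>) * \<eta> t) has_sum (T t - S F t)) (X - F)"
        unfolding S_def by (rule has_sum_Diff[OF T has_sum_finite[OF F(1)] F(2)])
      have tail: "(c has_sum (infsum c X - sum c F)) (X - F)"
        by (rule has_sum_Diff[OF has_sum_infsum[OF summable] has_sum_finite[OF F(1)] F(2)])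
      have "((\<lambda>\<eta>. norm (complex_of_real (c \<eta>) * \<eta> t)) has_sum (infsum c X - sum c F)) (X - F)"
      proof (rule has_sum_cong[THEN iffD2, OF _ tail])
        fix \<eta> assume "\<eta> \<in> X - F"
        then show "norm (complex_of_real (c \<eta>) * \<eta> t) = c \<eta>"
          using c[of \<eta>] by (simp add: norm_mult X_def norm_character)
      qed
      then have "norm (T t - S F t) \<le> infsum c X - sum c F"
        using sum by (rule norm_has_sum_bound)
      also have "\<dots> \<le> ?e"
      proof -
        have "F0 \<subseteq> F" by (auto simp: F_def)
        from F0(3)[OF F(1) this F(2)] show ?thesis unfolding dist_real_def by linarith
      qed
      finally show ?thesis by (simp add: r_def rest_def norm_minus_commute)
    qed
    from mean_inner_close[OF dominated_gauge_continuous[OF r] grest[OF F(2)] \<eta>(2) this,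
        of 1]
    have "norm (mean_inner r \<eta> - mean_inner (rest F) \<eta>) \<le> ?e"
      by (simp add: norm_character \<eta>(1))
    moreover have "Re (mean_inner (rest F) \<eta>) = 0" using inner_rest[OF F(1,2) \<eta>X] F(3) by simp
    ultimately show False
      using complex_Re_le_cmod[of "mean_inner r \<eta> - mean_inner (rest F) \<eta>"] pos by simp
  qed
  then have "T = \<phi>" by (auto simp: r_def fun_eq_iff)
  with T c show ?thesis by (intro that[of X c]) (auto simp: X_def)
qed

end

section \<open>Correlation functions of a dynamical system\<close>

text \<open>Tube lemma: compactness of the second factor makes continuity in the first uniform over
  it. It controls all orbits of a continuous function simultaneously.\<close>

lemma continuous_compact_uniform_nhds:
  fixes F :: "'a::topological_space \<Rightarrow> 'x::topological_space \<Rightarrow> 'b::metric_space"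
  assumes "compact (UNIV :: 'x set)" "continuous_on UNIV (\<lambda>(u, y). F u y)" "e > 0"
  shows "\<forall>\<^sub>F u in nhds u0. \<forall>y. dist (F u y) (F u0 y) < e"
proof -
  have "continuous_on (UNIV \<times> (UNIV :: 'x set)) (\<lambda>(u, y). F u y)" using assms(2) by simp
  from continuous_on_prod_compactE[OF this assms(1), of u0 "e / 2"] assms(3)
  obtain X0 where X0: "u0 \<in> X0" "open X0"
    "\<forall>u\<in>X0 \<inter> UNIV. \<forall>y\<in>UNIV. dist (F u y) (F u0 y) \<le> e / 2"
    by auto
  have "e / 2 < e" using assms(3) by simp
  with X0(3) have "\<forall>u\<in>X0. \<forall>y. dist (F u y) (F u0 y) < e" by (blast intro: le_less_trans)
  with X0(1,2) show ?thesis unfolding eventually_nhds by blast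
qed

lemma norm_add_square_le: "(norm (x + y))\<^sup>2 \<le> 2 * (norm x)\<^sup>2 + 2 * (norm (y::'a::real_normed_vector))\<^sup>2"
proof -
  have "(norm (x + y))\<^sup>2 \<le> (norm x + norm y)\<^sup>2" by (intro power_mono norm_triangle_ineq) simp
  also have "\<dots> \<le> 2 * (norm x)\<^sup>2 + 2 * (norm y)\<^sup>2"
    using sum_squares_ge_zero[of "norm x - norm y" 0] by (simp add: power2_eq_square algebra_simps)
  finally show ?thesis .
qed

locale dyn_system =
  fixes \<alpha> :: "'g::{topological_ab_group_add, t2_space} \<Rightarrow> 'x::t2_space \<Rightarrow> 'x" and m :: "'x measure"
  assumes dynamical: "dynamical_system \<alpha> m"
begin

lemma compact_UNIV: "compact (UNIV :: 'x set)"
  and action_0: "\<alpha> 0 x = x"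
  and action_add: "\<alpha> (s + t) x = \<alpha> s (\<alpha> t x)"
  and continuous_action: "continuous_on UNIV (\<lambda>(t, x). \<alpha> t x)"
  and radon: "radon_measure m"
  and invariant: "A \<in> sets m \<Longrightarrow> emeasure m (\<alpha> t -` A) = emeasure m A"
  using dynamical by (simp_all add: dynamical_system_def)

lemma sets_m [measurable_cong, simp]: "sets m = sets borel"
  using radon by (simp add: radon_measure_def)

lemma space_m [simp]: "space m = UNIV"
  using sets_eq_imp_space_eq[OF sets_m] by simp

sublocale prob_space m
  using dynamical by (simp add: dynamical_system_def)

lemma continuous_action_flip:
  assumes "continuous_on UNIV (f :: 'x \<Rightarrow> 'b::topological_space)"
  shows "continuous_on UNIV (\<lambda>(t, x). f (\<alpha> (- t) x))"
proof -
  have "continuous_on UNIV (\<lambda>p. (\<lambda>(t, x). \<alpha> t x) (- fst p, snd p :: 'x))"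
    by (intro continuous_on_compose2[OF continuous_action] continuous_intros) auto
  then have "continuous_on UNIV (\<lambda>p. f (\<alpha> (- fst p) (snd p)))"
    by (intro continuous_on_compose2[OF assms]) auto
  then show ?thesis by (simp add: case_prod_unfold)
qed

lemma continuous_orbit:
  assumes "continuous_on UNIV (f :: 'x \<Rightarrow> 'b::topological_space)"
  shows "continuous_on UNIV (\<lambda>t. f (\<alpha> (- t) x))"
proof -
  have "continuous_on UNIV (\<lambda>t. (t, x))" by (intro continuous_intros)
  from continuous_on_compose2[OF continuous_action_flip[OF assms] this] show ?thesis by simp
qed

lemma continuous_translate:
  assumes "continuous_on UNIV (f :: 'x \<Rightarrow> 'b::topological_space)"
  shows "continuous_on UNIV (\<lambda>x. f (\<alpha> t x))"
proof -
  have "continuous_on UNIV (\<lambda>x :: 'x. (- t, x))" by (intro continuous_intros)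
  from continuous_on_compose2[OF continuous_action_flip[OF assms] this] show ?thesis by simp
qed

lemma measurable_action [measurable]: "\<alpha> t \<in> measurable m m"
proof -
  have "continuous_on UNIV (\<alpha> t)" by (rule continuous_translate[OF continuous_on_id])
  then have "\<alpha> t \<in> borel_measurable borel" by (rule borel_measurable_continuous_onI)
  then show ?thesis unfolding measurable_cong_sets[OF sets_m sets_m] .
qed

lemma distr_action: "distr m m (\<alpha> t) = m"
  by (rule measure_eqI) (simp_all add: emeasure_distr invariant)

lemma integral_action:
  fixes f :: "'x \<Rightarrow> 'b::{banach, second_countable_topology}"
  assumes "f \<in> borel_measurable m"
  shows "(LINT x|m. f (\<alpha> t x)) = (LINT x|m. f x)"
  using integral_distr[OF measurable_action assms] by (simp add: distr_action)

lemma integrable_action: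
  fixes f :: "'x \<Rightarrow> 'b::{banach, second_countable_topology}"
  assumes "integrable m f"
  shows "integrable m (\<lambda>x. f (\<alpha> t x))"
  using integrable_distr[OF measurable_action[of t], of f] assms by (simp add: distr_action)

lemma borel_measurable_continuous:
  "continuous_on UNIV (f :: 'x \<Rightarrow> 'b::topological_space) \<Longrightarrow> f \<in> borel_measurable m"
  using borel_measurable_continuous_onI by (simp add: measurable_cong_sets[OF sets_m refl])

lemma continuous_bounded:
  assumes "continuous_on UNIV (f :: 'x \<Rightarrow> 'b::real_normed_vector)"
  obtains C where "C > 0" "\<And>x. norm (f x) \<le> C"
  using compact_imp_bounded[OF compact_continuous_image[OF assms compact_UNIV]]
  by (auto simp: bounded_pos)

lemma integrable_continuous:
  fixes f :: "'x \<Rightarrow> 'b::{banach, second_countable_topology}"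
  assumes "continuous_on UNIV f"
  shows "integrable m f"
proof -
  obtain C where "\<And>x. norm (f x) \<le> C" using continuous_bounded[OF assms] by blast
  then show ?thesis
    by (intro integrable_const_bound[of _ C] borel_measurable_continuous assms) simp
qed

lemma L2_measurable: "f \<in> L2_functions m \<Longrightarrow> f \<in> borel_measurable m"
  and L2_integrable_square: "f \<in> L2_functions m \<Longrightarrow> integrable m (\<lambda>x. (norm (f x))\<^sup>2)"
  by (simp_all add: L2_functions_def)

lemma L2_continuous: "continuous_on UNIV f \<Longrightarrow> f \<in> L2_functions m"
  unfolding L2_functions_def
  by (simp add: borel_measurable_continuous integrable_continuous continuous_intros)

lemma L2_add:
  assumes "f \<in> L2_functions m" "g \<in> L2_functions m"
  shows "(\<lambda>x. f x + g x) \<in> L2_functions m"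
proof -
  note [measurable] = assms[THEN L2_measurable]
  have "integrable m (\<lambda>x. 2 * (norm (f x))\<^sup>2 + 2 * (norm (g x))\<^sup>2)"
    using assms by (simp add: L2_integrable_square)
  then have "integrable m (\<lambda>x. (norm (f x + g x))\<^sup>2)"
    by (rule Bochner_Integration.integrable_bound) (simp_all add: norm_add_square_le)
  then show ?thesis by (simp add: L2_functions_def)
qed

lemma L2_cmult: "f \<in> L2_functions m \<Longrightarrow> (\<lambda>x. c * f x) \<in> L2_functions m"
  unfolding L2_functions_def by (auto simp: norm_mult power_mult_distrib)

lemma L2_diff:
  "f \<in> L2_functions m \<Longrightarrow> g \<in> L2_functions m \<Longrightarrow> (\<lambda>x. f x - g x) \<in> L2_functions m"
  using L2_add[of f "\<lambda>x. - 1 * g x"] L2_cmult[of g "- 1"] by simp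

lemma L2_action: "f \<in> L2_functions m \<Longrightarrow> (\<lambda>x. f (\<alpha> t x)) \<in> L2_functions m"
  unfolding L2_functions_def
  using integrable_action[of "\<lambda>x. (norm (f x))\<^sup>2" t] measurable_compose[OF measurable_action]
  by auto

lemma L2_mult_integrable:
  assumes "f \<in> L2_functions m" "g \<in> L2_functions m"
  shows "integrable m (\<lambda>x. f x * cnj (g x))"
proof -
  note [measurable] = assms[THEN L2_measurable]
  have "integrable m (\<lambda>x. (norm (f x))\<^sup>2 + (norm (g x))\<^sup>2)"
    using assms by (simp add: L2_integrable_square)
  moreover have bound: "norm (a * cnj b) \<le> (norm a)\<^sup>2 + (norm b)\<^sup>2" for a b :: complex
  proof -
    have "2 * norm a * norm b \<le> (norm a)\<^sup>2 + (norm b)\<^sup>2" by (rule sum_squares_bound)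
    moreover have "0 \<le> norm a * norm b" by simp
    ultimately show ?thesis unfolding norm_mult complex_mod_cnj by linarith
  qed
  ultimately show ?thesis
  proof (elim Bochner_Integration.integrable_bound)
    have [measurable]: "cnj \<in> borel_measurable borel"
      by (intro borel_measurable_continuous_onI continuous_intros)
    show "(\<lambda>x. f x * cnj (g x)) \<in> borel_measurable m" by measurable
  qed (auto intro!: AE_I2 order_trans[OF bound])
qed

definition correlation :: "('x \<Rightarrow> complex) \<Rightarrow> 'g \<Rightarrow> complex" where
  "correlation f t = (LINT x|m. f (\<alpha> (- t) x) * cnj (f x))"

definition L2_displacement :: "('x \<Rightarrow> complex) \<Rightarrow> 'g \<Rightarrow> real" where
  "L2_displacement f t = (LINT x|m. (norm (f (\<alpha> (- t) x) - f x))\<^sup>2)"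

lemma correlation_diff:
  assumes f: "f \<in> L2_functions m"
  shows "correlation f (s - t) = (LINT x|m. f (\<alpha> (- s) x) * cnj (f (\<alpha> (- t) x)))"
proof -
  note [measurable] = L2_measurable[OF f]
  have "\<alpha> (- (s - t)) (\<alpha> (- t) x) = \<alpha> (- s) x" for x
    by (simp flip: action_add)
  moreover have "(\<lambda>x. f (\<alpha> (- (s - t)) x) * cnj (f x)) \<in> borel_measurable m"
    by (rule borel_measurable_integrable[OF L2_mult_integrable[OF L2_action[OF f] f]])
  from integral_action[OF this, of "- t"]
  have "correlation f (s - t) =
      (LINT x|m. f (\<alpha> (- (s - t)) (\<alpha> (- t) x)) * cnj (f (\<alpha> (- t) x)))"
    by (simp only: correlation_def)
  ultimately show ?thesis by simp
qed

lemma correlation_uminus: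
  assumes f: "f \<in> L2_functions m"
  shows "correlation f (- t) = cnj (correlation f t)"
proof -
  have "correlation f (0 - t) = (LINT x|m. cnj (f (\<alpha> (- t) x) * cnj (f x)))"
    unfolding correlation_diff[OF f] by (simp add: action_0 mult.commute)
  also have "\<dots> = cnj (correlation f t)" unfolding correlation_def by (rule Bochner_Integration.integral_cnj)
  finally show ?thesis by simp
qed

lemma pos_def_correlation:
  assumes f: "f \<in> L2_functions m"
  shows "pos_def (correlation f)"
proof (rule pos_defI)
  fix n :: nat and s :: "nat \<Rightarrow> 'g" and w
  let ?F = "\<lambda>i x. f (\<alpha> (- s i) x)"
  have int: "integrable m (\<lambda>x. ?F i x * cnj (?F j x))" for i j
    by (intro L2_mult_integrable L2_action f)
  have "smear {..<n} s w (correlation f) 0 =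
      (\<Sum>i<n. \<Sum>j<n. (LINT x|m. w i * cnj (w j) * (?F i x * cnj (?F j x))))"
    unfolding smear_def by (simp add: correlation_diff[OF f])
  also have "\<dots> = (LINT x|m. (\<Sum>i<n. \<Sum>j<n. w i * cnj (w j) * (?F i x * cnj (?F j x))))"
    by (subst Bochner_Integration.integral_sum | simp add: int)+
  also have "\<dots> = (LINT x|m. complex_of_real ((norm (\<Sum>i<n. w i * ?F i x))\<^sup>2))"
  proof (rule Bochner_Integration.integral_cong[OF refl])
    fix x
    have "(\<Sum>i<n. \<Sum>j<n. w i * cnj (w j) * (?F i x * cnj (?F j x))) =
        (\<Sum>i<n. w i * ?F i x) * cnj (\<Sum>i<n. w i * ?F i x)"
      unfolding cnj_sum sum_product by (simp add: ac_simps)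
    then show "(\<Sum>i<n. \<Sum>j<n. w i * cnj (w j) * (?F i x * cnj (?F j x))) =
        complex_of_real ((norm (\<Sum>i<n. w i * ?F i x))\<^sup>2)" by (simp only: complex_norm_square)
  qed
  also have "\<dots> = complex_of_real (LINT x|m. (norm (\<Sum>i<n. w i * ?F i x))\<^sup>2)"
    by (rule integral_complex_of_real)
  finally show "0 \<le> Re (smear {..<n} s w (correlation f) 0)" by simp
qed (rule correlation_uminus[OF f])

text \<open>Expand the square and use invariance of \<open>m\<close>. The defect of the correlation
  function, later used as the gauge, thereby becomes half the squared displacement of
  \<open>f\<close>.\<close>

lemma correlation_displacement:
  assumes f: "f \<in> L2_functions m"
  shows "Re (correlation f 0) - Re (correlation f t) = L2_displacement f t / 2"
proof -
  let ?g = "\<lambda>x. f (\<alpha> (- t) x)"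
  have g: "?g \<in> L2_functions m" by (rule L2_action[OF f])
  note int = L2_mult_integrable[OF g g] L2_mult_integrable[OF f f] L2_mult_integrable[OF g f]
    L2_mult_integrable[OF f g]
  have "complex_of_real (L2_displacement f t) =
      (LINT x|m. complex_of_real ((norm (?g x - f x))\<^sup>2))"
    unfolding L2_displacement_def by (rule integral_complex_of_real[symmetric])
  also have "\<dots> = (LINT x|m. (?g x * cnj (?g x) + f x * cnj (f x)) - (?g x * cnj (f x) + f x * cnj (?g x)))"
    by (intro Bochner_Integration.integral_cong refl) (simp only: complex_norm_square complex_cnj_diff, simp add: algebra_simps)
  also have "\<dots> = (LINT x|m. ?g x * cnj (?g x)) + (LINT x|m. f x * cnj (f x)) -
      ((LINT x|m. ?g x * cnj (f x)) + (LINT x|m. f x * cnj (?g x)))"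
    by (simp add: int)
  also have "(LINT x|m. ?g x * cnj (?g x)) = correlation f 0"
    using correlation_diff[OF f, of t t] by simp
  also have "(LINT x|m. f x * cnj (f x)) = correlation f 0"
    by (simp add: correlation_def action_0)
  also have "(LINT x|m. ?g x * cnj (f x)) = correlation f t" by (simp add: correlation_def)
  also have "(LINT x|m. f x * cnj (?g x)) = cnj (correlation f t)"
    using correlation_diff[OF f, of 0 t] correlation_uminus[OF f, of t] by (simp add: action_0)
  finally have "Re (complex_of_real (L2_displacement f t)) =
      Re (correlation f 0 + correlation f 0 - (correlation f t + cnj (correlation f t)))" by (rule arg_cong)
  then show ?thesis by simp
qed

section \<open>Density of the continuous functions among the square integrable ones\<close>

definition L2_distance2 :: "('x \<Rightarrow> complex) \<Rightarrow> ('x \<Rightarrow> complex) \<Rightarrow> real" where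
  "L2_distance2 f g = (LINT x|m. (norm (f x - g x))\<^sup>2)"

lemma L2_distance2_nonneg: "0 \<le> L2_distance2 f g"
  by (simp add: L2_distance2_def)

lemma L2_distance2_triangle:
  assumes "f \<in> L2_functions m" "g \<in> L2_functions m" "h \<in> L2_functions m"
  shows "L2_distance2 f h \<le> 2 * L2_distance2 f g + 2 * L2_distance2 g h"
proof -
  have "L2_distance2 f h \<le> (LINT x|m. 2 * (norm (f x - g x))\<^sup>2 + 2 * (norm (g x - h x))\<^sup>2)"
    unfolding L2_distance2_def
  proof (rule integral_mono)
    show "(norm (f x - h x))\<^sup>2 \<le> 2 * (norm (f x - g x))\<^sup>2 + 2 * (norm (g x - h x))\<^sup>2" for x
      using norm_add_square_le[of "f x - g x" "g x - h x"] by simp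
  qed (use assms in \<open>simp_all add: L2_diff L2_integrable_square\<close>)
  then show ?thesis
    using assms by (simp add: L2_distance2_def L2_diff L2_integrable_square)
qed

definition continuous_dense :: "('x \<Rightarrow> complex) \<Rightarrow> bool" where
  "continuous_dense f \<longleftrightarrow> f \<in> L2_functions m \<and>
     (\<forall>e>0. \<exists>g. continuous_on UNIV g \<and> L2_distance2 f g < e)"

lemma continuous_dense_add:
  assumes "continuous_dense f" "continuous_dense g"
  shows "continuous_dense (\<lambda>x. f x + g x)"
  unfolding continuous_dense_def
proof (intro conjI allI impI)
  have fg: "f \<in> L2_functions m" "g \<in> L2_functions m" using assms by (auto simp: continuous_dense_def)
  then show "(\<lambda>x. f x + g x) \<in> L2_functions m" by (rule L2_add)
  fix e :: real assume "e > 0"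
  then obtain f' g' where f': "continuous_on UNIV f'" "L2_distance2 f f' < e / 4"
    and g': "continuous_on UNIV g'" "L2_distance2 g g' < e / 4"
    using assms unfolding continuous_dense_def by (metis divide_pos_pos zero_less_numeral)
  have L: "f' \<in> L2_functions m" "g' \<in> L2_functions m" by (auto intro: L2_continuous f' g')
  have "L2_distance2 (\<lambda>x. f x + g x) (\<lambda>x. f' x + g' x) \<le>
      2 * L2_distance2 (\<lambda>x. f x + g x) (\<lambda>x. f' x + g x) + 2 * L2_distance2 (\<lambda>x. f' x + g x) (\<lambda>x. f' x + g' x)"
    by (intro L2_distance2_triangle L2_add fg L)
  also have "\<dots> = 2 * L2_distance2 f f' + 2 * L2_distance2 g g'" by (simp add: L2_distance2_def)
  also have "\<dots> < e" using f'(2) g'(2) by simp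
  finally show "\<exists>h. continuous_on UNIV h \<and> L2_distance2 (\<lambda>x. f x + g x) h < e"
    using continuous_on_add[OF f'(1) g'(1)] by blast
qed

lemma continuous_dense_cmult:
  assumes "continuous_dense f"
  shows "continuous_dense (\<lambda>x. c * f x)"
  unfolding continuous_dense_def
proof (intro conjI allI impI)
  show "(\<lambda>x. c * f x) \<in> L2_functions m"
    using assms by (intro L2_cmult) (simp add: continuous_dense_def)
  fix e :: real assume e: "e > 0"
  have C: "0 < (norm c)\<^sup>2 + 1" by (simp add: add_nonneg_pos)
  then obtain g where g: "continuous_on UNIV g" "L2_distance2 f g < e / ((norm c)\<^sup>2 + 1)"
    using assms e unfolding continuous_dense_def by (metis divide_pos_pos)
  have "L2_distance2 (\<lambda>x. c * f x) (\<lambda>x. c * g x) = (norm c)\<^sup>2 * L2_distance2 f g"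
    unfolding L2_distance2_def
    by (simp add: norm_mult power_mult_distrib flip: right_diff_distrib)
  also have "\<dots> \<le> ((norm c)\<^sup>2 + 1) * L2_distance2 f g"
    using L2_distance2_nonneg by (intro mult_right_mono) auto
  also have "\<dots> < e" using g(2) C by (simp add: field_simps)
  finally show "\<exists>h. continuous_on UNIV h \<and> L2_distance2 (\<lambda>x. c * f x) h < e"
    using continuous_on_mult_left[OF g(1), of c] by blast
qed

lemma continuous_dense_sum:
  assumes "finite I" "\<And>i. i \<in> I \<Longrightarrow> continuous_dense (f i)"
  shows "continuous_dense (\<lambda>x. \<Sum>i\<in>I. f i x)"
  using assms
proof (induction I rule: finite_induct)
  case empty
  have "\<exists>g. continuous_on UNIV g \<and> L2_distance2 (\<lambda>_. 0) g < e" if "e > 0" for e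
    using that by (intro exI[of _ "\<lambda>_. 0"]) (simp add: L2_distance2_def continuous_on_const)
  then show ?case
    by (simp add: continuous_dense_def L2_continuous continuous_on_const)
qed (simp add: continuous_dense_add)

text \<open>Outer regularity for \<open>A\<close> and for its complement gives open \<open>U\<close>
  and \<open>V\<close> that cover the space and overlap in measure less than \<open>e\<close>. A
  Urysohn function equal to 0 off \<open>U\<close> and 1 off \<open>V\<close> differs from the
  indicator only on the overlap.\<close>

lemma continuous_dense_indicator:
  assumes A: "A \<in> sets m"
  shows "continuous_dense (indicator A)"
  unfolding continuous_dense_def
proof (intro conjI allI impI)
  show "indicator A \<in> L2_functions m"
    using A by (auto simp: L2_functions_def indicator_def intro!: integrable_const_bound[of _ 1])
  fix e :: real assume e: "e > 0"
  have outer: "\<exists>U. open U \<and> B \<subseteq> U \<and> measure m U < measure m B + e / 2" if "B \<in> sets m" for B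
  proof -
    have "emeasure m B = (INF U\<in>{U. open U \<and> B \<subseteq> U}. emeasure m U)"
      using radon that by (simp add: radon_measure_def)
    moreover have "emeasure m B < ennreal (measure m B + e / 2)"
      using e by (simp add: emeasure_eq_measure ennreal_lessI)
    ultimately obtain U where "open U" "B \<subseteq> U" "emeasure m U < ennreal (measure m B + e / 2)"
      by (auto simp: INF_less_iff)
    then show ?thesis
      by (intro exI[of _ U]) (simp add: emeasure_eq_measure ennreal_less_iff)
  qed
  obtain U where U: "open U" "A \<subseteq> U" "measure m U < measure m A + e / 2" using outer[OF A] by blast
  have "- A \<in> sets m" using A by (simp add: Compl_eq_Diff_UNIV)
  then obtain V where V: "open V" "- A \<subseteq> V" "measure m V < measure m (- A) + e / 2"
    using outer by blast
  have "normal_space (euclidean :: 'x topology)"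
    using compact_UNIV
    by (intro compact_Hausdorff_or_regular_imp_normal_space disjI1)
      (simp_all add: compact_space_def Hausdorff_space_def disjnt_def, metis hausdorff)
  then obtain f where f: "continuous_map euclidean (top_of_set {0..1::real}) f"
      "f ` (- U) \<subseteq> {0}" "f ` (- V) \<subseteq> {1}"
    using Urysohn_lemma[of euclidean "- U" "- V" 0 1] U V by (auto simp: disjnt_def)
  then have fc: "continuous_on UNIV f" and f01: "\<And>x. 0 \<le> f x \<and> f x \<le> 1"
    by (auto simp: continuous_map_in_subtopology Pi_iff image_subset_iff)
  have mV: "V \<in> sets m" "U \<in> sets m" using U V by simp_all
  have "L2_distance2 (indicator A) (\<lambda>x. of_real (f x)) \<le> (LINT x|m. indicator (U \<inter> V) x)"
    unfolding L2_distance2_def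
  proof (rule integral_mono)
    show "(norm (indicator A x - complex_of_real (f x)))\<^sup>2 \<le> indicator (U \<inter> V) x" for x
    proof (cases "x \<in> U \<inter> V")
      case True
      have "norm (indicator A x - complex_of_real (f x)) = \<bar>indicator A x - f x\<bar>"
        by (metis (no_types) norm_of_real of_real_diff of_real_indicator)
      then show ?thesis using True f01[of x] by (auto simp: indicator_def abs_square_le_1 power_le_one)
    next
      case False
      then have "indicator A x = complex_of_real (f x)"
        using f(2,3) U(2) V(2) by (auto simp: indicator_def)
      then show ?thesis by simp
    qed
    show "integrable m (\<lambda>x. (norm (indicator A x - complex_of_real (f x)))\<^sup>2)"
      by (rule L2_integrable_square[OF L2_diff[OF \<open>indicator A \<in> L2_functions m\<close>
              L2_continuous[OF continuous_on_of_real[OF fc]]]])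
  qed (use mV in \<open>simp add: emeasure_eq_measure\<close>)
  also have "\<dots> = measure m (U \<inter> V)" using mV by simp
  also have "\<dots> < e"
  proof -
    have "U \<union> V = UNIV" using U(2) V(2) by auto
    then have "measure m (U \<inter> V) = measure m U + measure m V - 1"
      using measure_Un3[of U m V] mV prob_space by (simp add: fmeasurable_eq_sets)
    moreover have "measure m (- A) = 1 - measure m A"
      using prob_compl[OF A] by (simp add: Compl_eq_Diff_UNIV)
    ultimately show ?thesis using U(3) V(3) by simp
  qed
  finally show "\<exists>g. continuous_on UNIV g \<and> L2_distance2 (indicator A) g < e"
    using continuous_on_of_real[OF fc] by blast
qed

lemma continuous_dense_simple:
  assumes s: "simple_function m (s :: 'x \<Rightarrow> complex)"
  shows "continuous_dense s"
proof -
  have fin: "finite (range s)" using simple_functionD(1)[OF s] by simp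
  have "s = (\<lambda>x. \<Sum>y\<in>range s. y * indicator (s -` {y}) x)"
    using fin by (auto simp: indicator_def fun_eq_iff)
  moreover have "continuous_dense (\<lambda>x. \<Sum>y\<in>range s. y * indicator (s -` {y}) x)"
    using simple_functionD(2)[OF s]
    by (intro continuous_dense_sum fin continuous_dense_cmult continuous_dense_indicator) simp
  ultimately show ?thesis by simp
qed

lemma L2_continuous_approx:
  assumes f: "f \<in> L2_functions m" and e: "e > 0"
  obtains g where "continuous_on UNIV g" "L2_distance2 f g < e"
proof -
  note [measurable] = L2_measurable[OF f]
  obtain s where s: "\<And>i. simple_function m (s i)" "\<And>x. (\<lambda>i. s i x) \<longlonglongrightarrow> f x"
    "\<And>i x. norm (s i x) \<le> 2 * norm (f x)"
    using borel_measurable_implies_sequence_metric[OF L2_measurable[OF f], of 0] by auto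
  have [measurable]: "s i \<in> borel_measurable m" for i
    using s(1) by (rule borel_measurable_simple_function)
  have "(\<lambda>i. LINT x|m. (norm (f x - s i x))\<^sup>2) \<longlonglongrightarrow> (LINT x|m. 0)"
  proof (rule integral_dominated_convergence)
    \<comment> \<open>The approximants have modulus at most \<open>2 * norm (f x)\<close>, so the
      difference has at most \<open>3 * norm (f x)\<close>; 9 is the square of 3.\<close>
    show "integrable m (\<lambda>x. 9 * (norm (f x))\<^sup>2)" using L2_integrable_square[OF f] by simp
    show "AE x in m. (\<lambda>i. (norm (f x - s i x))\<^sup>2) \<longlonglongrightarrow> 0"
    proof (rule AE_I2)
      fix x
      have "(\<lambda>i. (norm (f x - s i x))\<^sup>2) \<longlonglongrightarrow> (norm (f x - f x))\<^sup>2"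
        by (intro tendsto_intros s(2))
      then show "(\<lambda>i. (norm (f x - s i x))\<^sup>2) \<longlonglongrightarrow> 0" by simp
    qed
    show "AE x in m. norm ((norm (f x - s i x))\<^sup>2) \<le> 9 * (norm (f x))\<^sup>2" for i
    proof (rule AE_I2)
      fix x
      have "norm (f x - s i x) \<le> 3 * norm (f x)"
        using norm_triangle_ineq4[of "f x" "s i x"] s(3)[of i x] by simp
      then have "(norm (f x - s i x))\<^sup>2 \<le> (3 * norm (f x))\<^sup>2" by (intro power_mono) auto
      then show "norm ((norm (f x - s i x))\<^sup>2) \<le> 9 * (norm (f x))\<^sup>2" by (simp add: power_mult_distrib)
    qed
  qed simp_all
  then have "(\<lambda>i. L2_distance2 f (s i)) \<longlonglongrightarrow> 0" by (simp add: L2_distance2_def)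
  then have "\<forall>\<^sub>F i in sequentially. L2_distance2 f (s i) < e / 4"
    using e by (intro order_tendstoD) auto
  then obtain i where i: "L2_distance2 f (s i) < e / 4" 
    using eventually_happens'[OF sequentially_bot] by blast
  obtain g where g: "continuous_on UNIV g" "L2_distance2 (s i) g < e / 4" "s i \<in> L2_functions m"
    using continuous_dense_simple[OF s(1)] e unfolding continuous_dense_def
    by (metis divide_pos_pos zero_less_numeral)
  have "L2_distance2 f g \<le> 2 * L2_distance2 f (s i) + 2 * L2_distance2 (s i) g"
    by (intro L2_distance2_triangle f g(3) L2_continuous g(1))
  then show ?thesis using that[OF g(1)] i g(2) by simp
qed

end

section \<open>Pure point spectral measures\<close>

lemma relatively_dense_mono: "relatively_dense A \<Longrightarrow> A \<subseteq> B \<Longrightarrow> relatively_dense B"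
  unfolding relatively_dense_def using UN_mono[of A B] by (metis order_refl top.extremum_unique)

lemma dual_group_character: "\<eta> \<in> dual_group \<Longrightarrow> character \<eta>"
  by (simp add: dual_group_def character_def)

lemma openin_dual_eval:
  assumes "open U"
  shows "openin dual_topology {\<eta> \<in> dual_group. \<eta> t \<in> U}"
proof -
  have "{\<eta> \<in> dual_group. \<eta> t \<in> U} = {\<eta> \<in> dual_group. \<eta> ` {t} \<subseteq> U}" by simp
  then show ?thesis
    unfolding dual_topology_def using assms
    by (intro topology_generated_by_Basis CollectI exI[of _ "{t}"] exI[of _ U]) simp
qed

lemma open_dual_subset: "{U. openin dual_topology U} \<subseteq> Pow dual_group"
proof
  fix U :: "('a \<Rightarrow> complex) set" assume "U \<in> {U. openin dual_topology U}"
  then have "U \<subseteq> topspace dual_topology" by (simp add: openin_subset)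
  then show "U \<in> Pow dual_group" by (simp add: topspace_dual_topology)
qed

lemma dual_borel_sets_subset: "dual_borel_sets \<subseteq> Pow dual_group"
  unfolding dual_borel_sets_def using sigma_sets_into_sp[OF open_dual_subset] by blast

lemma measurable_dual_eval:
  assumes "space \<rho> = dual_group" "sets \<rho> = dual_borel_sets"
  shows "(\<lambda>\<eta>. \<eta> t) \<in> borel_measurable \<rho>"
proof (rule borel_measurableI)
  fix U :: "complex set" assume "open U"
  moreover have "(\<lambda>\<eta>. \<eta> t) -` U \<inter> space \<rho> = {\<eta> \<in> dual_group. \<eta> t \<in> U}" using assms by auto
  ultimately show "(\<lambda>\<eta>. \<eta> t) -` U \<inter> space \<rho> \<in> sets \<rho>"
    using assms openin_dual_eval[of U t] by (simp add: dual_borel_sets_def)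
qed

lemma dual_singleton_measurable:
  assumes "\<eta> \<in> dual_group"
  shows "{\<eta>} \<in> dual_borel_sets"
proof -
  have "openin dual_topology (\<Union>t. {\<xi> \<in> dual_group. \<xi> t \<in> - {\<eta> t}})"
    by (rule openin_Union, clarify, rule openin_dual_eval) (simp add: open_Compl)
  then have "dual_group - (\<Union>t. {\<xi> \<in> dual_group. \<xi> t \<in> - {\<eta> t}}) \<in> dual_borel_sets"
    unfolding dual_borel_sets_def by (intro sigma_sets.Compl sigma_sets.Basic) simp
  moreover have "dual_group - (\<Union>t. {\<xi> \<in> dual_group. \<xi> t \<in> - {\<eta> t}}) = {\<eta>}"
    using assms by auto
  ultimately show ?thesis by simp
qed

text \<open>Pigeonhole principle: label \<open>t\<close> by small balls containing the values
  \<open>\<eta> t\<close>. Finitely many labels occur, and subtracting from \<open>t\<close> a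
  chosen point with the same label brings every character of \<open>F\<close> close to 1. The chosen
  points form a finite, hence compact, set.\<close>

lemma finite_characters_return:
  assumes "finite F" "F \<subseteq> dual_group" "\<delta> > 0"
  shows "relatively_dense {t. \<forall>\<eta>\<in>F. norm (\<eta> t - 1) \<le> \<delta>}"
proof -
  have "\<exists>P. finite P \<and> P \<subseteq> cball (0 :: complex) 1 \<and> cball 0 1 \<subseteq> (\<Union>p\<in>P. ball p (\<delta> / 2))"
    using seq_compact_imp_totally_bounded[OF compact_imp_seq_compact[OF compact_cball],
        rule_format, of "\<delta> / 2" "0 :: complex" 1] assms(3) by simp
  then obtain P where P: "finite P" "cball (0 :: complex) 1 \<subseteq> (\<Union>p\<in>P. ball p (\<delta> / 2))" by blast
  have "\<exists>p\<in>P. dist p (\<eta> t) < \<delta> / 2" if "\<eta> \<in> F" for \<eta> t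
  proof -
    have "\<eta> t \<in> cball 0 1" using that assms(2) by (auto simp: dual_group_def)
    from subsetD[OF P(2) this] show ?thesis by simp
  qed
  then obtain p where p: "\<And>\<eta> t. \<eta> \<in> F \<Longrightarrow> p \<eta> t \<in> P \<and> dist (p \<eta> t) (\<eta> t) < \<delta> / 2" by metis
  define c where "c t = restrict (\<lambda>\<eta>. p \<eta> t) F" for t
  have "range c \<subseteq> PiE F (\<lambda>_. P)" using p by (auto simp: c_def)
  then have fin: "finite (range c)" using finite_PiE[OF assms(1), of "\<lambda>_. P"] P(1) finite_subset by blast
  define K where "K = inv c ` range c"
  have close: "norm (\<eta> t - \<eta> (inv c (c t))) \<le> \<delta>" if "\<eta> \<in> F" for \<eta> t
  proof -
    have "c (inv c (c t)) = c t" by (simp add: f_inv_into_f)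
    then have "p \<eta> (inv c (c t)) = p \<eta> t" using that by (metis c_def restrict_apply')
    then show ?thesis
      using p[OF that, of t] p[OF that, of "inv c (c t)"]
        dist_triangle_half_r[of "p \<eta> t" "\<eta> t" \<delta> "\<eta> (inv c (c t))"]
      by (simp add: dist_norm)
  qed
  have "(\<Union>a\<in>{t. \<forall>\<eta>\<in>F. norm (\<eta> t - 1) \<le> \<delta>}. (+) a ` K) = UNIV"
  proof (rule sym, rule UNIV_eq_I)
    fix t
    let ?s = "inv c (c t)"
    have "norm (\<eta> (t - ?s) - 1) \<le> \<delta>" if "\<eta> \<in> F" for \<eta>
    proof -
      have \<eta>: "character \<eta>" using that assms(2) dual_group_character by auto
      have "\<eta> (t - ?s) - 1 = (\<eta> t - \<eta> ?s) * cnj (\<eta> ?s)"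
        by (simp add: character_diff[OF \<eta>] left_diff_distrib character_mult_cnj[OF \<eta>])
      then show ?thesis using close[OF that] by (simp add: norm_mult norm_character[OF \<eta>])
    qed
    moreover have "t = (t - ?s) + ?s" by simp
    ultimately show "t \<in> (\<Union>a\<in>{t. \<forall>\<eta>\<in>F. norm (\<eta> t - 1) \<le> \<delta>}. (+) a ` K)"
      unfolding K_def by blast
  qed
  moreover have "compact K" using fin by (simp add: K_def finite_imp_compact)
  ultimately show ?thesis unfolding relatively_dense_def by blast
qed

lemma pure_point_finite_concentration:
  assumes "finite_measure \<rho>" "pure_point_measure \<rho>" "\<delta> > 0"
    and sing: "\<And>x. x \<in> space \<rho> \<Longrightarrow> {x} \<in> sets \<rho>"
  obtains F where "finite F" "F \<subseteq> space \<rho>" "measure \<rho> (space \<rho> - F) < \<delta>"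
proof -
  interpret finite_measure \<rho> by fact
  have "((\<lambda>x. emeasure \<rho> {x}) has_sum emeasure \<rho> (space \<rho>)) (space \<rho>)"
  proof -
    have "(\<lambda>x. emeasure \<rho> {x}) summable_on space \<rho>" by (rule nonneg_summable_on_complete) simp
    from has_sum_infsum[OF this] assms(2) show ?thesis by (simp add: pure_point_measure_def)
  qed
  then have "(sum (\<lambda>x. emeasure \<rho> {x}) \<longlongrightarrow> ennreal (measure \<rho> (space \<rho>)))
      (finite_subsets_at_top (space \<rho>))"
    unfolding has_sum_def by (subst (asm) emeasure_eq_measure[of "space \<rho>"])
  from tendsto_enn2real[OF this measure_nonneg]
have "\<forall>\<^sub>F F in finite_subsets_at_top (space \<rho>).
      measure \<rho> (space \<rho>) - \<delta> < enn2real (\<Sum>x\<in>F. emeasure \<rho> {x})"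
    by (rule order_tendstoD(1)) (use assms(3) in simp)
  then obtain F where F: "finite F" "F \<subseteq> space \<rho>"
    "measure \<rho> (space \<rho>) - \<delta> < enn2real (\<Sum>x\<in>F. emeasure \<rho> {x})"
    unfolding eventually_finite_subsets_at_top by blast
  have "emeasure \<rho> F = (\<Sum>x\<in>F. emeasure \<rho> {x})"
    using F sing by (intro emeasure_eq_sum_singleton) auto
  then have "measure \<rho> (space \<rho>) - \<delta> < measure \<rho> F" using F(3) by (simp add: measure_def)
  moreover have "F \<in> sets \<rho>" using sets.countable[of F \<rho>] F(1,2) sing by (auto simp: countable_finite)
  ultimately have "measure \<rho> (space \<rho> - F) < \<delta>" by (simp add: finite_measure_compl)
  then show ?thesis using that F by blast
qed

text \<open>A weighted counting measure lives on the power set, whereas a spectral measure must have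
  exactly the dual Borel sets. Pushing forward along the identity passes to this smaller
  sigma-algebra, which contains the singletons.\<close>

lemma ex_pure_point_measure:
  fixes c :: "('g::topological_ab_group_add \<Rightarrow> complex) \<Rightarrow> real"
  assumes X: "X \<subseteq> dual_group" and c: "\<And>\<eta>. \<eta> \<in> X \<Longrightarrow> 0 \<le> c \<eta>" and sum: "c summable_on X"
  obtains \<rho> where "space \<rho> = dual_group" "sets \<rho> = dual_borel_sets" "finite_measure \<rho>"
    "pure_point_measure \<rho>" "\<And>t. (LINT \<eta>|\<rho>. \<eta> t) = (\<Sum>\<^sub>\<infinity>\<eta>\<in>X. of_real (c \<eta>) * \<eta> t)"
proof -
  define d where "d \<eta> = (if \<eta> \<in> X then c \<eta> else 0)" for \<eta>
  have d0: "0 \<le> d \<eta>" for \<eta> using c by (simp add: d_def)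
  have sum_d: "d summable_on A" for A
  proof -
    have "c summable_on (A \<inter> X)" using summable_on_subset_banach[OF sum, of "A \<inter> X"] by simp
    moreover have "d summable_on (A \<inter> X) \<longleftrightarrow> c summable_on (A \<inter> X)"
      by (rule summable_on_cong) (simp add: d_def)
    ultimately have "d summable_on (A \<inter> X)" by simp
    then show ?thesis
      by (rule summable_on_cong_neutral[THEN iffD1, rotated -1]) (auto simp: d_def)
  qed
  define N where "N = density (count_space dual_group) (\<lambda>\<eta>. ennreal (d \<eta>))"
  define S :: "('g \<Rightarrow> complex) measure" where "S = sigma dual_group {U. openin dual_topology U}"
  have S: "space S = dual_group" "sets S = dual_borel_sets"
    unfolding S_def dual_borel_sets_def
    by (simp_all add: space_measure_of sets_measure_of open_dual_subset)
  have id_meas: "(\<lambda>\<eta>. \<eta>) \<in> measurable N S"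
  proof (rule measurableI)
    show "\<eta> \<in> space S" if "\<eta> \<in> space N" for \<eta> using that by (simp add: S N_def)
    show "(\<lambda>\<eta>. \<eta>) -` A \<inter> space N \<in> sets N" if "A \<in> sets S" for A
      by (simp add: N_def)
  qed
  define \<rho> where "\<rho> = distr N S (\<lambda>\<eta>. \<eta>)"
  have space_\<rho>: "space \<rho> = dual_group" and sets_\<rho>: "sets \<rho> = dual_borel_sets"
    by (simp_all add: \<rho>_def S)
  have em: "emeasure \<rho> A = (\<Sum>\<^sub>\<infinity>\<eta>\<in>A. ennreal (d \<eta>))" "emeasure \<rho> A < \<infinity>" if "A \<in> dual_borel_sets" for A
  proof -
    have A: "A \<subseteq> dual_group" using that dual_borel_sets_subset by auto
    have abs: "Infinite_Set_Sum.abs_summable_on d A"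
      unfolding abs_summable_equivalent[symmetric] using sum_d d0 by simp
    have "emeasure \<rho> A = emeasure N A"
      unfolding \<rho>_def using that A id_meas
      by (subst emeasure_distr) (simp_all add: S N_def Int_absorb2)
    also have "\<dots> = (\<integral>\<^sup>+\<eta>. ennreal (d \<eta>) * indicator A \<eta> \<partial>count_space dual_group)"
      unfolding N_def using A by (intro emeasure_density) auto
    also have "\<dots> = (\<integral>\<^sup>+\<eta>. ennreal (d \<eta>) \<partial>count_space A)"
      using A by (subst nn_integral_count_space_eq[of dual_group UNIV])
        (auto simp: nn_integral_count_space_indicator[of A] indicator_def split: if_splits)
    also have "\<dots> = ennreal (infsum d A)"
      using nn_integral_conv_infsetsum[OF abs] d0 infsetsum_infsum[OF abs] by simp
    also have "\<dots> = (\<Sum>\<^sub>\<infinity>\<eta>\<in>A. ennreal (d \<eta>))"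
    proof (rule infsumI[symmetric])
      have "((\<lambda>F. ennreal (sum d F)) \<longlongrightarrow> ennreal (infsum d A)) (finite_subsets_at_top A)"
        using has_sum_infsum[OF sum_d[of A]] unfolding has_sum_def by (rule tendsto_ennrealI)
      then show "((\<lambda>\<eta>. ennreal (d \<eta>)) has_sum ennreal (infsum d A)) A"
      proof -
        have "sum (\<lambda>\<eta>. ennreal (d \<eta>)) = (\<lambda>F. ennreal (sum d F))"
          by (rule ext) (simp add: sum_ennreal d0)
        then show ?thesis
          using \<open>((\<lambda>F. ennreal (sum d F)) \<longlongrightarrow> _) _\<close> by (simp add: has_sum_def)
      qed
    qed
    finally show em: "emeasure \<rho> A = (\<Sum>\<^sub>\<infinity>\<eta>\<in>A. ennreal (d \<eta>))" .
    show "emeasure \<rho> A < \<infinity>"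
      using \<open>emeasure \<rho> A = emeasure N A\<close> \<open>emeasure N A = _\<close>
        \<open>(\<integral>\<^sup>+\<eta>. ennreal (d \<eta>) * indicator A \<eta> \<partial>count_space dual_group) = _\<close>
        \<open>(\<integral>\<^sup>+\<eta>. ennreal (d \<eta>) \<partial>count_space A) = _\<close> by simp
  qed
  have "finite_measure \<rho>"
  proof
    have "space \<rho> \<in> dual_borel_sets" using sets.top[of \<rho>] by (simp add: sets_\<rho>)
    from em(2)[OF this] show "emeasure \<rho> (space \<rho>) \<noteq> \<infinity>" by simp
  qed
  moreover have "pure_point_measure \<rho>"
    unfolding pure_point_measure_def
  proof
    fix A assume "A \<in> sets \<rho>"
    then have A: "A \<in> dual_borel_sets" by (simp add: sets_\<rho>)
    have "emeasure \<rho> {\<eta>} = ennreal (d \<eta>)" if "\<eta> \<in> A" for \<eta>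
      using em(1)[OF dual_singleton_measurable[of \<eta>]] that A dual_borel_sets_subset by auto
    then show "emeasure \<rho> A = (\<Sum>\<^sub>\<infinity>\<eta>\<in>A. emeasure \<rho> {\<eta>})"
      unfolding em(1)[OF A] by (intro infsum_cong) simp
  qed
  moreover have "(LINT \<eta>|\<rho>. \<eta> t) = (\<Sum>\<^sub>\<infinity>\<eta>\<in>X. of_real (c \<eta>) * \<eta> t)" for t
  proof -
    have "(LINT \<eta>|\<rho>. \<eta> t) = (LINT \<eta>|N. \<eta> t)"
      unfolding \<rho>_def using measurable_dual_eval[OF S] by (intro integral_distr id_meas)
    also have "\<dots> = (LINT \<eta>|count_space dual_group. d \<eta> *\<^sub>R \<eta> t)"
      unfolding N_def using d0 by (intro integral_density) auto
    also have "\<dots> = infsetsum (\<lambda>\<eta>. d \<eta> *\<^sub>R \<eta> t) dual_group" by (simp add: infsetsum_def)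
    also have "\<dots> = (\<Sum>\<^sub>\<infinity>\<eta>\<in>dual_group. d \<eta> *\<^sub>R \<eta> t)"
    proof (rule infsetsum_infsum)
      have "(\<lambda>\<eta>. norm (d \<eta> *\<^sub>R \<eta> t)) summable_on dual_group \<longleftrightarrow> d summable_on dual_group"
        by (rule summable_on_cong) (simp add: dual_group_def d0)
      with sum_d have "(\<lambda>\<eta>. norm (d \<eta> *\<^sub>R \<eta> t)) summable_on dual_group" by blast
      then show "Infinite_Set_Sum.abs_summable_on (\<lambda>\<eta>. d \<eta> *\<^sub>R \<eta> t) dual_group"
        unfolding abs_summable_equivalent[symmetric] .
    qed
    also have "\<dots> = (\<Sum>\<^sub>\<infinity>\<eta>\<in>X. of_real (c \<eta>) * \<eta> t)"
      using X by (intro infsum_cong_neutral) (auto simp: d_def scaleR_conv_of_real)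
    finally show ?thesis .
  qed
  ultimately show ?thesis using that[OF space_\<rho> sets_\<rho>] by blast
qed

section \<open>Displacement of functions by the group action\<close>

context dyn_system
begin

definition L1_displacement :: "('x \<Rightarrow> complex) \<Rightarrow> 'g \<Rightarrow> real" where
  "L1_displacement f t = (LINT x|m. norm (f x - f (\<alpha> (- t) x)))"

lemma prob_UNIV: "prob UNIV = 1"
  using prob_space by simp

text \<open>Go from the translate of \<open>f\<close> to that of \<open>g\<close>, then to
  \<open>g\<close>, then to \<open>f\<close>. Each use of the squared triangle inequality doubles,
  so the constants are 2 + 4 and 4.\<close>

lemma L2_displacement_le:
  assumes "f \<in> L2_functions m" "g \<in> L2_functions m"
  shows "L2_displacement f t \<le> 6 * L2_distance2 f g + 4 * L2_displacement g t"
proof -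
  let ?T = "\<lambda>f x. f (\<alpha> (- t) x)"
  have L: "?T f \<in> L2_functions m" "?T g \<in> L2_functions m" using assms by (auto intro: L2_action)
  have "(\<lambda>x. (norm (f x - g x))\<^sup>2) \<in> borel_measurable m"
    using L2_measurable[OF L2_diff[OF assms]] by measurable
  then have T: "L2_distance2 (?T f) (?T g) = L2_distance2 f g"
    unfolding L2_distance2_def by (rule integral_action)
  have sym: "L2_distance2 g f = L2_distance2 f g"
    unfolding L2_distance2_def by (simp add: norm_minus_commute)
  have "L2_displacement f t = L2_distance2 (?T f) f" by (simp add: L2_displacement_def L2_distance2_def)
  also have "\<dots> \<le> 2 * L2_distance2 (?T f) (?T g) + 2 * L2_distance2 (?T g) f"
    by (intro L2_distance2_triangle L assms)
  also have "L2_distance2 (?T g) f \<le> 2 * L2_distance2 (?T g) g + 2 * L2_distance2 g f"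
    by (intro L2_distance2_triangle L assms)
  also have "L2_distance2 (?T g) g = L2_displacement g t"
    by (simp add: L2_displacement_def L2_distance2_def)
  finally show ?thesis unfolding T sym by simp
qed

lemma integrable_displacement:
  assumes "continuous_on UNIV (f :: 'x \<Rightarrow> complex)"
  shows "integrable m (\<lambda>x. norm (f (\<alpha> s x) - f (\<alpha> t x)))"
  by (intro integrable_continuous continuous_intros continuous_translate assms)

lemma L1_displacement_0: "L1_displacement f 0 = 0"
  by (simp add: L1_displacement_def action_0)

lemma L1_displacement_add_le:
  assumes f: "continuous_on UNIV f"
  shows "L1_displacement f (s + t) \<le> L1_displacement f s + L1_displacement f t"
proof -
  have i: "integrable m (\<lambda>x. norm (f x - f (\<alpha> t x)))" for t
    using integrable_displacement[OF f, of 0 t] by (simp add: action_0)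
  have add: "\<alpha> (- (s + t)) x = \<alpha> (- t) (\<alpha> (- s) x)" for x
    by (simp only: minus_add action_add)
  have "L1_displacement f (s + t) \<le>
      (LINT x|m. norm (f x - f (\<alpha> (- s) x)) + norm (f (\<alpha> (- s) x) - f (\<alpha> (- t) (\<alpha> (- s) x))))"
    unfolding L1_displacement_def
  proof (rule integral_mono)
    show "norm (f x - f (\<alpha> (- (s + t)) x)) \<le>
        norm (f x - f (\<alpha> (- s) x)) + norm (f (\<alpha> (- s) x) - f (\<alpha> (- t) (\<alpha> (- s) x)))" for x
      unfolding add using norm_triangle_ineq[of "f x - f (\<alpha> (- s) x)" "f (\<alpha> (- s) x) - f (\<alpha> (- t) (\<alpha> (- s) x))"]
      by simp
  qed (use i integrable_action[OF i[of "- t"], of "- s"] in auto)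
  also have "\<dots> = L1_displacement f s + (LINT x|m. norm (f (\<alpha> (- s) x) - f (\<alpha> (- t) (\<alpha> (- s) x))))"
    using i integrable_action[OF i[of "- t"], of "- s"] by (simp add: L1_displacement_def)
  also have "(LINT x|m. norm (f (\<alpha> (- s) x) - f (\<alpha> (- t) (\<alpha> (- s) x)))) = L1_displacement f t"
    unfolding L1_displacement_def
    using integral_action[OF borel_measurable_integrable[OF i[of "- t"]], of "- s"] .
  finally show ?thesis .
qed

lemma eventually_displacement:
  assumes f: "continuous_on UNIV (f :: 'x \<Rightarrow> complex)" and "e > 0"
  shows "\<forall>\<^sub>F u in nhds t. \<forall>y. norm (f (\<alpha> (- u) y) - f (\<alpha> (- t) y)) < e"
  using continuous_compact_uniform_nhds[OF compact_UNIV continuous_action_flip[OF f] assms(2), of t]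
  by (simp add: dist_norm)

lemma L1_displacement_close:
  assumes f: "continuous_on UNIV f" and close: "\<And>y. norm (f (\<alpha> (- u) y) - f (\<alpha> (- t) y)) \<le> e"
  shows "\<bar>L1_displacement f u - L1_displacement f t\<bar> \<le> e"
proof -
  have i: "integrable m (\<lambda>x. norm (f x - f (\<alpha> t x)))" for t
    using integrable_displacement[OF f, of 0 t] by (simp add: action_0)
  have "L1_displacement f u - L1_displacement f t =
      (LINT x|m. norm (f x - f (\<alpha> (- u) x)) - norm (f x - f (\<alpha> (- t) x)))"
    using i by (simp add: L1_displacement_def)
  also have "\<bar>\<dots>\<bar> \<le> (LINT x|m. \<bar>norm (f x - f (\<alpha> (- u) x)) - norm (f x - f (\<alpha> (- t) x))\<bar>)"
    by (rule integral_abs_bound)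
  also have "\<dots> \<le> (LINT x|m. e)"
  proof (rule integral_mono)
    show "\<bar>norm (f x - f (\<alpha> (- u) x)) - norm (f x - f (\<alpha> (- t) x))\<bar> \<le> e" for x
      using norm_triangle_ineq3[of "f x - f (\<alpha> (- u) x)" "f x - f (\<alpha> (- t) x)"] close[of x]
      by (simp add: norm_minus_commute)
  qed (use i in auto)
  finally show ?thesis by (simp add: prob_UNIV)
qed

lemma eventually_L1_displacement:
  assumes f: "continuous_on UNIV f" and "e > 0"
  shows "\<forall>\<^sub>F u in nhds 0. L1_displacement f u < e"
proof -
  have "e / 2 > 0" using assms(2) by simp
  from eventually_displacement[OF f this, of 0] show ?thesis
  proof eventually_elim
    case (elim u)
    then have "\<bar>L1_displacement f u - L1_displacement f 0\<bar> \<le> e / 2"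
      by (intro L1_displacement_close f less_imp_le) auto
    then show ?case using \<open>e > 0\<close> by (simp add: L1_displacement_0)
  qed
qed

text \<open>If \<open>C\<close> bounds \<open>f\<close>, one factor of the square is at most
  \<open>2 * C\<close>.\<close>

lemma L2_displacement_le_L1:
  assumes f: "continuous_on UNIV f"
  obtains C where "C > 0" "\<And>t. L2_displacement f t \<le> C * L1_displacement f t"
proof -
  obtain C where C: "C > 0" "\<And>x. norm (f x) \<le> C" using continuous_bounded[OF f] by blast
  have "L2_displacement f t \<le> 2 * C * L1_displacement f t" for t
  proof -
    have i: "integrable m (\<lambda>x. norm (f x - f (\<alpha> (- t) x)))"
      using integrable_displacement[OF f, of 0 "- t"] by (simp add: action_0)
    have "L2_displacement f t \<le> (LINT x|m. 2 * C * norm (f x - f (\<alpha> (- t) x)))"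
      unfolding L2_displacement_def
    proof (rule integral_mono)
      fix x
      have "norm (f (\<alpha> (- t) x) - f x) \<le> 2 * C"
        using norm_triangle_ineq4[of "f (\<alpha> (- t) x)" "f x"] C(2)[of x] C(2)[of "\<alpha> (- t) x"] by simp
      then show "(norm (f (\<alpha> (- t) x) - f x))\<^sup>2 \<le> 2 * C * norm (f x - f (\<alpha> (- t) x))"
        by (simp add: power2_eq_square norm_minus_commute mult_right_mono)
    next
      show "integrable m (\<lambda>x. (norm (f (\<alpha> (- t) x) - f x))\<^sup>2)"
        by (intro integrable_continuous continuous_intros continuous_translate f)
    qed (use i in auto)
    then show ?thesis by (simp add: L1_displacement_def)
  qed
  then show ?thesis using that[of "2 * C"] C(1) by simp
qed

text \<open>Write \<open>t\<close> as a small-displacement point plus a point of a compact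
  \<open>K\<close>, and cover \<open>K\<close> by finitely many translates of a neighbourhood of 0
  with small displacement. Subadditivity adds the two halves.\<close>

lemma L1_displacement_net:
  assumes f: "continuous_on UNIV f" and "relatively_dense {t. L1_displacement f t < e / 2}" "e > 0"
  shows "\<exists>F. finite F \<and> (\<forall>t. \<exists>s\<in>F. L1_displacement f (t - s) \<le> e)"
proof -
  obtain K where K: "compact K" "(\<Union>a\<in>{t. L1_displacement f t < e / 2}. (+) a ` K) = UNIV"
    using assms(2) unfolding relatively_dense_def by blast
  have "e / 2 > 0" using assms(3) by simp
  from eventually_L1_displacement[OF f this]
  obtain N where N: "open N" "0 \<in> N" "\<And>u. u \<in> N \<Longrightarrow> L1_displacement f u < e / 2"
    unfolding eventually_nhds by blast
  have "K \<subseteq> (\<Union>k\<in>K. (+) k ` N)" using N(2) by force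
  moreover have "open ((+) k ` N)" for k
  proof -
    have "(+) k ` N = (\<lambda>x. x - k) -` N" by (force intro: image_eqI[of _ _ "_ - k"])
    moreover have "open ((\<lambda>x. x - k) -` N)" by (intro open_vimage N(1) continuous_intros)
    ultimately show ?thesis by simp
  qed
  ultimately obtain F where F: "F \<subseteq> K" "finite F" "K \<subseteq> (\<Union>k\<in>F. (+) k ` N)"
    using compactE_image[OF K(1), of K "\<lambda>k. (+) k ` N"] by metis
  have "\<exists>s\<in>F. L1_displacement f (t - s) \<le> e" for t
  proof -
    have "t \<in> (\<Union>a\<in>{t. L1_displacement f t < e / 2}. (+) a ` K)" using K(2) by simp
    then obtain a k' where a: "L1_displacement f a < e / 2" "k' \<in> K" "t = a + k'" by blast
    then obtain k n where k: "k \<in> F" "n \<in> N" "k' = k + n" using F(3) by blast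
    have "t - k = a + n" using a k by simp
    then have "L1_displacement f (t - k) \<le> e"
      using L1_displacement_add_le[OF f, of a n] a(1) N(3)[OF k(2)] by simp
    then show ?thesis using k(1) by blast
  qed
  then show ?thesis using F(2) by blast
qed

text \<open>If the finitely many characters carrying nearly all the mass are close to 1 at
  \<open>t\<close>, the integral of \<open>Re (\<eta> 0) - Re (\<eta> t)\<close> is small: the
  integrand is at most \<delta> on \<open>F\<close> and at most 2 elsewhere.\<close>

lemma relatively_dense_displacement:
  assumes f: "continuous_on UNIV f"
    and \<rho>: "is_spectral_measure \<alpha> m f \<rho>" "pure_point_measure \<rho>" and \<epsilon>: "\<epsilon> > 0"
  shows "relatively_dense {t. L1_displacement f t < \<epsilon>}"
proof -
  note f2 = L2_continuous[OF f]
  have space_\<rho>: "space \<rho> = dual_group" and sets_\<rho>: "sets \<rho> = dual_borel_sets"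
    and fin: "finite_measure \<rho>" and corr: "correlation f t = (LINT \<eta>|\<rho>. \<eta> t)" for t
    using \<rho>(1) unfolding is_spectral_measure_def correlation_def by auto
  interpret \<rho>: finite_measure \<rho> by fact
  note [measurable] = measurable_dual_eval[OF space_\<rho> sets_\<rho>]
  define M where "M = measure \<rho> (space \<rho>) + 1"
  have M: "M > 0" by (simp add: M_def add_nonneg_pos)
  \<comment> \<open>With mass below \<open>\<epsilon>\<^sup>2 / 16\<close> outside \<open>F\<close>,
    both contributions are at most \<open>\<epsilon>\<^sup>2 / 8\<close>, which makes the squared
    displacement less than \<open>\<epsilon>\<^sup>2 / 2\<close>.\<close>
  define \<delta> where "\<delta> = \<epsilon>\<^sup>2 / (8 * M)"
  have \<delta>: "\<delta> > 0" using \<epsilon> M by (simp add: \<delta>_def)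
  have sing: "{x} \<in> sets \<rho>" if "x \<in> space \<rho>" for x
    using dual_singleton_measurable that by (simp add: space_\<rho> sets_\<rho>)
  obtain F where F: "finite F" "F \<subseteq> space \<rho>" "measure \<rho> (space \<rho> - F) < \<epsilon>\<^sup>2 / 16"
    using pure_point_finite_concentration[OF fin \<rho>(2) _ sing, of "\<epsilon>\<^sup>2 / 16"] \<epsilon> by auto
  have Fm: "F \<in> sets \<rho>" using sets.countable[of F \<rho>] F(1,2) sing by (auto simp: countable_finite)
  have ind: "integrable \<rho> (indicator (space \<rho> - F) :: _ \<Rightarrow> real)"
    using Fm by (intro integrable_real_indicator) (auto simp: \<rho>.emeasure_eq_measure)
  have int: "integrable \<rho> (\<lambda>\<eta>. \<eta> t)" for t
    by (rule \<rho>.integrable_const_bound[of _ 1]) (auto simp: space_\<rho> dual_group_def intro!: AE_I2)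
  have "L1_displacement f t < \<epsilon>" if t: "\<And>\<eta>. \<eta> \<in> F \<Longrightarrow> norm (\<eta> t - 1) \<le> \<delta>" for t
  proof -
    have "L2_displacement f t / 2 = Re (LINT \<eta>|\<rho>. \<eta> 0) - Re (LINT \<eta>|\<rho>. \<eta> t)"
      using correlation_displacement[OF f2, of t] by (simp add: corr)
    also have "\<dots> = (LINT \<eta>|\<rho>. Re (\<eta> 0) - Re (\<eta> t))"
      using int by simp
    also have "\<dots> \<le> (LINT \<eta>|\<rho>. \<delta> + 2 * indicator (space \<rho> - F) \<eta>)"
    proof (rule integral_mono)
      show "Re (\<eta> 0) - Re (\<eta> t) \<le> \<delta> + 2 * indicator (space \<rho> - F) \<eta>" if "\<eta> \<in> space \<rho>" for \<eta>
      proof -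
        have \<eta>: "character \<eta>" using that by (simp add: space_\<rho> dual_group_character)
        show ?thesis
        proof (cases "\<eta> \<in> F")
          case True
          have "Re (1 - \<eta> t) \<le> norm (\<eta> t - 1)"
            by (metis complex_Re_le_cmod norm_minus_commute)
          then show ?thesis using True t[OF True] by (simp add: character_0[OF \<eta>])
        next
          case False
          have "- Re (\<eta> t) \<le> 1" using abs_Re_le_cmod[of "\<eta> t"] by (simp add: norm_character[OF \<eta>])
          then show ?thesis using False that \<delta> by (simp add: character_0[OF \<eta>])
        qed
      qed
    qed (use int ind in auto)
    also have "\<dots> = \<delta> * measure \<rho> (space \<rho>) + 2 * measure \<rho> (space \<rho> - F)"
      using Fm ind by (simp add: mult.commute)
    also have "\<dots> < \<epsilon>\<^sup>2 / 4"
    proof -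
      have "\<delta> * measure \<rho> (space \<rho>) \<le> \<delta> * M" using \<delta> by (simp add: M_def)
      also have "\<delta> * M = \<epsilon>\<^sup>2 / 8" using M by (simp add: \<delta>_def)
      finally show ?thesis using F(3) by simp
    qed
    finally have L2: "L2_displacement f t < \<epsilon>\<^sup>2 / 2" by simp
    \<comment> \<open>A pointwise arithmetic-geometric inequality takes the place of Cauchy-Schwarz;
      the final bound is three quarters of \<epsilon>.\<close>
    have "L1_displacement f t \<le> (LINT x|m. \<epsilon> / 2 + 1 / (2 * \<epsilon>) * (norm (f (\<alpha> (- t) x) - f x))\<^sup>2)"
      unfolding L1_displacement_def
    proof (rule integral_mono)
      fix x
      let ?a = "norm (f (\<alpha> (- t) x) - f x)"
      have "2 * \<epsilon> * ?a \<le> \<epsilon>\<^sup>2 + ?a\<^sup>2" by (rule sum_squares_bound)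
      then have "?a \<le> (\<epsilon>\<^sup>2 + ?a\<^sup>2) / (2 * \<epsilon>)" using \<epsilon> by (simp add: field_simps)
      also have "\<dots> = \<epsilon> / 2 + 1 / (2 * \<epsilon>) * ?a\<^sup>2" using \<epsilon> by (simp add: field_simps power2_eq_square)
      finally show "norm (f x - f (\<alpha> (- t) x)) \<le> \<epsilon> / 2 + 1 / (2 * \<epsilon>) * ?a\<^sup>2"
        by (simp add: norm_minus_commute)
    qed (intro integrable_continuous continuous_intros continuous_translate f)+
    also have "\<dots> = \<epsilon> / 2 + 1 / (2 * \<epsilon>) * L2_displacement f t"
    proof -
      have "integrable m (\<lambda>x. (norm (f (\<alpha> (- t) x) - f x))\<^sup>2)"
        by (intro integrable_continuous continuous_intros continuous_translate f)
      then show ?thesis by (simp add: L2_displacement_def prob_UNIV)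
    qed
    also have "\<dots> < \<epsilon> / 2 + 1 / (2 * \<epsilon>) * (\<epsilon>\<^sup>2 / 2)"
      using L2 \<epsilon> by (intro add_strict_left_mono mult_strict_left_mono) auto
    also have "\<dots> \<le> \<epsilon>" using \<epsilon> by (simp add: field_simps power2_eq_square)
    finally show ?thesis .
  qed
  then show ?thesis
    by (intro relatively_dense_mono[OF finite_characters_return[OF F(1) _ \<delta>]])
      (use F(2) in \<open>auto simp: space_\<rho>\<close>)
qed

text \<open>The expansion of the correlation function supplies the atoms and masses. As
  \<open>f\<close> is merely square integrable, total boundedness of the gauge and its smallness
  near 0 are both transferred from continuous approximants.\<close>

lemma ex_pure_point_spectral_measure:
  assumes dense: "\<And>g e. continuous_on UNIV g \<Longrightarrow> e > 0 \<Longrightarrow> relatively_dense {t. L1_displacement g t < e}"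
    and f: "f \<in> L2_functions m"
  shows "\<exists>\<rho>. is_spectral_measure \<alpha> m f \<rho> \<and> pure_point_measure \<rho>"
proof -
  define \<theta> where "\<theta> t = Re (correlation f 0) - Re (correlation f t)" for t
  have \<theta>: "\<theta> t = L2_displacement f t / 2" for t
    by (simp add: \<theta>_def correlation_displacement[OF f])
  have \<theta>0: "0 \<le> \<theta> t" for t by (simp add: \<theta> L2_displacement_def)
  have approx: "\<exists>g C. continuous_on UNIV g \<and> C > 0 \<and> (\<forall>t. \<theta> t \<le> \<epsilon> + C * L1_displacement g t)"
    if \<epsilon>: "\<epsilon> > 0" for \<epsilon>
  proof -
    \<comment> \<open>Half of the coefficient 6 in \<open>L2_displacement_le\<close> is 3, so this
      distance costs at most \<epsilon>.\<close>
    obtain g where g: "continuous_on UNIV g" "L2_distance2 f g < \<epsilon> / 3"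
      using L2_continuous_approx[OF f, of "\<epsilon> / 3"] \<epsilon> by auto
    obtain C where C: "C > 0" "\<And>t. L2_displacement g t \<le> C * L1_displacement g t"
      using L2_displacement_le_L1[OF g(1)] by blast
    have "\<theta> t \<le> \<epsilon> + 2 * C * L1_displacement g t" for t
      using L2_displacement_le[OF f L2_continuous[OF g(1)], of t] C(2)[of t] g(2) by (simp add: \<theta>)
    then show ?thesis using g(1) C(1) by (intro exI[of _ g] exI[of _ "2 * C"]) simp
  qed
  interpret totally_bounded_gauge \<theta>
  proof
    show "0 \<le> \<theta> t" for t by (rule \<theta>0)
    fix \<epsilon> :: real assume \<epsilon>: "\<epsilon> > 0"
    then obtain g C where g: "continuous_on UNIV g" "C > 0" "\<And>t. \<theta> t \<le> \<epsilon> / 2 + C * L1_displacement g t"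
      using approx[of "\<epsilon> / 2"] by auto
    have e: "\<epsilon> / (2 * C) > 0" using g(2) \<epsilon> by simp
    then obtain F where F: "finite F" "\<And>t. \<exists>s\<in>F. L1_displacement g (t - s) \<le> \<epsilon> / (2 * C)"
      using L1_displacement_net[OF g(1) dense[OF g(1)] e] by auto
    have "\<exists>s\<in>F. \<theta> (t - s) \<le> \<epsilon>" for t
    proof -
      obtain s where s: "s \<in> F" "L1_displacement g (t - s) \<le> \<epsilon> / (2 * C)" using F(2) by blast
      then have "C * L1_displacement g (t - s) \<le> \<epsilon> / 2" using g(2) by (simp add: field_simps)
      then show ?thesis using g(3)[of "t - s"] s(1) by (intro bexI[of _ s]) auto
    qed
    then show "\<exists>F. finite F \<and> (\<forall>t. \<exists>s\<in>F. \<theta> (t - s) \<le> \<epsilon>)" using F(1) by blast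
  qed
  let ?C = "max 1 (Re (correlation f 0))"
  have "\<theta> t \<le> ?C * \<theta> t" for t
    using mult_right_mono[OF max.cobounded1 \<theta>0[of t], of 1 "Re (correlation f 0)"] by simp
  then have "correlation f \<in> dominated ?C"
    unfolding dominated_def by (simp add: pos_def_correlation[OF f] flip: \<theta>_def)
  from pos_def_character_expansion[OF this] obtain X c where
    X: "\<And>\<eta>. \<eta> \<in> X \<Longrightarrow> character \<eta> \<and> gauge_continuous \<eta> \<and> 0 \<le> c \<eta>" and
    sum: "\<And>t. ((\<lambda>\<eta>. complex_of_real (c \<eta>) * \<eta> t) has_sum correlation f t) X" by blast
  \<comment> \<open>This turns continuity with respect to the gauge into continuity for the topology
    of the group, placing the characters of \<open>X\<close> in the dual group.\<close>
  have \<theta>_small: "\<forall>\<^sub>F u in nhds 0. \<theta> u < \<delta>" if \<delta>: "\<delta> > 0" for \<delta>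
  proof -
    obtain g C where g: "continuous_on UNIV g" "C > 0" "\<And>t. \<theta> t \<le> \<delta> / 2 + C * L1_displacement g t"
      using approx[of "\<delta> / 2"] \<delta> by auto
    have "\<delta> / (2 * C) > 0" using g(2) \<delta> by simp
    from eventually_L1_displacement[OF g(1) this] show ?thesis
    proof eventually_elim
      case (elim u)
      then have "C * L1_displacement g u < \<delta> / 2" using g(2) by (simp add: field_simps)
      then show ?case using g(3)[of u] by simp
    qed
  qed
  have "X \<subseteq> dual_group"
  proof
    fix \<eta> assume \<eta>X: "\<eta> \<in> X"
    then have \<eta>: "character \<eta>" "gauge_continuous \<eta>" using X by auto
    have "(\<eta> \<longlongrightarrow> \<eta> t) (at t)" for t
    proof (rule tendstoI)
      fix e :: real assume e: "e > 0"
      then obtain \<delta> where \<delta>: "\<delta> > 0" "\<And>s t. \<theta> (s - t) \<le> \<delta> \<Longrightarrow> norm (\<eta> s - \<eta> t) \<le> e / 2"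
        using gauge_continuousD[OF \<eta>(2), of "e / 2"] by auto
      have "((\<lambda>s. s - t) \<longlongrightarrow> t - t) (at t)" by (intro tendsto_intros)
      then have "filterlim (\<lambda>s. s - t) (nhds 0) (at t)" by simp
      from filterlim_iff[THEN iffD1, OF this, rule_format, OF \<theta>_small[OF \<delta>(1)]]
      show "\<forall>\<^sub>F s in at t. dist (\<eta> s) (\<eta> t) < e"
      proof eventually_elim
        case (elim s)
        then show ?case using \<delta>(2)[of s t] e by (simp add: dist_norm)
      qed
    qed
    then have "continuous_on UNIV \<eta>" by (simp add: continuous_on_def)
    then show "\<eta> \<in> dual_group" using \<eta>(1) by (simp add: dual_group_def character_def)
  qed
  moreover have "c summable_on X"
  proof -
    have "((\<lambda>\<eta>. complex_of_real (c \<eta>)) has_sum correlation f 0) X"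
      using sum[of 0] X by (simp add: character_0 cong: has_sum_cong)
    from has_sum_Re[OF this] show ?thesis by (auto simp: summable_on_def)
  qed
  ultimately obtain \<rho> where \<rho>: "space \<rho> = dual_group" "sets \<rho> = dual_borel_sets" "finite_measure \<rho>"
    "pure_point_measure \<rho>" "\<And>t. (LINT \<eta>|\<rho>. \<eta> t) = (\<Sum>\<^sub>\<infinity>\<eta>\<in>X. of_real (c \<eta>) * \<eta> t)"
    using ex_pure_point_measure[of X c] X by blast
  have "(LINT \<eta>|\<rho>. \<eta> t) = correlation f t" for t
    unfolding \<rho>(5) using sum[of t] by (rule infsumI)
  then have "is_spectral_measure \<alpha> m f \<rho>"
    using \<rho>(1-3) by (simp add: is_spectral_measure_def correlation_def)
  with \<rho>(4) show ?thesis by blast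
qed

end

section \<open>Mean almost periodicity of typical orbits\<close>

lemma set_integral_close:
  fixes f g :: "'a \<Rightarrow> real"
  assumes A: "A \<in> sets M" "emeasure M A < \<infinity>"
    and f: "f \<in> borel_measurable M" "\<And>x. \<bar>f x\<bar> \<le> C" and g: "g \<in> borel_measurable M" "\<And>x. \<bar>g x\<bar> \<le> C"
    and close: "\<And>x. \<bar>f x - g x\<bar> \<le> e"
  shows "\<bar>(LINT x:A|M. f x) - (LINT x:A|M. g x)\<bar> \<le> e * measure M A"
proof -
  have i: "integrable M (\<lambda>x. indicator A x *\<^sub>R f x)" "integrable M (\<lambda>x. indicator A x *\<^sub>R g x)"
    using integrableI_bounded_set_indicator[where B = C, OF A(1) f(1) A(2)]
      integrableI_bounded_set_indicator[where B = C, OF A(1) g(1) A(2)] f(2) g(2) by simp_all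
  have "(LINT x:A|M. f x) - (LINT x:A|M. g x) = (LINT x|M. indicator A x *\<^sub>R (f x - g x))"
    unfolding set_lebesgue_integral_def scaleR_diff_right
    by (rule Bochner_Integration.integral_diff[OF i, symmetric])
  also have "\<bar>\<dots>\<bar> \<le> (LINT x|M. \<bar>indicator A x *\<^sub>R (f x - g x)\<bar>)" by (rule integral_abs_bound)
  also have "\<dots> \<le> (LINT x|M. e * indicator A x)"
  proof (rule integral_mono)
    show "integrable M (\<lambda>x. \<bar>indicator A x *\<^sub>R (f x - g x)\<bar>)"
      unfolding scaleR_diff_right by (intro integrable_abs Bochner_Integration.integrable_diff i)
    show "\<bar>indicator A x *\<^sub>R (f x - g x)\<bar> \<le> e * indicator A x" for x
      using close[of x] by (simp add: indicator_def)
  qed (use A in simp)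
  also have "\<dots> = e * measure M A" using A by simp
  finally show ?thesis .
qed

lemma tendsto_of_uniform_approx:
  fixes a :: "nat \<Rightarrow> real"
  assumes "\<And>e. e > 0 \<Longrightarrow> \<exists>b m. b \<longlonglongrightarrow> m \<and> (\<forall>n. \<bar>a n - b n\<bar> \<le> e) \<and> \<bar>l - m\<bar> \<le> e"
  shows "a \<longlonglongrightarrow> l"
proof (rule tendstoI)
  fix e :: real assume "e > 0"
  then obtain b m where b: "b \<longlonglongrightarrow> m" "\<And>n. \<bar>a n - b n\<bar> \<le> e / 4" "\<bar>l - m\<bar> \<le> e / 4"
    using assms[of "e / 4"] by auto
  have "\<forall>\<^sub>F n in sequentially. dist (b n) m < e / 4" using b(1) \<open>e > 0\<close> by (intro tendstoD) auto
  then show "\<forall>\<^sub>F n in sequentially. dist (a n) l < e"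
  proof eventually_elim
    case (elim n)
    then show ?case using b(2)[of n] b(3) \<open>e > 0\<close> unfolding dist_real_def by linarith
  qed
qed

context dyn_system
begin

lemma orbit_uniformly_continuous:
  assumes "continuous_on UNIV f"
  shows "group_uniformly_continuous (\<lambda>t. f (\<alpha> (- t) x))"
  unfolding group_uniformly_continuous_def
proof (intro allI impI)
  fix \<epsilon> :: real assume "\<epsilon> > 0"
  from eventually_displacement[OF assms this, of 0]
  show "\<forall>\<^sub>F u in nhds 0. \<forall>t. norm (f (\<alpha> (- (t + u)) x) - f (\<alpha> (- t) x)) < \<epsilon>"
    by eventually_elim (simp only: minus_add action_add minus_zero action_0 simp_thms)
qed

text \<open>The Birkhoff theorem gives one null set per \<open>t\<close>; a countable dense set
  leaves a single one. For \<open>d\<close> near \<open>t\<close> the translates of \<open>f\<close>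
  are uniformly close, so the averages differ little, uniformly in \<open>n\<close> and
  \<open>x\<close>, and convergence passes from \<open>d\<close> to \<open>t\<close>.\<close>

lemma AE_upper_mean:
  fixes mG :: "'g measure"
  assumes f: "continuous_on UNIV f" and birkhoff: "birkhoff_along mG B \<alpha> m"
    and sets_mG: "sets mG = sets borel" and B: "\<And>n. B n \<in> sets mG" "\<And>n. emeasure mG (B n) < \<infinity>"
    and pos: "\<And>n. measure mG (B n) > 0"
    and D: "countable D" "\<forall>U :: 'g set. open U \<longrightarrow> U \<noteq> {} \<longrightarrow> (\<exists>d\<in>D. d \<in> U)"
  shows "AE x in m. \<forall>t. upper_mean mG B (\<lambda>s. f (\<alpha> (- s) x) - f (\<alpha> (- (t + s)) x)) =
    ereal (L1_displacement f t)"
proof -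
  define a where "a x t n = (LINT s:B n|mG. norm (f (\<alpha> (- s) x) - f (\<alpha> (- (t + s)) x))) / measure mG (B n)"
    for x t n
  \<comment> \<open>By commutativity the integrand is the function
    \<open>norm (f y - f (\<alpha> (- t) y))\<close> evaluated along the orbit of \<open>x\<close>,
    so \<open>a x t n\<close> is a Birkhoff average.\<close>
  have shift: "\<alpha> (- (t + s)) x = \<alpha> (- t) (\<alpha> (- s) x)" for s t x
    using action_add[of "- t" "- s" x] by (simp add: add.commute)
  have conv: "AE x in m. a x t \<longlonglongrightarrow> L1_displacement f t" for t
  proof -
    let ?F = "\<lambda>y. complex_of_real (norm (f y - f (\<alpha> (- t) y)))"
    have "integrable m ?F" by (intro integrable_continuous continuous_intros continuous_translate f)
    then have "AE x in m. (\<lambda>n. (LINT s:B n|mG. ?F (\<alpha> (- s) x)) /\<^sub>R measure mG (B n)) \<longlonglongrightarrow> (LINT y|m. ?F y)"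
      using birkhoff unfolding birkhoff_along_def by blast
    moreover have "(LINT s:B n|mG. ?F (\<alpha> (- s) x)) /\<^sub>R measure mG (B n) = complex_of_real (a x t n)" for x n
      unfolding set_integral_complex_of_real a_def shift
      by (simp add: scaleR_conv_of_real divide_inverse mult.commute)
    moreover have "(LINT y|m. ?F y) = complex_of_real (L1_displacement f t)"
      unfolding L1_displacement_def by (rule integral_complex_of_real)
    ultimately show ?thesis by (simp add: tendsto_of_real_iff)
  qed
  obtain C where C: "\<And>x. norm (f x) \<le> C" using continuous_bounded[OF f] by blast
  have close: "\<bar>a x t n - a x d n\<bar> \<le> e"
    if e: "\<And>y. norm (f (\<alpha> (- t) y) - f (\<alpha> (- d) y)) \<le> e" for x t d n e
  proof -
    let ?h = "\<lambda>t s. norm (f (\<alpha> (- s) x) - f (\<alpha> (- (t + s)) x))"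
    have meas: "?h t \<in> borel_measurable mG" for t
    proof -
      have "continuous_on UNIV (?h t)"
        unfolding shift
        by (intro continuous_intros continuous_orbit f continuous_orbit[OF continuous_translate[OF f]])
      then show ?thesis
        using borel_measurable_continuous_onI by (simp add: measurable_cong_sets[OF sets_mG refl])
    qed
    have bound: "\<bar>?h t s\<bar> \<le> 2 * C" for t s
      using norm_triangle_ineq4[of "f (\<alpha> (- s) x)" "f (\<alpha> (- (t + s)) x)"] C[of "\<alpha> (- s) x"]
        C[of "\<alpha> (- (t + s)) x"] by simp
    have diff: "\<bar>?h t s - ?h d s\<bar> \<le> e" for s
      using norm_triangle_ineq3[of "f (\<alpha> (- s) x) - f (\<alpha> (- (t + s)) x)"
          "f (\<alpha> (- s) x) - f (\<alpha> (- (d + s)) x)"] e[of "\<alpha> (- s) x"]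
      unfolding shift by (simp add: norm_minus_commute)
    have "\<bar>(LINT s:B n|mG. ?h t s) - (LINT s:B n|mG. ?h d s)\<bar> \<le> e * measure mG (B n)"
      by (rule set_integral_close[OF B meas bound meas bound diff])
    then show ?thesis
      using pos[of n] by (simp add: a_def diff_divide_distrib[symmetric] abs_divide pos_divide_le_eq)
  qed
  have "AE x in m. \<forall>d\<in>D. a x d \<longlonglongrightarrow> L1_displacement f d"
    using conv D(1) by (intro AE_ball_countable')
  then show ?thesis
  proof eventually_elim
    case (elim x)
    show ?case
    proof
      fix t
      have "a x t \<longlonglongrightarrow> L1_displacement f t"
      proof (rule tendsto_of_uniform_approx)
        fix e :: real assume "e > 0"
        from eventually_displacement[OF f this, of t] obtain U where U: "open U" "t \<in> U"
          "\<And>u y. u \<in> U \<Longrightarrow> norm (f (\<alpha> (- u) y) - f (\<alpha> (- t) y)) < e"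
          unfolding eventually_nhds by blast
        then obtain d where d: "d \<in> D" "d \<in> U" using D(2) by blast
        have e: "norm (f (\<alpha> (- t) y) - f (\<alpha> (- d) y)) \<le> e" for y
          using U(3)[OF d(2), of y] by (simp add: norm_minus_commute)
        show "\<exists>b m. b \<longlonglongrightarrow> m \<and> (\<forall>n. \<bar>a x t n - b n\<bar> \<le> e) \<and> \<bar>L1_displacement f t - m\<bar> \<le> e"
          using elim d(1) close[OF e] L1_displacement_close[OF f e] by blast
      qed
      then have "(\<lambda>n. ereal (a x t n)) \<longlonglongrightarrow> ereal (L1_displacement f t)" by simp
      then show "upper_mean mG B (\<lambda>s. f (\<alpha> (- s) x) - f (\<alpha> (- (t + s)) x)) = ereal (L1_displacement f t)"
        unfolding upper_mean_def a_def by (intro lim_imp_Limsup) auto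
    qed
  qed
qed

end

theorem theorem5p2:
  fixes mG :: "'g::{topological_ab_group_add, t2_space, second_countable_topology} measure"
    and B :: "nat \<Rightarrow> 'g set"
    and \<alpha> :: "'g \<Rightarrow> 'x::t2_space \<Rightarrow> 'x"
    and m :: "'x measure"
  assumes "locally_compact_space (euclidean :: 'g topology)"
    and "sigma_compact_space TYPE('g)"
    and "haar_measure mG"
    and "ergodic_system \<alpha> m"
    and "van_hove_sequence mG B"
    and "birkhoff_along mG B \<alpha> m"
  shows "discrete_spectrum \<alpha> m \<longleftrightarrow>
    (\<forall>f :: 'x \<Rightarrow> complex. continuous_on UNIV f \<longrightarrow>
       (AE x in m. mean_almost_periodic mG B (\<lambda>t. f (\<alpha> (- t) x))))"
proof -
  interpret dyn_system \<alpha> m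
    using assms(4) by unfold_locales (simp add: ergodic_system_def)
  obtain D :: "'g set" where D: "countable D" "\<forall>U. open U \<longrightarrow> U \<noteq> {} \<longrightarrow> (\<exists>d\<in>D. d \<in> U)"
    by (rule countable_dense_setE) blast
  have radon: "radon_measure mG" using assms(3) by (simp add: haar_measure_def)
  then have sets_mG: "sets mG = sets borel" by (simp add: radon_measure_def)
  have cB: "compact (B n)" and pos: "measure mG (B n) > 0" for n
    using assms(5) by (auto simp: van_hove_sequence_def)
  have B: "B n \<in> sets mG" "emeasure mG (B n) < \<infinity>" for n
    using radon cB[of n] by (auto simp: sets_mG radon_measure_def intro: borel_compact)
  have iff: "AE x in m. mean_almost_periodic mG B (\<lambda>t. f (\<alpha> (- t) x)) \<longleftrightarrow>
      (\<forall>\<epsilon>>0. relatively_dense {t. L1_displacement f t < \<epsilon>})" if f: "continuous_on UNIV f" for f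
    using AE_upper_mean[OF f assms(6) sets_mG B pos D]
  proof eventually_elim
    case (elim x)
    obtain C where "\<And>x. norm (f x) \<le> C" using continuous_bounded[OF f] by blast
    then have "bounded (range (\<lambda>t. f (\<alpha> (- t) x)))" by (intro boundedI[of _ C]) auto
    then show ?case
      unfolding mean_almost_periodic_def using elim orbit_uniformly_continuous[OF f] by simp
  qed
  \<comment> \<open>The right-hand side does not involve \<open>x\<close>, and in a probability
    space a constant statement holds almost everywhere just when it holds.\<close>
  have "(AE x in m. mean_almost_periodic mG B (\<lambda>t. f (\<alpha> (- t) x))) \<longleftrightarrow>
      (\<forall>\<epsilon>>0. relatively_dense {t. L1_displacement f t < \<epsilon>})" if f: "continuous_on UNIV f" for f
    using eventually_subst[OF iff[OF f]] by simp
  \<comment> \<open>Forwards, each continuous \<open>f\<close> uses its own spectral measure.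
    Backwards, one square integrable \<open>f\<close> draws on the almost periodicity of the
    continuous functions approximating it.\<close>
  then show ?thesis
    using relatively_dense_displacement ex_pure_point_spectral_measure L2_continuous
    unfolding discrete_spectrum_def by blast
qed

end
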